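(* Let $\mathbf t,\mathbf k\in\mathbb N^n$ and $\mathbf r\in[\mathbf 0,\mathbf t]$. Suppose $\mathbf u,\mathbf v\in\mathbb N^n$ with $\mathbf 0\le\mathbf u\le\mathbf v\le\mathbf t$ and $\gamma\in\mathbb Z$ are such that the cohomology of the complex $\mathcal N^{\mathbf k+\mathbf 1}_{\mathbf t}\big(K_{\mathbf t}\{\mathbf t-\mathbf r,\mathbf t\}\big)$ is concentrated in cohomological degree $\gamma+n$, where it is isomorphic to $K_{\mathbf t}\{\mathbf t-\mathbf v,\mathbf t-\mathbf u\}$. Then for every positively $\mathbf t$-determined monomial ideal $I\subseteq S$ and every $i\in\mathbb Z$ there is an isomorphism of $K$-vector spaces $$H^i\big(\mathcal N^{\mathbf k}_{\mathbf t}(S/I)\big)_{\mathbf r}\cong \widetilde H^{\,i-\gamma-1}\big(\Delta^{\mathbf v}_{\mathbf u}(S/I;\mathbf t)\big).$$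
   Context: $K$ is a field and $S=K[x_1,\dots,x_n]$ with its $\mathbb Z^n$-grading ($\deg x_i=\varepsilon_i$, the $i$-th unit vector); $\mathbf 1=(1,\dots,1)$; $\le$ on $\mathbb Z^n$ is componentwise and $[\mathbf a,\mathbf b]=\{\mathbf x:\mathbf a\le\mathbf x\le\mathbf b\}$. Write $x^{\mathbf a}=\prod_i x_i^{a_i}$ and $\mathfrak m^{\mathbf a}$ for the ideal generated by the $x_i^{a_i}$ with $a_i\ge1$. All modules are $\mathbb Z^n$-graded; an $\mathbb N^n$-graded module is regarded as zero in degrees outside $\mathbb N^n$; $M(\mathbf a)_{\mathbf r}=M_{\mathbf a+\mathbf r}$. For $\mathbf t\in\mathbb N^n$, an $\mathbb N^n$-graded $S$-module $M$ is positively $\mathbf t$-determined if $x_i:M_{\mathbf a}\to M_{\mathbf a+\varepsilon_i}$ is bijective whenever $a_i\ge t_i$; a monomial ideal $I$ is positively $\mathbf t$-determined if every minimal monomial generator $x^{\mathbf a}$ of $I$ satisfies $\mathbf a\le\mathbf t$ (equivalently $S/I$ is positively $\mathbf t$-determined). For an order-preserving map $q:\mathbb N^n\to\mathbb Z^n$ and a graded module $M$, $q^*M$ is the $\mathbb N^n$-graded module with $(q^*M)_{\mathbf a}=M_{q(\mathbf a)}$ for $\mathbf a\in\mathbb N^n$, where $x^{\mathbf b}:(q^*M)_{\mathbf a}\to(q^*M)_{\mathbf a+\mathbf b}$ is multiplication by $x^{q(\mathbf a+\mathbf b)-q(\mathbf a)}$ on $M$; $q^*$ is applied degreewise to complexes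 and is exact. Let $p_{\mathbf t}(\mathbf a)=(\min(a_1,t_1),\dots,\min(a_n,t_n))$. For $\mathbf a\le\mathbf b\le\mathbf t$ in $\mathbb N^n$ the interval module is $K_{\mathbf t}\{\mathbf a,\mathbf b\}=p_{\mathbf t}^*\big((S/\mathfrak m^{\mathbf b-\mathbf a+\mathbf 1})(-\mathbf a)\big)$ (for $\mathbf r\in[\mathbf 0,\mathbf t]$ its degree-$\mathbf r$ part is $K$ if $\mathbf r\in[\mathbf a,\mathbf b]$ and $0$ otherwise); by convention $K_{\mathbf t}\{\mathbf a,\mathbf b\}=0$ if $\mathbf a\not\le\mathbf b$. Complexes are chain complexes (differential lowers degree), $H^iC:=H_{-i}C$, and $T$ is the shift $(TC)_i=C_{i-1}$, $d_{TC}=-d_C$; $\underline{\operatorname{Hom}}_S$ is graded Hom (total complex for complexes). Nakayama functor: for $t\ge0$ let $P_{t\varepsilon_j}$ be the complex $x_j^tS\hookrightarrow S$ with $S$ in degree $0$; for $\mathbf t\in\mathbb N^n$ and $\mathbf k\in\{0,1\}^n$ let $P^{\mathbf k}_{\mathbf t}=\bigotimes_{j=1}^n P_{t_j\varepsilon_j}^{\otimes k_j}$ (tensor over $S$, zeroth power $=S$), and for a complex $C$ of positively $\mathbf t$-determined modules set $\mathcal N^{\mathbf k}_{\mathbf t}(C)=p_{\mathbf t}^*\underline{\operatorname{Hom}}_S(P^{\mathbf k}_{\mathbf t+\mathbf 1},C(-\mathbf k))$. For general $\mathbf k\in\mathbb N^n$, $\mathcal N^{\mathbf k}_{\mathbf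 t}=(\mathcal N^{\varepsilon_1}_{\mathbf t})^{\circ k_1}\circ\cdots\circ(\mathcal N^{\varepsilon_n}_{\mathbf t})^{\circ k_n}$. Simplicial complexes: for a positively $\mathbf t$-determined monomial ideal $I$ and $\mathbf a,\mathbf b\in\mathbb N^n$ with $\mathbf b\le\mathbf t$, $\mathbf a\le\mathbf b+\mathbf 1$, $\Delta^{\mathbf b}_{\mathbf a}(S/I;\mathbf t)$ is the simplicial complex on vertex set $\{1,\dots,n\}$ whose faces are the subsets $F$ such that $\mathbf x_F=\sum_{i\notin F}a_i\varepsilon_i+\sum_{i\in F}(b_i+1)\varepsilon_i$ satisfies $\mathbf x_F\le\mathbf t$ and $(S/I)_{\mathbf x_F}\ne0$. $\widetilde H^*$ denotes reduced simplicial cohomology with coefficients in $K$; the complex $\{\emptyset\}$ has $\widetilde H^{-1}=K$, and a complex with no faces has all reduced cohomology zero. *)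

theory Defs
  imports Main
begin

text \<open>
  Concrete model.  Multidegrees in N^n are functions deg = nat => nat that vanish
  at indices >= n (variables are indexed 0..n-1).  Every graded piece of every
  module/complex is a K-subspace of the universe type nat => 'k (K = the field 'k).
  A complex of Z^n-graded S-modules is given by its pieces sp m a (homological
  degree m, multidegree a), its differential dif m a : C_{m,a} -> C_{m-1,a} and
  the action mulx i m a : C_{m,a} -> C_{m,a+e_i} of the variable x_i.
\<close>

type_synonym deg = "nat \<Rightarrow> nat"
type_synonym 'k vec = "nat \<Rightarrow> 'k"

definition Dn :: "nat \<Rightarrow> deg set" where
  "Dn n = {a. \<forall>i\<ge>n. a i = 0}"

definition onesv :: "nat \<Rightarrow> deg" where
  "onesv n = (\<lambda>i. if i < n then 1 else 0)"

definition unitv :: "nat \<Rightarrow> deg" where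
  "unitv j = (\<lambda>i. if i = j then 1 else 0)"

definition ptrunc :: "deg \<Rightarrow> deg \<Rightarrow> deg" where
  "ptrunc t a = (\<lambda>i. min (a i) (t i))"

definition shiftj :: "nat \<Rightarrow> nat \<Rightarrow> deg \<Rightarrow> deg" where
  "shiftj j s c = (\<lambda>i. if i = j then c i + s else c i)"

definition decj :: "nat \<Rightarrow> deg \<Rightarrow> deg" where
  "decj j c = (\<lambda>i. if i = j then c i - 1 else c i)"

definition vadd :: "('a \<Rightarrow> 'k::field) \<Rightarrow> ('a \<Rightarrow> 'k) \<Rightarrow> ('a \<Rightarrow> 'k)" where
  "vadd f g = (\<lambda>x. f x + g x)"
definition vsub :: "('a \<Rightarrow> 'k::field) \<Rightarrow> ('a \<Rightarrow> 'k) \<Rightarrow> ('a \<Rightarrow> 'k)" where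
  "vsub f g = (\<lambda>x. f x - g x)"
definition sc :: "'k::field \<Rightarrow> ('a \<Rightarrow> 'k) \<Rightarrow> ('a \<Rightarrow> 'k)" where
  "sc c f = (\<lambda>x. c * f x)"
definition vzero :: "'a \<Rightarrow> 'k::field" where
  "vzero = (\<lambda>x. 0)"

definition kline :: "'k::field vec set" where
  "kline = {f. \<forall>l>0. f l = 0}"

definition pr1 :: "'k vec \<Rightarrow> 'k vec" where "pr1 h = (\<lambda>l. h (2*l))"
definition pr2 :: "'k vec \<Rightarrow> 'k vec" where "pr2 h = (\<lambda>l. h (2*l+1))"
definition pairv :: "'k vec \<Rightarrow> 'k vec \<Rightarrow> 'k vec" where
  "pairv f g = (\<lambda>l. if even l then f (l div 2) else g (l div 2))"
definition dsum :: "'k vec set \<Rightarrow> 'k vec set \<Rightarrow> 'k vec set" where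
  "dsum A B = {h. pr1 h \<in> A \<and> pr2 h \<in> B}"

record 'k gcx =
  sp :: "int \<Rightarrow> deg \<Rightarrow> 'k vec set"
  dif :: "int \<Rightarrow> deg \<Rightarrow> 'k vec \<Rightarrow> 'k vec"
  mulx :: "nat \<Rightarrow> int \<Rightarrow> deg \<Rightarrow> 'k vec \<Rightarrow> 'k vec"

primrec mulpow :: "'k gcx \<Rightarrow> nat \<Rightarrow> int \<Rightarrow> deg \<Rightarrow> nat \<Rightarrow> 'k vec \<Rightarrow> 'k vec" where
  "mulpow C j m c 0 v = v"
| "mulpow C j m c (Suc s) v = mulx C j m (shiftj j s c) (mulpow C j m c s v)"

text \<open>
  Nakayama functor N^{e_j}_t(C) = p_t^* Hom_S(P_{(t_j+1) e_j}, C(-e_j)), written out using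
  Hom_S(S, M)_a = M_a and Hom_S(x_j^s S, M)_a = M_{a+s e_j} (via evaluation at the generator).
  Hom(P,C)_m = Hom(P_0,C_m) x Hom(P_1,C_{m+1}), differential
  D f = d_C o f - (-1)^m f o d_P.  Hence in multidegree a (b = p_t(a)):
  N_{m,a} = C_{m,b-e_j} (+) C_{m+1,b+t_j e_j},
  D(c0,c1) = (d c0, d c1 - (-1)^m x_j^{t_j+1} c0);
  x_i acts as x^{p_t(a+e_i) - p_t(a)} componentwise.  C is N^n-graded, so C_{m,b-e_j}=0 if b_j=0.
\<close>
definition NakEps :: "deg \<Rightarrow> nat \<Rightarrow> 'k::field gcx \<Rightarrow> 'k gcx" where
  "NakEps t j C =
    \<lparr> sp = (\<lambda>m a. let b = ptrunc t a in
              dsum (if b j = 0 then {vzero} else sp C m (decj j b))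
                   (sp C (m+1) (shiftj j (t j) b))),
      dif = (\<lambda>m a h. let b = ptrunc t a in
              pairv (if b j = 0 then vzero else dif C m (decj j b) (pr1 h))
                    (vsub (dif C (m+1) (shiftj j (t j) b) (pr2 h))
                          (if b j = 0 then vzero
                           else sc (if even m then 1 else -1)
                                   (mulpow C j m (decj j b) (Suc (t j)) (pr1 h))))),
      mulx = (\<lambda>i m a h. let b = ptrunc t a in
              if t i \<le> a i then h
              else pairv (if b j = 0 then vzero else mulx C i m (decj j b) (pr1 h))
                         (mulx C i (m+1) (shiftj j (t j) b) (pr2 h))) \<rparr>"

primrec Ncomp :: "deg \<Rightarrow> deg \<Rightarrow> nat list \<Rightarrow> 'k::field gcx \<Rightarrow> 'k gcx" where
  "Ncomp t k [] C = C"
| "Ncomp t k (j # js) C = (NakEps t j ^^ k j) (Ncomp t k js C)"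

definition Nk :: "deg \<Rightarrow> deg \<Rightarrow> nat \<Rightarrow> 'k::field gcx \<Rightarrow> 'k gcx" where
  "Nk t k n C = Ncomp t k [0..<n] C"

text \<open>monomial ideals, given by the set of exponent vectors of the monomials they contain\<close>
definition monideal :: "nat \<Rightarrow> deg set \<Rightarrow> bool" where
  "monideal n I \<longleftrightarrow> I \<subseteq> Dn n \<and> (\<forall>a\<in>I. \<forall>b\<in>Dn n. a \<le> b \<longrightarrow> b \<in> I)"

definition mingens :: "deg set \<Rightarrow> deg set" where
  "mingens I = {a\<in>I. \<forall>b\<in>I. b \<le> a \<longrightarrow> b = a}"

definition pos_tdet_ideal :: "deg \<Rightarrow> deg set \<Rightarrow> bool" where
  "pos_tdet_ideal t I \<longleftrightarrow> (\<forall>a\<in>mingens I. a \<le> t)"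

definition quotI :: "nat \<Rightarrow> deg set \<Rightarrow> 'k::field gcx" where
  "quotI n I =
    \<lparr> sp = (\<lambda>m a. if m = 0 \<and> a \<in> Dn n \<and> a \<notin> I then kline else {vzero}),
      dif = (\<lambda>m a v. vzero),
      mulx = (\<lambda>i m a v. if shiftj i 1 a \<notin> I then v else vzero) \<rparr>"

text \<open>interval module K_t{a,b} = p_t^*((S/m^{b-a+1})(-a)), zero if a is not <= b\<close>
definition Kint :: "deg \<Rightarrow> deg \<Rightarrow> deg \<Rightarrow> 'k::field gcx" where
  "Kint t a b =
    \<lparr> sp = (\<lambda>m r. if m = 0 \<and> a \<le> b \<and> a \<le> ptrunc t r \<and> ptrunc t r \<le> b then kline else {vzero}),
      dif = (\<lambda>m r v. vzero),
      mulx = (\<lambda>i m r v. if t i \<le> r i then v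
                        else if a \<le> shiftj i 1 (ptrunc t r) \<and> shiftj i 1 (ptrunc t r) \<le> b
                        then v else vzero) \<rparr>"

text \<open>homology: H^i C = H_{-i} C, computed multidegreewise\<close>
definition cycles :: "'k::field gcx \<Rightarrow> int \<Rightarrow> deg \<Rightarrow> 'k vec set" where
  "cycles C m a = {z \<in> sp C m a. dif C m a z = vzero}"

definition bnds :: "'k::field gcx \<Rightarrow> int \<Rightarrow> deg \<Rightarrow> 'k vec set" where
  "bnds C m a = dif C (m+1) a ` sp C (m+1) a"

definition lin_on :: "('a \<Rightarrow> 'k::field) set \<Rightarrow> (('a \<Rightarrow> 'k) \<Rightarrow> ('b \<Rightarrow> 'k)) \<Rightarrow> bool" where
  "lin_on Z f \<longleftrightarrow> (\<forall>x\<in>Z. \<forall>y\<in>Z. f (vadd x y) = vadd (f x) (f y)) \<and>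
                  (\<forall>c. \<forall>x\<in>Z. f (sc c x) = sc c (f x))"

text \<open>Z1/B1 \<cong> Z2/B2 as K-vector spaces (witnessed by a linear lift Z1 -> Z2)\<close>
definition quot_iso :: "('a \<Rightarrow> 'k::field) set \<Rightarrow> ('a \<Rightarrow> 'k) set \<Rightarrow> ('b \<Rightarrow> 'k) set \<Rightarrow> ('b \<Rightarrow> 'k) set \<Rightarrow> bool" where
  "quot_iso Z1 B1 Z2 B2 \<longleftrightarrow> (\<exists>f. (\<forall>x\<in>Z1. f x \<in> Z2) \<and> lin_on Z1 f \<and>
       (\<forall>x\<in>Z1. f x \<in> B2 \<longleftrightarrow> x \<in> B1) \<and> (\<forall>y\<in>Z2. \<exists>x\<in>Z1. vsub y (f x) \<in> B2))"

definition coh_vanish :: "nat \<Rightarrow> 'k::field gcx \<Rightarrow> int \<Rightarrow> bool" where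
  "coh_vanish n C i \<longleftrightarrow> (\<forall>a\<in>Dn n. cycles C (-i) a \<subseteq> bnds C (-i) a)"

definition coh_iso_graded :: "nat \<Rightarrow> 'k::field gcx \<Rightarrow> int \<Rightarrow> 'k gcx \<Rightarrow> bool" where
  "coh_iso_graded n C i M \<longleftrightarrow> (\<exists>f. \<forall>a\<in>Dn n.
      (\<forall>z\<in>cycles C (-i) a. f a z \<in> sp M 0 a) \<and>
      lin_on (cycles C (-i) a) (f a) \<and>
      (\<forall>z\<in>cycles C (-i) a. f a z = vzero \<longleftrightarrow> z \<in> bnds C (-i) a) \<and>
      (\<forall>w\<in>sp M 0 a. \<exists>z\<in>cycles C (-i) a. f a z = w) \<and>
      (\<forall>l<n. \<forall>z\<in>cycles C (-i) a.
          f (shiftj l 1 a) (mulx C l (-i) a z) = mulx M l 0 a (f a z)))"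

definition quot_nonzero :: "nat \<Rightarrow> deg set \<Rightarrow> deg \<Rightarrow> bool" where
  "quot_nonzero n I x \<longleftrightarrow> x \<in> Dn n \<and> x \<notin> I"

definition xF :: "deg \<Rightarrow> deg \<Rightarrow> nat set \<Rightarrow> deg" where
  "xF a b F = (\<lambda>i. if i \<in> F then b i + 1 else a i)"

definition Delta :: "nat \<Rightarrow> deg \<Rightarrow> deg set \<Rightarrow> deg \<Rightarrow> deg \<Rightarrow> nat set set" where
  "Delta n t I a b = {F. F \<subseteq> {..<n} \<and> xF a b F \<le> t \<and>
                        quot_nonzero n I (xF a b F)}"

definition cochains :: "nat set set \<Rightarrow> int \<Rightarrow> (nat set \<Rightarrow> 'k::field) set" where
  "cochains D q = {\<phi>. \<forall>F. \<phi> F \<noteq> 0 \<longrightarrow> F \<in> D \<and> int (card F) = q + 1}"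

definition cobd :: "nat set set \<Rightarrow> int \<Rightarrow> (nat set \<Rightarrow> 'k::field) \<Rightarrow> (nat set \<Rightarrow> 'k)" where
  "cobd D q \<phi> = (\<lambda>G. if G \<in> D \<and> int (card G) = q + 2
       then (\<Sum>l\<in>G. (-1) ^ card {g\<in>G. g < l} * \<phi> (G - {l})) else 0)"

definition rcycles :: "nat set set \<Rightarrow> int \<Rightarrow> (nat set \<Rightarrow> 'k::field) set" where
  "rcycles D q = {\<phi> \<in> cochains D q. cobd D q \<phi> = vzero}"

definition rbnds :: "nat set set \<Rightarrow> int \<Rightarrow> (nat set \<Rightarrow> 'k::field) set" where
  "rbnds D q = cobd D (q - 1) ` cochains D (q - 1)"

end

theory Submission
  imports Defs "HOL.Vector_Spaces" "HOL-Library.Function_Algebras"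
begin

text \<open>
  In one variable, \<open>\<N>\<close> replaces the functional "complex \<open>C\<^bsub>u\<^esub> \<rightarrow> C\<^bsub>v+1\<^esub>\<close> placed in degree \<open>g\<close>" (second
  term dropped if \<open>v = t\<close>) by a functional of the same shape: applied to \<open>\<N> C\<close> it is quasi-isomorphic
  to \<open>C\<^bsub>u-1\<^esub> \<rightarrow> C\<^bsub>v\<^esub>\<close> in degree \<open>g\<close> if \<open>u > 0\<close>, and to \<open>C\<^bsub>v\<^esub>\<close> in degree \<open>g + 1\<close> if \<open>u = 0\<close>.
  Starting from \<open>(r\<^sub>j, t\<^sub>j, 0)\<close> and iterating \<open>k\<^sub>j\<close> times in each direction, \<open>\<N>\<^sup>k C\<close> in degree \<open>r\<close> becomes an
  iterated mapping cone over a cube of graded pieces of \<open>C\<close>; for \<open>C = S/I\<close> these are the reduced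
  cochains of \<open>\<Delta>\<close>. The same computation for the interval module, whose complex is an interval of faces,
  shows that the hypothesis determines \<open>u\<close>, \<open>v\<close> and \<open>\<gamma>\<close> to be the result of this iteration, because the
  step on functionals is adjoint to the action of \<open>\<N>\<close> on intervals.
\<close>

section \<open>Complexes of subspaces and cones\<close>

text \<open>Slabs are stable for the following reason. N places C at coordinate a_j - 1 in one
  degree and C at coordinate t_j in the next, so a slab of N C has up to four pieces: C_{u-1}, C_t,
  C_v, C_t. For v < t the two copies of C_t are joined by the identity up to sign and cancel, so at
  most two pieces remain. Quasi-isomorphisms, and not just dimensions, have to be carried along: the
  arrows of the next slab are multiplications by variables not yet treated, and the maps must
  commute with these, while treated coordinates stay fixed at r_j. The 1 in k+1 and the n in gamma+n
  have one source: in each variable a single step sends K{t-r,t} to K{0,t-r} one cohomological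
  degree higher, and [0,t-r] is the reflection under x -> t-x of the starting slab (r,t). The k
  further steps on intervals then mirror the k steps on slabs. The index i-gamma-1 is the dimension
  of a face with i-gamma elements: each vertex selects the second term of a slab, at the cost of one
  cohomological degree.\<close>

lemma vadd_eq_plus: "vadd f g = f + g"
  by (simp add: vadd_def fun_eq_iff)

lemma vsub_eq_minus: "vsub f g = f - g"
  by (simp add: vsub_def fun_eq_iff)

lemma vzero_eq_zero: "vzero = 0"
  by (simp add: vzero_def fun_eq_iff)

text \<open>Translates the pointwise operations of the definitions to \<open>+\<close>,
  \<open>-\<close> and \<open>0\<close> on function types, so that general facts on
  \<open>vector_space\<close> and \<open>module_hom\<close> apply.\<close>

lemmas vec_simps = vadd_eq_plus vsub_eq_minus vzero_eq_zero

interpretation sc: vector_space "sc :: 'k::field \<Rightarrow> ('a \<Rightarrow> 'k) \<Rightarrow> 'a \<Rightarrow> 'k"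
  by unfold_locales (auto simp: sc_def fun_eq_iff algebra_simps)

text \<open>Linearity is required on the whole function space and not only on a graded piece. The
  maps below satisfy this, and no membership side conditions arise when they are expanded.\<close>

abbreviation lin :: "(('a \<Rightarrow> 'k::field) \<Rightarrow> ('b \<Rightarrow> 'k)) \<Rightarrow> bool" where
  "lin \<equiv> module_hom sc sc"

lemma linI:
  assumes "\<And>x y. f (x + y) = f x + f y" "\<And>c x. f (sc c x) = sc c (f x)"
  shows "lin f"
  using assms by (simp add: module_hom_iff sc.module_axioms)

lemmas lin_add = module_hom.add[where ?s1.0 = sc and ?s2.0 = sc]
  and lin_diff = module_hom.diff[where ?s1.0 = sc and ?s2.0 = sc]
  and lin_minus = module_hom.neg[where ?s1.0 = sc and ?s2.0 = sc]
  and lin_zero = module_hom.zero[where ?s1.0 = sc and ?s2.0 = sc]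
  and lin_scale = module_hom.scale[where ?s1.0 = sc and ?s2.0 = sc]

lemma lin_id: "lin (\<lambda>x. x)" and lin_const_zero: "lin (\<lambda>x. 0)"
  and lin_sub: "lin f \<Longrightarrow> lin g \<Longrightarrow> lin (\<lambda>x. f x - g x)"
  and lin_smult: "lin f \<Longrightarrow> lin (\<lambda>x. sc c (f x))"
  by (auto simp: module_hom_iff sc.module_axioms sc.scale_right_diff_distrib sc.scale_right_distrib
      mult.commute)

lemma lin_comp: "lin f \<Longrightarrow> lin g \<Longrightarrow> lin (\<lambda>x. f (g x))"
  by (auto simp: module_hom_iff sc.module_axioms)

lemma lin_imp_lin_on: "lin f \<Longrightarrow> lin_on Z f"
  by (simp add: lin_on_def vec_simps module_hom_iff)

lemma pr_pairv [simp]: "pr1 (pairv f g) = f" "pr2 (pairv f g) = g"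
  by (auto simp: pr1_def pr2_def pairv_def fun_eq_iff)

lemma pairv_pr [simp]: "pairv (pr1 h) (pr2 h) = h"
  by (auto simp: pr1_def pr2_def pairv_def fun_eq_iff)

lemma pair_cong: "pr1 g = pr1 h \<Longrightarrow> pr2 g = pr2 h \<Longrightarrow> g = h"
  by (metis pairv_pr)

lemma pr_linear [simp]:
  "pr1 (f + g) = pr1 f + pr1 g" "pr2 (f + g) = pr2 f + pr2 g"
  "pr1 (f - g) = pr1 f - pr1 g" "pr2 (f - g) = pr2 f - pr2 g"
  "pr1 0 = 0" "pr2 0 = 0"
  "pr1 (sc c f) = sc c (pr1 f)" "pr2 (sc c f) = sc c (pr2 f)"
  by (auto simp: pr1_def pr2_def sc_def fun_eq_iff)

lemma lin_pr: "lin pr1" "lin pr2"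
  by (auto intro!: linI)

lemma pairv_zero [simp]: "pairv 0 0 = 0"
  by (rule pair_cong) auto

lemma pairv_linear:
  "pairv (f + f') (g + g') = pairv f g + pairv f' g'"
  "pairv (sc c f) (sc c g) = sc c (pairv f g)"
  by (rule pair_cong; simp)+

lemma lin_pairv: "lin f \<Longrightarrow> lin g \<Longrightarrow> lin (\<lambda>x. pairv (f x) (g x))"
  by (simp add: module_hom_iff pairv_linear)

lemma pairv_eq_iff: "pairv a b = pairv c d \<longleftrightarrow> a = c \<and> b = d"
  by (metis pr_pairv)

lemma eq_pairv_iff: "h = pairv a b \<longleftrightarrow> pr1 h = a \<and> pr2 h = b"
  by (metis pairv_pr pr_pairv)

lemma pairv_diff: "pairv a b - pairv c d = pairv (a - c) (b - d)"
  and pairv_minus: "- pairv a b = pairv (- a) (- b)"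
  and scale_pairv: "sc r (pairv a b) = pairv (sc r a) (sc r b)"
  by (auto simp: pairv_def sc_def fun_eq_iff)

lemma dsum_iff: "h \<in> dsum A B \<longleftrightarrow> pr1 h \<in> A \<and> pr2 h \<in> B"
  by (simp add: dsum_def)

lemma pairv_eq_zero: "pairv f g = 0 \<longleftrightarrow> f = 0 \<and> g = 0"
  by (metis pairv_zero pr_pairv)

lemma subspace_dsum: "sc.subspace A \<Longrightarrow> sc.subspace B \<Longrightarrow> sc.subspace (dsum A B)"
  by (auto simp: sc.subspace_def dsum_iff)

section \<open>Chain complexes and quasi-isomorphisms, elementwise\<close>

abbreviation sg :: "int \<Rightarrow> 'k::field" where
  "sg m \<equiv> (if even m then 1 else - 1)"

definition cplx :: "(int \<Rightarrow> 'k::field vec set) \<Rightarrow> (int \<Rightarrow> 'k vec \<Rightarrow> 'k vec) \<Rightarrow> bool" where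
  "cplx A d \<longleftrightarrow> (\<forall>m. sc.subspace (A m) \<and> lin (d m) \<and>
     (\<forall>z\<in>A m. d m z \<in> A (m - 1) \<and> d (m - 1) (d m z) = 0))"

definition cmap where
  "cmap A d B e s f \<longleftrightarrow> (\<forall>m. lin (f m) \<and>
     (\<forall>z\<in>A m. f m z \<in> B (m + s) \<and> e (m + s) (f m z) = f (m - 1) (d m z)))"
  for s :: int and A :: "int \<Rightarrow> 'k::field vec set" and f :: "int \<Rightarrow> 'k vec \<Rightarrow> 'k vec"

text \<open>Homology quotients are never formed: the two clauses after \<open>cmap\<close> are
  injectivity and surjectivity on homology, with boundaries given by explicit preimages.\<close>

definition qis where
  "qis A d B e s f \<longleftrightarrow> cmap A d B e s f \<and>
     (\<forall>m. \<forall>z\<in>A m. d m z = 0 \<longrightarrow> f m z \<in> e (m + 1 + s) ` B (m + 1 + s) \<longrightarrow> z \<in> d (m + 1) ` A (m + 1)) \<and>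
     (\<forall>m. \<forall>w\<in>B (m + s). e (m + s) w = 0 \<longrightarrow>
        (\<exists>z\<in>A m. d m z = 0 \<and> (\<exists>b\<in>B (m + 1 + s). w = f m z + e (m + 1 + s) b)))"
  for s :: int and A :: "int \<Rightarrow> 'k::field vec set" and f :: "int \<Rightarrow> 'k vec \<Rightarrow> 'k vec"

lemma cplxD:
  assumes "cplx A d"
  shows "sc.subspace (A m)" "lin (d m)" "z \<in> A m \<Longrightarrow> d m z \<in> A (m - 1)"
    "z \<in> A m \<Longrightarrow> d (m - 1) (d m z) = 0" "z \<in> A (m + 1) \<Longrightarrow> d (m + 1) z \<in> A m"
    "z \<in> A (m + 1) \<Longrightarrow> d m (d (m + 1) z) = 0"
  using assms unfolding cplx_def by (auto dest: spec[where x="m+1"])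

lemma cmapD:
  assumes "cmap A d B e s f"
  shows "lin (f m)" "z \<in> A m \<Longrightarrow> f m z \<in> B (m + s)"
    "z \<in> A m \<Longrightarrow> e (m + s) (f m z) = f (m - 1) (d m z)"
    "z \<in> A (m + 1) \<Longrightarrow> e (m + 1 + s) (f (m + 1) z) = f m (d (m + 1) z)"
  using assms unfolding cmap_def by (auto dest: spec[where x="m+1"])

lemma qisD:
  assumes "qis A d B e s f"
  shows "cmap A d B e s f"
    "z \<in> A m \<Longrightarrow> d m z = 0 \<Longrightarrow> b \<in> B (m + 1 + s) \<Longrightarrow> f m z = e (m + 1 + s) b \<Longrightarrow>
      \<exists>c\<in>A (m + 1). z = d (m + 1) c"
    "w \<in> B (m + s) \<Longrightarrow> e (m + s) w = 0 \<Longrightarrow>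
        \<exists>z\<in>A m. d m z = 0 \<and> (\<exists>b\<in>B (m + 1 + s). w = f m z + e (m + 1 + s) b)"
  using assms unfolding qis_def by blast+

lemma cmap_comp0:
  assumes "cmap A d B e 0 f" "cmap B e B' e' 0 g"
  shows "cmap A d B' e' 0 (\<lambda>m z. g m (f m z))"
  using assms unfolding cmap_def by (auto intro: lin_comp)

lemma cmap_id: "cmap A d A d 0 (\<lambda>m z. z)"
  unfolding cmap_def by (auto intro: lin_id)

lemma cmap_zero: "cplx A d \<Longrightarrow> cplx B e \<Longrightarrow> cmap A d B e s (\<lambda>m z. 0)"
  unfolding cmap_def
  by (auto intro: lin_const_zero sc.subspace_0 cplxD simp: lin_zero[OF cplxD(2)])

lemma cplx_zero: "cplx (\<lambda>_. {0}) (\<lambda>_ _. 0)"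
  unfolding cplx_def by (auto intro: lin_const_zero)

lemma qis_comp:
  assumes C: "cplx B e" "cplx B' e'" and f: "qis A d B e s f" and g: "qis B e B' e' s' g"
  shows "qis A d B' e' (s + s') (\<lambda>m z. g (m + s) (f m z))"
proof -
  note fm = cmapD[OF qisD(1)[OF f]] and gm = cmapD[OF qisD(1)[OF g]]
  have E: "m - 1 + s = m + s - 1" "m + (s + s') = m + s + s'"
    "m + 1 + (s + s') = m + s + 1 + s'" "m + 1 + s = m + s + 1" for m by auto
  have "cmap A d B' e' (s + s') (\<lambda>m z. g (m + s) (f m z))"
    unfolding cmap_def
    using fm gm by (auto intro: lin_comp simp: E)
  moreover have "z \<in> d (m + 1) ` A (m + 1)"
    if z: "z \<in> A m" "d m z = 0" and zb: "g (m + s) (f m z) \<in> e' (m + 1 + (s + s')) ` B' (m + 1 + (s + s'))" for m z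
  proof -
    obtain b where b: "b \<in> B' (m + s + 1 + s')" "g (m + s) (f m z) = e' (m + s + 1 + s') b"
      using zb unfolding E by blast
    have "e (m + s) (f m z) = 0" using fm(3)[OF z(1)] z by (simp add: lin_zero[OF fm(1)])
    then obtain c where "c \<in> B (m + s + 1)" "f m z = e (m + s + 1) c"
      using qisD(2)[OF g, of "f m z" "m + s" b] b fm z by auto
    then show ?thesis using qisD(2)[OF f z, of c] by (auto simp: E)
  qed
  moreover have "\<exists>z\<in>A m. d m z = 0 \<and> (\<exists>b\<in>B' (m + 1 + (s + s')). w = g (m + s) (f m z) + e' (m + 1 + (s + s')) b)"
    if w: "w \<in> B' (m + (s + s'))" "e' (m + (s + s')) w = 0" for m w
  proof -
    obtain y b where y: "y \<in> B (m + s)" "e (m + s) y = 0" "b \<in> B' (m + s + 1 + s')"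
      "w = g (m + s) y + e' (m + s + 1 + s') b"
      using qisD(3)[OF g, of w "m + s"] w by (auto simp: E)
    obtain z c where z: "z \<in> A m" "d m z = 0" "c \<in> B (m + s + 1)" "y = f m z + e (m + s + 1) c"
      using qisD(3)[OF f y(1,2)] by (auto simp: E)
    have "w = g (m + s) (f m z) + e' (m + s + 1 + s') (g (m + s + 1) c + b)"
      using y z gm(4)[of c "m + s"] by (simp add: lin_add[OF gm(1)] lin_add[OF cplxD(2)[OF C(2)]])
    moreover have "g (m + s + 1) c + b \<in> B' (m + s + 1 + s')"
      using y z gm(2) by (intro sc.subspace_add cplxD[OF C(2)]) auto
    ultimately show ?thesis using z by (auto simp: E)
  qed
  ultimately show ?thesis unfolding qis_def by blast
qed

text \<open>The long exact sequence of kernel, source and target, chased by hand: \<open>ker\<close>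
  says that the kernel complex is acyclic, and lifts through the surjection are corrected by kernel
  elements.\<close>

lemma qis_surj:
  assumes C: "cplx A d" "cplx B e" and f: "cmap A d B e s f"
    and surj: "\<And>m w. w \<in> B (m + s) \<Longrightarrow> \<exists>z\<in>A m. f m z = w"
    and ker: "\<And>m z. z \<in> A m \<Longrightarrow> f m z = 0 \<Longrightarrow> d m z = 0 \<Longrightarrow> \<exists>y\<in>A (m + 1). f (m + 1) y = 0 \<and> d (m + 1) y = z"
  shows "qis A d B e s f"
proof -
  note fm = cmapD[OF f] and Ad = cplxD[OF C(1)] and Be = cplxD[OF C(2)]
  have E: "m + 1 - 1 = m" for m :: int by simp
  have "z \<in> d (m + 1) ` A (m + 1)"
    if z: "z \<in> A m" "d m z = 0" and zb: "f m z \<in> e (m + 1 + s) ` B (m + 1 + s)" for m z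
  proof -
    obtain b where b: "b \<in> B (m + 1 + s)" "f m z = e (m + 1 + s) b" using zb by blast
    obtain c where c: "c \<in> A (m + 1)" "f (m + 1) c = b" using surj[of b "m + 1"] b by auto
    have "z - d (m + 1) c \<in> A m" using z c Ad by (intro sc.subspace_diff) auto
    moreover have "f m (z - d (m + 1) c) = 0"
      using b c fm(4)[of c m] by (simp add: lin_diff[OF fm(1)])
    moreover have "d m (z - d (m + 1) c) = 0"
      using z c Ad(6) by (simp add: lin_diff[OF Ad(2)])
    ultimately obtain y where "y \<in> A (m + 1)" "d (m + 1) y = z - d (m + 1) c"
      using ker by blast
    then have "y + c \<in> A (m + 1)" "d (m + 1) (y + c) = z"
      using Ad c by (auto intro!: sc.subspace_add simp: lin_add[OF Ad(2)])
    then show ?thesis by blast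
  qed
  moreover have "\<exists>z\<in>A m. d m z = 0 \<and> (\<exists>b\<in>B (m + 1 + s). w = f m z + e (m + 1 + s) b)"
    if w: "w \<in> B (m + s)" "e (m + s) w = 0" for m w
  proof -
    obtain z where z: "z \<in> A m" "f m z = w" using surj w by blast
    \<comment> \<open>As \<open>w\<close> is a cycle, the differential of its lift is a cycle of the
      kernel, hence the differential of some kernel element \<open>y\<close>. Then
      \<open>z - y\<close> is a cycle with the same image.\<close>
    have "d m z \<in> A (m - 1)" "f (m - 1) (d m z) = 0" "d (m - 1) (d m z) = 0"
      using z w fm(3)[of z m] Ad by auto
    then obtain y where y: "y \<in> A m" "f m y = 0" "d m y = d m z"
      using ker[of "d m z" "m - 1"] by auto
    have "z - y \<in> A m" "d m (z - y) = 0" "w = f m (z - y) + e (m + 1 + s) 0"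
      using y z Ad by (auto intro!: sc.subspace_diff simp: lin_diff[OF Ad(2)] lin_diff[OF fm(1)] lin_zero[OF Be(2)])
    then show ?thesis using sc.subspace_0[OF Be(1)] by blast
  qed
  ultimately show ?thesis using f unfolding qis_def by blast
qed

section \<open>Mapping cones\<close>

definition cone_sp :: "(int \<Rightarrow> 'k::field vec set) \<Rightarrow> (int \<Rightarrow> 'k vec set) \<Rightarrow> int \<Rightarrow> 'k vec set" where
  "cone_sp A B m = dsum (A m) (B (m + 1))"

text \<open>The cone is shifted so that the source keeps its degree and the target sits one
  cohomological degree higher. The sign is that of the total Hom complex in \<open>NakEps\<close>,
  which makes the Nakayama functor an instance of this construction.\<close>

definition cone_dif ::
  "(int \<Rightarrow> 'k::field vec \<Rightarrow> 'k vec) \<Rightarrow> (int \<Rightarrow> 'k vec \<Rightarrow> 'k vec) \<Rightarrow> (int \<Rightarrow> 'k vec \<Rightarrow> 'k vec) \<Rightarrow>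
    int \<Rightarrow> 'k vec \<Rightarrow> 'k vec" where
  "cone_dif d e x m h = pairv (d m (pr1 h)) (e (m + 1) (pr2 h) - sc (sg m) (x m (pr1 h)))"

lemma cone_cplx:
  assumes "cplx A d" "cplx B e" "cmap A d B e 0 x"
  shows "cplx (cone_sp A B) (cone_dif d e x)"
proof -
  note Ad = cplxD[OF assms(1)] and Be = cplxD[OF assms(2)] and xm = cmapD[OF assms(3), simplified]
  have "lin (cone_dif d e x m)" for m
    unfolding cone_dif_def
    by (intro lin_pairv lin_sub lin_smult lin_comp[OF Ad(2)] lin_comp[OF Be(2)] lin_comp[OF xm(1)] lin_pr)
  moreover have "cone_dif d e x m z \<in> cone_sp A B (m - 1)" if "z \<in> cone_sp A B m" for z m
    using that Ad Be xm
    by (auto simp: cone_sp_def cone_dif_def dsum_iff simp del: sc.scale_minus_left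
        intro!: sc.subspace_diff sc.subspace_scale)
  moreover have "cone_dif d e x (m - 1) (cone_dif d e x m z) = 0" if "z \<in> cone_sp A B m" for z m
  proof (rule pair_cong)
    have z: "pr1 z \<in> A m" "pr2 z \<in> B (m + 1)" using that by (auto simp: cone_sp_def dsum_iff)
    show "pr1 (cone_dif d e x (m - 1) (cone_dif d e x m z)) = pr1 0"
      using Ad(4) z by (simp add: cone_dif_def)
    show "pr2 (cone_dif d e x (m - 1) (cone_dif d e x m z)) = pr2 0"
      using Be(6)[of "pr2 z" m] z xm(3)[of "pr1 z" m]
      by (simp add: cone_dif_def lin_diff[OF Be(2)] lin_minus[OF Be(2)] lin_scale[OF Be(2)])
  qed
  ultimately show ?thesis
    unfolding cplx_def cone_sp_def using Ad Be by (auto intro: subspace_dsum)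
qed

text \<open>A chain map of degree \<open>s\<close> anticommutes with the sign in the cone differential
  when \<open>s\<close> is odd, whence the sign on the second component.\<close>

definition cone_map :: "int \<Rightarrow> (int \<Rightarrow> 'k::field vec \<Rightarrow> 'k vec) \<Rightarrow> (int \<Rightarrow> 'k vec \<Rightarrow> 'k vec) \<Rightarrow>
    int \<Rightarrow> 'k vec \<Rightarrow> 'k vec" where
  "cone_map s f g m h = pairv (f m (pr1 h)) (sc (sg s) (g (m + 1) (pr2 h)))"

lemma cone_cmap:
  assumes C: "cplx A d" "cplx B e" "cplx A' d'" "cplx B' e'"
    and x: "cmap A d B e 0 x" and x': "cmap A' d' B' e' 0 x'"
    and f: "cmap A d A' d' s f" and g: "cmap B e B' e' s g"
    and com: "\<And>m z. z \<in> A m \<Longrightarrow> g m (x m z) = x' (m + s) (f m z)"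
  shows "cmap (cone_sp A B) (cone_dif d e x) (cone_sp A' B') (cone_dif d' e' x') s (cone_map s f g)"
proof -
  note Be' = cplxD[OF C(4)] and fm = cmapD[OF f] and gm = cmapD[OF g]
  note L = lin_minus[OF Be'(2)] lin_diff[OF gm(1)] lin_minus[OF gm(1)] lin_add[OF gm(1)]
  note D = cone_sp_def cone_dif_def cone_map_def dsum_iff
  have E: "m + 1 + s = m + s + 1" "m - 1 + s = m + s - 1" for m
    by auto
  have "lin (cone_map s f g m)" for m
    unfolding cone_map_def
    by (intro lin_pairv lin_smult lin_comp[OF fm(1)] lin_comp[OF gm(1)] lin_pr)
  moreover have "cone_map s f g m z \<in> cone_sp A' B' (m + s)" if "z \<in> cone_sp A B m" for z m
    using that fm(2)[of "pr1 z" m] gm(2)[of "pr2 z" "m + 1"] Be'(1)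
    by (auto simp: D E intro!: sc.subspace_scale sc.subspace_neg)
  moreover have "cone_dif d' e' x' (m + s) (cone_map s f g m z) = cone_map s f g (m - 1) (cone_dif d e x m z)"
    if "z \<in> cone_sp A B m" for z m
  proof (rule pair_cong)
    have z: "pr1 z \<in> A m" "pr2 z \<in> B (m + 1)" using that by (auto simp: D)
    show "pr1 (cone_dif d' e' x' (m + s) (cone_map s f g m z))
        = pr1 (cone_map s f g (m - 1) (cone_dif d e x m z))"
      using z fm(3) by (simp add: D)
    show "pr2 (cone_dif d' e' x' (m + s) (cone_map s f g m z))
        = pr2 (cone_map s f g (m - 1) (cone_dif d e x m z))"
      using z gm(4)[of "pr2 z" m] com[of "pr1 z" m] by (auto simp: D L E)
  qed
  ultimately show ?thesis
    unfolding cmap_def by blast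
qed

text \<open>The five lemma for the long exact sequences of the two cones, written as a chase: the
  first component is settled first, and the remaining freedom adjusts the second.\<close>

lemma cone_qis:
  assumes C: "cplx A d" "cplx B e" "cplx A' d'" "cplx B' e'"
    and x: "cmap A d B e 0 x" and x': "cmap A' d' B' e' 0 x'"
    and f: "qis A d A' d' s f" and g: "qis B e B' e' s g"
    and com: "\<And>m z. z \<in> A m \<Longrightarrow> g m (x m z) = x' (m + s) (f m z)"
  shows "qis (cone_sp A B) (cone_dif d e x) (cone_sp A' B') (cone_dif d' e' x') s (cone_map s f g)"
proof -
  note Ad = cplxD[OF C(1)] and Be = cplxD[OF C(2)] and Ad' = cplxD[OF C(3)] and Be' = cplxD[OF C(4)]
  note xm = cmapD[OF x, simplified] and xm' = cmapD[OF x', simplified]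
  note fm = cmapD[OF qisD(1)[OF f]] and gm = cmapD[OF qisD(1)[OF g]]
  note L = lin_diff[OF Be'(2)] lin_minus[OF Be'(2)] lin_scale[OF Be'(2)] lin_add[OF Be'(2)]
    lin_diff[OF gm(1)] lin_minus[OF gm(1)] lin_scale[OF gm(1)] lin_add[OF gm(1)]
    lin_diff[OF xm'(1)] lin_minus[OF xm'(1)] lin_scale[OF xm'(1)] lin_add[OF xm'(1)]
    lin_diff[OF xm(1)] lin_minus[OF xm(1)] lin_scale[OF xm(1)] lin_add[OF xm(1)]
    lin_diff[OF Be(2)] lin_minus[OF Be(2)] lin_scale[OF Be(2)] lin_add[OF Be(2)]
    lin_diff[OF Ad(2)] lin_diff[OF fm(1)] lin_add[OF Ad'(2)]
    lin_zero[OF Be'(2)] lin_zero[OF Be(2)] lin_zero[OF gm(1)] lin_zero[OF xm'(1)] lin_zero[OF xm(1)]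
  note D = cone_sp_def cone_dif_def cone_map_def dsum_iff
  have E: "m + 1 + s = m + s + 1" "m - 1 + s = m + s - 1" for m
    by auto
  have cm: "cmap (cone_sp A B) (cone_dif d e x) (cone_sp A' B') (cone_dif d' e' x') s (cone_map s f g)"
    by (rule cone_cmap[OF C x x' qisD(1)[OF f] qisD(1)[OF g] com])
  have "z \<in> cone_dif d e x (m + 1) ` cone_sp A B (m + 1)"
    if z: "z \<in> cone_sp A B m" "cone_dif d e x m z = 0"
      and zb: "cone_map s f g m z \<in> cone_dif d' e' x' (m + 1 + s) ` cone_sp A' B' (m + 1 + s)" for z m
  proof -
    obtain b where b: "pr1 b \<in> A' (m + s + 1)" "pr2 b \<in> B' (m + s + 1 + 1)"
      and zb: "cone_map s f g m z = cone_dif d' e' x' (m + s + 1) b"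
      using zb by (auto simp: D E)
    have z': "pr1 z \<in> A m" "pr2 z \<in> B (m + 1)" "d m (pr1 z) = 0"
      "e (m + 1) (pr2 z) = sc (sg m) (x m (pr1 z))"
      using z by (auto simp: D pairv_eq_zero)
    have zb': "f m (pr1 z) = d' (m + s + 1) (pr1 b)"
      "sc (sg s) (g (m + 1) (pr2 z)) = e' (m + s + 1 + 1) (pr2 b) - sc (sg (m + s + 1)) (x' (m + s + 1) (pr1 b))"
      using arg_cong[OF zb, of pr1] arg_cong[OF zb, of pr2] by (simp_all add: D)
    obtain c where c: "c \<in> A (m + 1)" "pr1 z = d (m + 1) c"
      using qisD(2)[OF f z'(1,3), of "pr1 b"] b zb' by (auto simp: E)
    have "f (m + 1) c - pr1 b \<in> A' (m + 1 + s)" "d' (m + 1 + s) (f (m + 1) c - pr1 b) = 0"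
      using fm(2)[OF c(1)] fm(4)[OF c(1)] b Ad'(1) c zb'(1)
      by (auto intro!: sc.subspace_diff simp: E lin_diff[OF Ad'(2)])
    then obtain y q where y: "y \<in> A (m + 1)" "d (m + 1) y = 0" "q \<in> A' (m + s + 1 + 1)"
      "f (m + 1) c - pr1 b = f (m + 1) y + d' (m + s + 1 + 1) q"
      using qisD(3)[OF f, of "f (m + 1) c - pr1 b" "m + 1"] unfolding E by blast
    \<comment> \<open>\<open>c\<close> has boundary \<open>pr1 z\<close>, but
      \<open>f (m + 1) c\<close> and \<open>pr1 b\<close> may differ by a homology class.
      Subtracting the cycle \<open>y\<close> leaves only the boundary of \<open>q\<close> as
      difference.\<close>
    define c' where "c' = c - y"
    have c': "c' \<in> A (m + 1)" "pr1 z = d (m + 1) c'" "f (m + 1) c' = pr1 b + d' (m + s + 1 + 1) q"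
      using c y Ad(1) by (auto simp: c'_def L algebra_simps intro!: sc.subspace_diff)
    \<comment> \<open>The error in the second component when \<open>pairv c' 0\<close> is taken as
      bounding chain of \<open>z\<close>; it is a cycle of \<open>B\<close>.\<close>
    define p where "p = pr2 z + sc (sg (m + 1)) (x (m + 1) c')"
    have p: "p \<in> B (m + 1)"
      unfolding p_def using z' c' xm Be by (intro sc.subspace_add sc.subspace_scale) auto
    have dp: "e (m + 1) p = 0"
      using c' z'(4) xm(4)[OF c'(1)] by (auto simp: p_def L)
    define w where "w = sc (sg s) (pr2 b) + sc (sg (m + 1)) (x' (m + s + 1 + 1) q)"
    have "w \<in> B' (m + s + 1 + 1)"
      unfolding w_def using b y xm' Be' by (intro sc.subspace_add sc.subspace_scale) auto
    moreover have "g (m + 1) p = e' (m + s + 1 + 1) w"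
    proof -
      have g2: "g (m + 1) (pr2 z) = sc (sg s) (e' (m + s + 1 + 1) (pr2 b) - sc (sg (m + s + 1)) (x' (m + s + 1) (pr1 b)))"
        using arg_cong[OF zb'(2), of "sc (sg s)"] by (auto split: if_splits)
      have xq: "e' (m + s + 1 + 1) (x' (m + s + 1 + 1) q) = x' (m + s + 1) (d' (m + s + 1 + 1) q)"
        using xm'(4)[OF y(3)] .
      have "g (m + 1) (x (m + 1) c') = x' (m + s + 1) (pr1 b) + x' (m + s + 1) (d' (m + s + 1 + 1) q)"
        using com[OF c'(1)] c'(3) by (simp add: L E)
      then show ?thesis unfolding p_def w_def using xq g2
        by (auto simp: L algebra_simps)
    qed
    ultimately obtain c2 where c2: "c2 \<in> B (m + 1 + 1)" "p = e (m + 1 + 1) c2"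
      using qisD(2)[OF g p dp, of w] unfolding E by blast
    have "pr2 z = e (m + 1 + 1) c2 - sc (sg (m + 1)) (x (m + 1) c')"
      unfolding c2(2)[symmetric] p_def by simp
    then have "z = cone_dif d e x (m + 1) (pairv c' c2)"
      unfolding cone_dif_def pr_pairv using c'(2) by (metis pairv_pr)
    moreover have "pairv c' c2 \<in> cone_sp A B (m + 1)"
      using c2 c' by (simp add: cone_sp_def dsum_iff)
    ultimately show ?thesis by blast
  qed
  moreover have "\<exists>z\<in>cone_sp A B m. cone_dif d e x m z = 0 \<and>
      (\<exists>b\<in>cone_sp A' B' (m + 1 + s). w = cone_map s f g m z + cone_dif d' e' x' (m + 1 + s) b)"
    if w: "w \<in> cone_sp A' B' (m + s)" "cone_dif d' e' x' (m + s) w = 0" for w m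
  proof -
    have w': "pr1 w \<in> A' (m + s)" "pr2 w \<in> B' (m + s + 1)" "d' (m + s) (pr1 w) = 0"
      "e' (m + s + 1) (pr2 w) = sc (sg (m + s)) (x' (m + s) (pr1 w))"
      using w by (auto simp: D pairv_eq_zero)
    obtain z0 b0 where z0: "z0 \<in> A m" "d m z0 = 0" "b0 \<in> A' (m + s + 1)"
      "pr1 w = f m z0 + d' (m + s + 1) b0"
      using qisD(3)[OF f w'(1,3)] by (auto simp: E)
    have xb0: "e' (m + s + 1) (x' (m + s + 1) b0) = x' (m + s) (d' (m + s + 1) b0)"
      using xm'(4)[OF z0(3)] .
    have "g m (x m z0) = e' (m + 1 + s) (sc (sg (m + s)) (pr2 w) - x' (m + s + 1) b0)"
      using com[OF z0(1)] w'(4) z0(4) xb0 by (auto simp: L E split: if_splits)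
    moreover have "sc (sg (m + s)) (pr2 w) - x' (m + s + 1) b0 \<in> B' (m + 1 + s)"
      unfolding E using w' z0 xm' Be' by (intro sc.subspace_diff sc.subspace_scale) auto
    moreover have "e m (x m z0) = 0" using xm(3)[OF z0(1)] z0 by (simp add: L)
    ultimately obtain z1 where z1: "z1 \<in> B (m + 1)" "x m z0 = e (m + 1) z1"
      using qisD(2)[OF g, of "x m z0" m] xm(2)[OF z0(1)] by blast
    \<comment> \<open>The second component that completes \<open>z0\<close> to a cycle of the
      cone.\<close>
    define z2 where "z2 = sc (sg m) z1"
    have z2: "z2 \<in> B (m + 1)" "e (m + 1) z2 = sc (sg m) (x m z0)"
      using z1 Be by (auto simp: z2_def L intro!: sc.subspace_scale sc.subspace_neg)
    \<comment> \<open>What is left of the second component of \<open>w\<close> after removing the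
      image of \<open>pairv z0 z2\<close> and the boundary of \<open>pairv b0 0\<close>. It is a
      cycle, so its class is hit by \<open>g\<close>.\<close>
    define w2 where "w2 = pr2 w - sc (sg s) (g (m + 1) z2) + sc (sg (m + s + 1)) (x' (m + s + 1) b0)"
    have "w2 \<in> B' (m + 1 + s)"
      unfolding w2_def E using w' z0 xm' Be' gm(2)[OF z2(1)]
      by (intro sc.subspace_add sc.subspace_diff sc.subspace_scale) (auto simp: E)
    moreover have "e' (m + 1 + s) w2 = 0"
      using w'(4) xb0 gm(4)[OF z2(1)] z2(2) com[OF z0(1)] z0(4)
      by (auto simp: w2_def L E)
    ultimately obtain y b1 where y: "y \<in> B (m + 1)" "e (m + 1) y = 0" "b1 \<in> B' (m + s + 1 + 1)"
      "w2 = g (m + 1) y + e' (m + s + 1 + 1) b1"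
      using qisD(3)[OF g, of w2 "m + 1"] unfolding E by blast
    define z where "z = pairv z0 (z2 + sc (sg s) y)"
    have "z \<in> cone_sp A B m"
      using z0 z2 y Be by (auto simp: z_def D intro!: sc.subspace_add sc.subspace_diff)
    moreover have "cone_dif d e x m z = 0"
      using z0 z2 y by (auto simp: z_def D L)
    moreover have "pairv b0 b1 \<in> cone_sp A' B' (m + 1 + s)"
      using y z0 by (auto simp: D E)
    moreover have "w = cone_map s f g m z + cone_dif d' e' x' (m + 1 + s) (pairv b0 b1)"
    proof (rule pair_cong)
      show "pr1 w = pr1 (cone_map s f g m z + cone_dif d' e' x' (m + 1 + s) (pairv b0 b1))"
        using z0 by (simp add: D z_def E)
      have "pr2 w = w2 + sc (sg s) (g (m + 1) z2) - sc (sg (m + s + 1)) (x' (m + s + 1) b0)"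
        by (simp add: w2_def)
      then show "pr2 w = pr2 (cone_map s f g m z + cone_dif d' e' x' (m + 1 + s) (pairv b0 b1))"
        using y(4) by (auto simp: D z_def E L algebra_simps)
    qed
    ultimately show ?thesis by blast
  qed
  ultimately show ?thesis using cm unfolding qis_def by blast
qed

section \<open>Positively determined graded complexes\<close>

abbreviation at_sp :: "'k::field gcx \<Rightarrow> deg \<Rightarrow> int \<Rightarrow> 'k vec set" where
  "at_sp C a \<equiv> \<lambda>m. sp C m a"

abbreviation at_dif :: "'k::field gcx \<Rightarrow> deg \<Rightarrow> int \<Rightarrow> 'k vec \<Rightarrow> 'k vec" where
  "at_dif C a \<equiv> \<lambda>m. dif C m a"

lemma Dn_upd [simp]: "a \<in> Dn n \<Longrightarrow> j < n \<Longrightarrow> a(j := x) \<in> Dn n"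
  by (auto simp: Dn_def)

lemma Dn_shiftj [simp]: "a \<in> Dn n \<Longrightarrow> j < n \<Longrightarrow> shiftj j s a \<in> Dn n"
  by (auto simp: Dn_def shiftj_def)

lemma Dn_ptrunc [simp]: "a \<in> Dn n \<Longrightarrow> ptrunc t a \<in> Dn n"
  by (auto simp: Dn_def ptrunc_def)

lemma Dn_decj [simp]: "a \<in> Dn n \<Longrightarrow> decj j a \<in> Dn n"
  by (auto simp: Dn_def decj_def)

lemma shiftj_upd: "shiftj j s a = a(j := a j + s)"
  by (auto simp: shiftj_def fun_eq_iff)

lemma ptrunc_upd: "ptrunc t (a(j := x)) = (ptrunc t a)(j := min x (t j))"
  by (auto simp: ptrunc_def fun_eq_iff)

lemma ptrunc_apply: "ptrunc t a j = min (a j) (t j)"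
  by (simp add: ptrunc_def)

lemma ptrunc_idem [simp]: "ptrunc t (ptrunc t a) = ptrunc t a"
  by (auto simp: ptrunc_def fun_eq_iff)

lemma ptrunc_le: "a \<le> t \<Longrightarrow> ptrunc t a = a"
  by (auto simp: ptrunc_def fun_eq_iff le_fun_def min_absorb1)

text \<open>Strict form of a positively t-determined complex: beyond the threshold multiplication is
  literally the identity, and pieces and differentials depend on the truncated multidegree only.
  This is the form that \<open>p_t^*\<close> produces. Equality in place of isomorphism lets pieces
  at different multidegrees be exchanged without transport maps.\<close>

locale tdet =
  fixes n :: nat and t :: deg and C :: "'k::field gcx"
  assumes cplx: "a \<in> Dn n \<Longrightarrow> cplx (at_sp C a) (at_dif C a)"
    and mulx_cmap: "i < n \<Longrightarrow> a \<in> Dn n \<Longrightarrow>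
      cmap (at_sp C a) (at_dif C a) (at_sp C (shiftj i 1 a)) (at_dif C (shiftj i 1 a)) 0 (\<lambda>m. mulx C i m a)"
    and mulx_mulx: "i < n \<Longrightarrow> l < n \<Longrightarrow> a \<in> Dn n \<Longrightarrow> z \<in> sp C m a \<Longrightarrow>
      mulx C i m (shiftj l 1 a) (mulx C l m a z) = mulx C l m (shiftj i 1 a) (mulx C i m a z)"
    and sp_trunc: "a \<in> Dn n \<Longrightarrow> sp C m (ptrunc t a) = sp C m a"
    and dif_trunc: "a \<in> Dn n \<Longrightarrow> z \<in> sp C m a \<Longrightarrow> dif C m (ptrunc t a) z = dif C m a z"
    and mulx_id: "i < n \<Longrightarrow> a \<in> Dn n \<Longrightarrow> t i \<le> a i \<Longrightarrow> z \<in> sp C m a \<Longrightarrow> mulx C i m a z = z"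
    and mulx_trunc: "i < n \<Longrightarrow> a \<in> Dn n \<Longrightarrow> a i < t i \<Longrightarrow> z \<in> sp C m a \<Longrightarrow>
      mulx C i m (ptrunc t a) z = mulx C i m a z"
begin

lemma mulpow_cmap:
  assumes j: "j < n" and a: "a \<in> Dn n"
  shows "cmap (at_sp C a) (at_dif C a) (at_sp C (shiftj j s a)) (at_dif C (shiftj j s a)) 0
    (\<lambda>m. mulpow C j m a s)"
proof (induction s)
  case 0
  then show ?case using cmap_id by (simp add: shiftj_upd)
next
  case (Suc s)
  have "shiftj j (Suc s) a = shiftj j 1 (shiftj j s a)" by (simp add: shiftj_upd)
  then show ?case using cmap_comp0[OF Suc mulx_cmap[OF j, of "shiftj j s a"]] a j by simp
qed

lemmas mulpow_in = cmapD(2)[OF mulpow_cmap, simplified]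
lemmas mulpow_lin = cmapD(1)[OF mulpow_cmap]

lemma mulx_mulpow:
  assumes "i < n" "j < n" "a \<in> Dn n" "z \<in> sp C m a"
  shows "mulx C i m (shiftj j s a) (mulpow C j m a s z) = mulpow C j m (shiftj i 1 a) s (mulx C i m a z)"
proof (induction s)
  case 0
  then show ?case by (simp add: shiftj_upd)
next
  case (Suc s)
  have E: "shiftj j (Suc s) a = shiftj j 1 (shiftj j s a)"
    "shiftj i 1 (shiftj j s a) = shiftj j s (shiftj i 1 a)"
    by (auto simp: shiftj_def fun_eq_iff)
  show ?case
    using mulx_mulx[of i j "shiftj j s a" "mulpow C j m a s z" m] assms Suc mulpow_in[of j a z m s]
    unfolding E by simp
qed

lemma mulpow_trunc:
  assumes "j < n" "a \<in> Dn n" "z \<in> sp C m a" "a j + s \<le> t j"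
  shows "mulpow C j m (ptrunc t a) s z = mulpow C j m a s z"
  using assms(4)
proof (induction s)
  case (Suc s)
  have "shiftj j s (ptrunc t a) = ptrunc t (shiftj j s a)"
    using Suc.prems by (auto simp: shiftj_def fun_eq_iff ptrunc_def)
  then show ?case
    using Suc mulx_trunc[of j "shiftj j s a" "mulpow C j m a s z" m] assms mulpow_in[of j a z m s]
    by (simp add: shiftj_upd)
qed auto

lemma mulpow_beyond:
  assumes "j < n" "a \<in> Dn n" "z \<in> sp C m a" "t j \<le> a j + s"
  shows "mulpow C j m a (s + s') z = mulpow C j m a s z"
proof (induction s')
  case (Suc s')
  then show ?case
    using mulx_id[of j "shiftj j (s + s') a" "mulpow C j m a (s + s') z" m] assms
      mulpow_in[of j a z m "s + s'"]
    by (simp add: shiftj_upd)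
qed auto

lemma sp_upd_trunc:
  assumes "j < n" "a \<in> Dn n" "t j \<le> x"
  shows "sp C m (a(j := x)) = sp C m (a(j := t j))"
  using sp_trunc[of "a(j := x)" m] sp_trunc[of "a(j := t j)" m] assms by (simp add: ptrunc_upd)

lemma dif_upd_trunc:
  assumes "j < n" "a \<in> Dn n" "t j \<le> x" "z \<in> sp C m (a(j := t j))"
  shows "dif C m (a(j := x)) z = dif C m (a(j := t j)) z"
  using dif_trunc[of "a(j := x)" z m] dif_trunc[of "a(j := t j)" z m] assms sp_upd_trunc[of j a x m]
  by (simp add: ptrunc_upd)

end

section \<open>The Nakayama functor preserves positively determined complexes\<close>

text \<open>This and the next two equations exhibit \<open>NakEps\<close> in each multidegree as the
  cone of multiplication by \<open>x_j^(t_j+1)\<close>, with source 0 where the coordinate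
  \<open>j\<close> is 0.\<close>

lemma sp_NakEps:
  "at_sp (NakEps t j C) a = cone_sp (\<lambda>m. if ptrunc t a j = 0 then {0} else sp C m (decj j (ptrunc t a)))
     (at_sp C (shiftj j (t j) (ptrunc t a)))"
  by (auto simp: NakEps_def cone_sp_def Let_def vec_simps fun_eq_iff)

lemma dif_NakEps:
  "at_dif (NakEps t j C) a = cone_dif
     (\<lambda>m. if ptrunc t a j = 0 then (\<lambda>_. 0) else dif C m (decj j (ptrunc t a)))
     (at_dif C (shiftj j (t j) (ptrunc t a)))
     (\<lambda>m. if ptrunc t a j = 0 then (\<lambda>_. 0) else mulpow C j m (decj j (ptrunc t a)) (Suc (t j)))"
  by (auto simp: NakEps_def cone_dif_def Let_def vec_simps fun_eq_iff simp del: mulpow.simps)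

lemma mulx_NakEps:
  "mulx (NakEps t j C) i m a = (if t i \<le> a i then (\<lambda>h. h) else
     cone_map 0 (\<lambda>m. if ptrunc t a j = 0 then (\<lambda>_. 0) else mulx C i m (decj j (ptrunc t a)))
       (\<lambda>m. mulx C i m (shiftj j (t j) (ptrunc t a))) m)"
  by (auto simp: NakEps_def cone_map_def Let_def vec_simps fun_eq_iff)

text \<open>The claims on differentials follow from the cone lemmas once multiplication by a
  variable is seen as a map of cones; the relations between multiplications are inherited
  componentwise.\<close>

lemma (in tdet) tdet_NakEps:
  assumes j: "j < n"
  shows "tdet n t (NakEps t j C)"
proof
  let ?N = "NakEps t j C"
  have lo_cplx: "cplx (\<lambda>m. if b j = 0 then {0} else sp C m (decj j b))
      (\<lambda>m. if b j = 0 then (\<lambda>_. 0) else dif C m (decj j b))" if "b \<in> Dn n" for b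
    using that by (cases "b j = 0") (auto intro: cplx cplx_zero)
  have x_cmap: "cmap (\<lambda>m. if b j = 0 then {0} else sp C m (decj j b))
      (\<lambda>m. if b j = 0 then (\<lambda>_. 0) else dif C m (decj j b))
      (at_sp C (shiftj j (t j) b)) (at_dif C (shiftj j (t j) b)) 0
      (\<lambda>m. if b j = 0 then (\<lambda>_. 0) else mulpow C j m (decj j b) (Suc (t j)))" if b: "b \<in> Dn n" for b
  proof (cases "b j = 0")
    case True
    then show ?thesis using cmap_zero[OF cplx_zero cplx] b j by simp
  next
    case False
    then have "shiftj j (Suc (t j)) (decj j b) = shiftj j (t j) b"
      by (auto simp: shiftj_def decj_def fun_eq_iff)
    then show ?thesis using mulpow_cmap[OF j, of "decj j b" "Suc (t j)"] b False by simp
  qed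
  show "cplx (at_sp ?N a) (at_dif ?N a)" if "a \<in> Dn n" for a
    unfolding sp_NakEps dif_NakEps using that j by (intro cone_cplx lo_cplx x_cmap cplx) auto
  show "cmap (at_sp ?N a) (at_dif ?N a) (at_sp ?N (shiftj i 1 a)) (at_dif ?N (shiftj i 1 a)) 0
      (\<lambda>m. mulx ?N i m a)" if i: "i < n" and a: "a \<in> Dn n" for i a
  proof (cases "t i \<le> a i")
    case True
    then have E: "ptrunc t (shiftj i 1 a) = ptrunc t a"
      by (auto simp: shiftj_def ptrunc_def fun_eq_iff)
    show ?thesis
      unfolding sp_NakEps dif_NakEps mulx_NakEps E using cmap_id True by simp
  next
    case False
    define b where "b = ptrunc t a"
    have b: "b \<in> Dn n" using a by (simp add: b_def)
    have E: "ptrunc t (shiftj i 1 a) = shiftj i 1 b"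
      using False by (auto simp: shiftj_def ptrunc_def fun_eq_iff b_def)
    have E1: "shiftj j s (shiftj i 1 b) = shiftj i 1 (shiftj j s b)" for s
      by (auto simp: shiftj_def fun_eq_iff)
    \<comment> \<open>\<open>decj\<close> truncates at 0 and so commutes with a shift only if
      \<open>b j\<close> is nonzero; in the other case the lower piece is 0, as are the maps out of
      it.\<close>
    have E2: "decj j (shiftj i 1 b) = shiftj i 1 (decj j b)" if "b j \<noteq> 0"
      using that by (auto simp: shiftj_def decj_def fun_eq_iff)
    have E3: "shiftj j (Suc (t j)) (decj j b) = shiftj j (t j) b" if "b j \<noteq> 0"
      using that by (auto simp: shiftj_def decj_def fun_eq_iff)
    have E4: "shiftj i 1 b j \<noteq> 0" if "b j \<noteq> 0"
      using that by (auto simp: shiftj_def)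
    have z0: "cmap (\<lambda>m. if b j = 0 then {0} else sp C m (decj j b))
        (\<lambda>m. if b j = 0 then \<lambda>_. 0 else dif C m (decj j b))
        (\<lambda>m. if shiftj i 1 b j = 0 then {0} else sp C m (decj j (shiftj i 1 b)))
        (\<lambda>m. if shiftj i 1 b j = 0 then \<lambda>_. 0 else dif C m (decj j (shiftj i 1 b))) 0
        (\<lambda>m. if b j = 0 then \<lambda>_. 0 else mulx C i m (decj j b))"
    proof (cases "b j = 0")
      case True
      then show ?thesis using cmap_zero[OF cplx_zero lo_cplx[of "shiftj i 1 b"]] b i by simp
    next
      case nz: False
      then show ?thesis using mulx_cmap[OF i, of "decj j b"] b E4 E2 by simp
    qed
    have z1: "cmap (at_sp C (shiftj j (t j) b)) (at_dif C (shiftj j (t j) b))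
        (at_sp C (shiftj j (t j) (shiftj i 1 b))) (at_dif C (shiftj j (t j) (shiftj i 1 b))) 0
        (\<lambda>m. mulx C i m (shiftj j (t j) b))"
      unfolding E1 using b i j by (intro mulx_cmap) auto
    have com: "mulx C i m (shiftj j (t j) b)
           ((if b j = 0 then \<lambda>_. 0 else mulpow C j m (decj j b) (Suc (t j))) z) =
          (if shiftj i 1 b j = 0 then \<lambda>_. 0 else mulpow C j (m + 0) (decj j (shiftj i 1 b)) (Suc (t j)))
           ((if b j = 0 then \<lambda>_. 0 else mulx C i m (decj j b)) z)"
      if z: "z \<in> (if b j = 0 then {0} else sp C m (decj j b))" for m z
    proof (cases "b j = 0")
      case True
      then show ?thesis
        using b i j lin_zero[OF cmapD(1)[OF mulx_cmap[OF i, of "shiftj j (t j) b"], of m]]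
          lin_zero[OF mulpow_lin[OF j, of "decj j (shiftj i 1 b)" m "Suc (t j)"]]
        by (simp del: mulpow.simps)
    next
      case nz: False
      then show ?thesis
        using mulx_mulpow[OF i j, of "decj j b" z m "Suc (t j)"] b z E2 E3 E4 by (simp del: mulpow.simps)
    qed
    have "cmap (at_sp ?N a) (at_dif ?N a) (at_sp ?N (shiftj i 1 a)) (at_dif ?N (shiftj i 1 a)) 0
      (cone_map 0 (\<lambda>m. if b j = 0 then (\<lambda>_. 0) else mulx C i m (decj j b))
       (\<lambda>m. mulx C i m (shiftj j (t j) b)))"
      unfolding sp_NakEps dif_NakEps E b_def[symmetric]
      using b i j by (intro cone_cmap lo_cplx x_cmap cplx z0 z1 com) auto
    then show ?thesis using False unfolding mulx_NakEps b_def by simp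
  qed
  show "mulx ?N i m (shiftj l 1 a) (mulx ?N l m a z) = mulx ?N l m (shiftj i 1 a) (mulx ?N i m a z)"
    if i: "i < n" and l: "l < n" and a: "a \<in> Dn n" and z: "z \<in> sp ?N m a" for i l a z m
  proof (cases "i = l \<or> t i \<le> a i \<or> t l \<le> a l")
    case True
    have E: "ptrunc t (shiftj i 1 a) = ptrunc t a" if "t i \<le> a i" for i
      using that by (auto simp: shiftj_def ptrunc_def fun_eq_iff)
    have "t i \<le> shiftj l 1 a i" if "t i \<le> a i" for i l
      using that by (auto simp: shiftj_def)
    moreover have "shiftj l 1 a i = a i" if "i \<noteq> l" for i l
      using that by (simp add: shiftj_def)
    ultimately show ?thesis
      using True by (cases "i = l") (auto simp: mulx_NakEps E simp del: One_nat_def cong: if_cong)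
  next
    case False
    define b where "b = ptrunc t a"
    have b: "b \<in> Dn n" using a by (simp add: b_def)
    have E: "ptrunc t (shiftj i 1 a) = shiftj i 1 b" "ptrunc t (shiftj l 1 a) = shiftj l 1 b"
      using False by (auto simp: shiftj_def ptrunc_def fun_eq_iff b_def)
    have S: "\<not> t i \<le> shiftj l 1 a i" "\<not> t l \<le> shiftj i 1 a l"
      using False by (auto simp: shiftj_def)
    have E1: "shiftj j s (shiftj i 1 b) = shiftj i 1 (shiftj j s b)" for s i
      by (auto simp: shiftj_def fun_eq_iff)
    have E2: "decj j (shiftj i 1 b) = shiftj i 1 (decj j b)" if "b j \<noteq> 0" for i
      using that by (auto simp: shiftj_def decj_def fun_eq_iff)
    have E4: "(shiftj i 1 b j = 0) = False" if "b j \<noteq> 0" for i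
      using that by (auto simp: shiftj_def)
    have "pr1 z \<in> (if b j = 0 then {0} else sp C m (decj j b))" "pr2 z \<in> sp C (m + 1) (shiftj j (t j) b)"
      using z fun_cong[OF sp_NakEps[of t j C a], of m] by (auto simp: cone_sp_def dsum_iff b_def)
    moreover have "mulx C i m (decj j (shiftj l 1 b)) 0 = 0" "mulx C l m (decj j (shiftj i 1 b)) 0 = 0"
      using lin_zero[OF cmapD(1)[OF mulx_cmap]] i l b by auto
    ultimately show ?thesis
      using False mulx_mulx[OF i l, of "decj j b" "pr1 z" m] mulx_mulx[OF i l, of "shiftj j (t j) b" "pr2 z" "m + 1"]
        S b j
      unfolding mulx_NakEps E b_def[symmetric] cone_map_def E1
      by (cases "b j = 0") (auto simp: E2 E4 simp del: One_nat_def split: if_splits)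
  qed
  show "sp ?N m (ptrunc t a) = sp ?N m a" if "a \<in> Dn n" for m a
    by (simp add: NakEps_def)
  show "dif ?N m (ptrunc t a) z = dif ?N m a z" if "a \<in> Dn n" "z \<in> sp ?N m a" for m a z
    by (simp add: NakEps_def)
  show "mulx ?N i m a z = z" if "i < n" "a \<in> Dn n" "t i \<le> a i" "z \<in> sp ?N m a" for i m a z
    using that by (simp add: NakEps_def)
  show "mulx ?N i m (ptrunc t a) z = mulx ?N i m a z"
    if "i < n" "a \<in> Dn n" "a i < t i" "z \<in> sp ?N m a" for i m a z
    using that by (simp add: NakEps_def Let_def) (simp add: ptrunc_def)
qed

section \<open>Slabs\<close>

text \<open>\<open>Slab t j u v C\<close> is the complex \<open>C\<^bsub>u\<^esub> \<rightarrow> C\<^bsub>v + 1\<^esub>\<close> in direction \<open>j\<close>, where the second term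
  is dropped if \<open>v = t\<^sub>j\<close>; it does not depend on the \<open>j\<close>-th coordinate of the multidegree.\<close>

definition Slab :: "deg \<Rightarrow> nat \<Rightarrow> nat \<Rightarrow> nat \<Rightarrow> 'k::field gcx \<Rightarrow> 'k gcx" where
  "Slab t j u v C = \<lparr>
     sp = (\<lambda>m a. cone_sp (at_sp C (a(j := u))) (\<lambda>m. if v < t j then sp C m (a(j := Suc v)) else {0}) m),
     dif = (\<lambda>m a. cone_dif (at_dif C (a(j := u)))
       (\<lambda>m. if v < t j then dif C m (a(j := Suc v)) else (\<lambda>_. 0))
       (\<lambda>m. if v < t j then mulpow C j m (a(j := u)) (Suc v - u) else (\<lambda>_. 0)) m),
     mulx = (\<lambda>i m a. if i = j then (\<lambda>h. h) else cone_map 0 (\<lambda>m. mulx C i m (a(j := u)))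
       (\<lambda>m. if v < t j then mulx C i m (a(j := Suc v)) else (\<lambda>_. 0)) m) \<rparr>"

lemma sp_Slab: "at_sp (Slab t j u v C) a =
    cone_sp (at_sp C (a(j := u))) (\<lambda>m. if v < t j then sp C m (a(j := Suc v)) else {0})"
  and dif_Slab: "at_dif (Slab t j u v C) a = cone_dif (at_dif C (a(j := u)))
     (\<lambda>m. if v < t j then dif C m (a(j := Suc v)) else (\<lambda>_. 0))
     (\<lambda>m. if v < t j then mulpow C j m (a(j := u)) (Suc v - u) else (\<lambda>_. 0))"
  and mulx_Slab: "mulx (Slab t j u v C) i m a = (if i = j then (\<lambda>h. h) else
     cone_map 0 (\<lambda>m. mulx C i m (a(j := u)))
       (\<lambda>m. if v < t j then mulx C i m (a(j := Suc v)) else (\<lambda>_. 0)) m)"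
  by (auto simp: Slab_def fun_eq_iff)

lemma in_Slab_iff: "h \<in> sp (Slab t j u v C) m a \<longleftrightarrow>
    pr1 h \<in> sp C m (a(j := u)) \<and> (if v < t j then pr2 h \<in> sp C (m + 1) (a(j := Suc v)) else pr2 h = 0)"
  by (simp add: Slab_def cone_sp_def dsum_iff)

lemma dif_Slab_apply: "dif (Slab t j u v C) m a h = pairv (dif C m (a(j := u)) (pr1 h))
   (if v < t j then dif C (m + 1) (a(j := Suc v)) (pr2 h)
      - sc (sg m) (mulpow C j m (a(j := u)) (Suc v - u) (pr1 h)) else 0)"
  by (simp add: Slab_def cone_dif_def)

lemma mulx_Slab_apply: "mulx (Slab t j u v C) i m a h = (if i = j then h else
   pairv (mulx C i m (a(j := u)) (pr1 h)) (if v < t j then mulx C i (m + 1) (a(j := Suc v)) (pr2 h) else 0))"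
  by (simp add: Slab_def cone_map_def)

context tdet
begin

context
  fixes j u v assumes j: "j < n" and uv: "u \<le> v" "v \<le> t j"
begin

lemma slab_hi_cplx: "a \<in> Dn n \<Longrightarrow> cplx (\<lambda>m. if v < t j then sp C m (a(j := Suc v)) else {0})
    (\<lambda>m. if v < t j then dif C m (a(j := Suc v)) else (\<lambda>_. 0))"
  using j cplx cplx_zero by (cases "v < t j") auto

lemma slab_cmap: "a \<in> Dn n \<Longrightarrow> cmap (at_sp C (a(j := u))) (at_dif C (a(j := u)))
    (\<lambda>m. if v < t j then sp C m (a(j := Suc v)) else {0})
    (\<lambda>m. if v < t j then dif C m (a(j := Suc v)) else (\<lambda>_. 0)) 0
    (\<lambda>m. if v < t j then mulpow C j m (a(j := u)) (Suc v - u) else (\<lambda>_. 0))"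
  using mulpow_cmap[OF j, of "a(j := u)" "Suc v - u"] j uv cmap_zero[OF cplx cplx_zero]
  by (cases "v < t j") (auto simp: shiftj_upd)

lemma tdet_Slab: "tdet n t (Slab t j u v C)"
proof
  let ?S = "Slab t j u v C"
  show "cplx (at_sp ?S a) (at_dif ?S a)" if "a \<in> Dn n" for a
    unfolding sp_Slab dif_Slab using that j by (intro cone_cplx slab_hi_cplx slab_cmap cplx) auto
  show "cmap (at_sp ?S a) (at_dif ?S a) (at_sp ?S (shiftj i 1 a)) (at_dif ?S (shiftj i 1 a)) 0
      (\<lambda>m. mulx ?S i m a)" if i: "i < n" and a: "a \<in> Dn n" for i a
  proof (cases "i = j")
    case True
    then have E: "(shiftj i 1 a)(j := x) = a(j := x)" for x by (simp add: shiftj_upd)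
    show ?thesis
      unfolding sp_Slab dif_Slab mulx_Slab E using cmap_id True by simp
  next
    case False
    then have E: "(shiftj i 1 a)(j := x) = shiftj i 1 (a(j := x))" for x
      by (auto simp: shiftj_def fun_eq_iff)
    have hi: "cmap (\<lambda>m. if v < t j then sp C m (a(j := Suc v)) else {0})
        (\<lambda>m. if v < t j then dif C m (a(j := Suc v)) else (\<lambda>_. 0))
        (\<lambda>m. if v < t j then sp C m ((shiftj i 1 a)(j := Suc v)) else {0})
        (\<lambda>m. if v < t j then dif C m ((shiftj i 1 a)(j := Suc v)) else (\<lambda>_. 0)) 0
        (\<lambda>m. if v < t j then mulx C i m (a(j := Suc v)) else (\<lambda>_. 0))"
      unfolding E using mulx_cmap[OF i, of "a(j := Suc v)"] a j cmap_zero[OF cplx_zero cplx_zero]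
      by (cases "v < t j") auto
    have lo: "cmap (at_sp C (a(j := u))) (at_dif C (a(j := u)))
        (at_sp C ((shiftj i 1 a)(j := u))) (at_dif C ((shiftj i 1 a)(j := u))) 0
        (\<lambda>m. mulx C i m (a(j := u)))"
      unfolding E using a i j by (intro mulx_cmap) auto
    have com: "(if v < t j then mulx C i m (a(j := Suc v)) else (\<lambda>_. 0))
           ((if v < t j then mulpow C j m (a(j := u)) (Suc v - u) else (\<lambda>_. 0)) z) =
          (if v < t j then mulpow C j (m + 0) ((shiftj i 1 a)(j := u)) (Suc v - u) else (\<lambda>_. 0))
           (mulx C i m (a(j := u)) z)"
      if z: "z \<in> sp C m (a(j := u))" for m z
    proof -
      have "shiftj j (Suc v - u) (a(j := u)) = a(j := Suc v)"
        using uv by (simp add: shiftj_upd)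
      then show ?thesis
        using mulx_mulpow[OF i j, of "a(j := u)" z m "Suc v - u"] a z j
        unfolding E by auto
    qed
    have "cmap (at_sp ?S a) (at_dif ?S a) (at_sp ?S (shiftj i 1 a)) (at_dif ?S (shiftj i 1 a)) 0
      (cone_map 0 (\<lambda>m. mulx C i m (a(j := u)))
        (\<lambda>m. if v < t j then mulx C i m (a(j := Suc v)) else (\<lambda>_. 0)))"
      unfolding sp_Slab dif_Slab
      using a i j by (intro cone_cmap slab_hi_cplx slab_cmap cplx lo hi com) auto
    then show ?thesis using False unfolding mulx_Slab by simp
  qed
  show "mulx ?S i m (shiftj l 1 a) (mulx ?S l m a z) = mulx ?S l m (shiftj i 1 a) (mulx ?S i m a z)"
    if i: "i < n" and l: "l < n" and a: "a \<in> Dn n" and z: "z \<in> sp ?S m a" for i l a z m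
  proof (cases "i = j \<or> l = j")
    case True
    have "(shiftj j 1 a)(j := x) = a(j := x)" for x by (simp add: shiftj_upd)
    then show ?thesis using True by (auto simp: mulx_Slab simp del: One_nat_def cong: if_cong)
  next
    case False
    then have E: "(shiftj i 1 a)(j := x) = shiftj i 1 (a(j := x))" "(shiftj l 1 a)(j := x) = shiftj l 1 (a(j := x))" for x
      by (auto simp: shiftj_def fun_eq_iff)
    show ?thesis
      using z False mulx_mulx[OF i l, of "a(j := u)" "pr1 z" m] mulx_mulx[OF i l, of "a(j := Suc v)" "pr2 z" "m + 1"]
        a j
      unfolding mulx_Slab_apply E by (simp add: in_Slab_iff)
  qed
  have E: "(ptrunc t a)(j := x) = ptrunc t (a(j := x))" if "x \<le> t j" for a x
    using that by (simp add: ptrunc_upd min_absorb1)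
  show "sp ?S m (ptrunc t a) = sp ?S m a" if "a \<in> Dn n" for m a
    using that uv j E[of "Suc v" a] E[of u a] by (auto simp: in_Slab_iff sp_trunc)
  show "dif ?S m (ptrunc t a) z = dif ?S m a z" if "a \<in> Dn n" "z \<in> sp ?S m a" for m a z
    using that uv j E[of "Suc v" a] E[of u a]
    by (auto simp: in_Slab_iff dif_Slab_apply dif_trunc mulpow_trunc)
  show "mulx ?S i m a z = z" if "i < n" "a \<in> Dn n" "t i \<le> a i" "z \<in> sp ?S m a" for i m a z
    using that j by - (rule pair_cong; auto simp: in_Slab_iff mulx_Slab_apply mulx_id)
  show "mulx ?S i m (ptrunc t a) z = mulx ?S i m a z"
    if "i < n" "a \<in> Dn n" "a i < t i" "z \<in> sp ?S m a" for i m a z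
    using that uv j E[of "Suc v" a] E[of u a] by (auto simp: in_Slab_iff mulx_Slab_apply mulx_trunc)
qed

end

end

section \<open>Quasi-isomorphisms on a set of multidegrees\<close>

text \<open>Two index sets are carried because treating a variable freezes its coordinate:
  \<open>P\<close> holds the multidegrees still allowed, \<open>M\<close> the variables whose
  multiplications must be respected since they become arrows of later slabs.\<close>

definition gqis :: "deg set \<Rightarrow> nat set \<Rightarrow> 'k::field gcx \<Rightarrow> 'k gcx \<Rightarrow> int \<Rightarrow>
    (int \<Rightarrow> deg \<Rightarrow> 'k vec \<Rightarrow> 'k vec) \<Rightarrow> bool" where
  "gqis P M C D s f \<longleftrightarrow>
     (\<forall>a\<in>P. qis (at_sp C a) (at_dif C a) (at_sp D a) (at_dif D a) s (\<lambda>m. f m a)) \<and>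
     (\<forall>i\<in>M. \<forall>a\<in>P. \<forall>m. \<forall>z\<in>sp C m a. f m (shiftj i 1 a) (mulx C i m a z) = mulx D i (m + s) a (f m a z))"

lemma gqis_subset: "gqis P M C D s f \<Longrightarrow> P' \<subseteq> P \<Longrightarrow> M' \<subseteq> M \<Longrightarrow> gqis P' M' C D s f"
  unfolding gqis_def by blast

lemma gqis_id: "gqis P M C C 0 (\<lambda>_ _ z. z)" if "tdet n t C" "P \<subseteq> Dn n"
  unfolding gqis_def
proof (intro conjI ballI)
  fix a assume "a \<in> P"
  then have C: "cplx (at_sp C a) (at_dif C a)" using that tdet.cplx by blast
  have "\<exists>y\<in>at_sp C a (m + 1). y = 0 \<and> at_dif C a (m + 1) y = 0" for m
    using sc.subspace_0[OF cplxD(1)[OF C]] lin_zero[OF cplxD(2)[OF C]] by blast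
  then show "qis (at_sp C a) (at_dif C a) (at_sp C a) (at_dif C a) 0 (\<lambda>m z. z)"
    by (intro qis_surj C cmap_id) auto
qed auto

lemma gqis_comp:
  assumes "tdet n t D" "tdet n t D'" "P \<subseteq> Dn n" "gqis P M C D s f" "gqis P M D D' s' g"
  shows "gqis P M C D' (s + s') (\<lambda>m a z. g (m + s) a (f m a z))"
  unfolding gqis_def
proof (intro conjI ballI allI)
  fix a assume "a \<in> P"
  then show "qis (at_sp C a) (at_dif C a) (at_sp D' a) (at_dif D' a) (s + s') (\<lambda>m z. g (m + s) a (f m a z))"
    using assms tdet.cplx unfolding gqis_def by (intro qis_comp[where g = "\<lambda>m. g m a"]) blast+
next
  fix i a m z assume H: "i \<in> M" "a \<in> P" "z \<in> sp C m a"
  then have "f m a z \<in> sp D (m + s) a"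
    using assms(4) cmapD(2)[OF qisD(1)] unfolding gqis_def by fast
  then show "g (m + s) (shiftj i 1 a) (f m (shiftj i 1 a) (mulx C i m a z)) =
      mulx D' i (m + (s + s')) a (g (m + s) a (f m a z))"
    using assms(4,5) H unfolding gqis_def by (simp add: add.assoc)
qed

text \<open>A slab is the cone of a power of \<open>x_j\<close>, so \<open>cone_qis\<close> applies
  once the square with this power commutes. For this \<open>j\<close> lies in \<open>M\<close>, and
  \<open>P\<close> allows every value of the coordinate \<open>j\<close>.\<close>

lemma gqis_Slab:
  assumes C: "tdet n t C" and D: "tdet n t D" and j: "j < n" "j \<in> M" and M: "M \<subseteq> {..<n}" and uv: "u \<le> v" "v \<le> t j"
    and P: "P \<subseteq> Dn n" "\<And>a x. a \<in> P \<Longrightarrow> a(j := x) \<in> P" and f: "gqis P M C D s f"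
  shows "gqis P M (Slab t j u v C) (Slab t j u v D) s
    (\<lambda>m a. cone_map s (\<lambda>m. f m (a(j := u))) (\<lambda>m. if v < t j then f m (a(j := Suc v)) else (\<lambda>_. 0)) m)"
  unfolding gqis_def
proof (intro conjI ballI allI)
  interpret C: tdet n t C by fact
  interpret D: tdet n t D by fact
  have fq: "qis (at_sp C a) (at_dif C a) (at_sp D a) (at_dif D a) s (\<lambda>m. f m a)" if "a \<in> P" for a
    using f that unfolding gqis_def by blast
  have fx: "f m (shiftj i 1 a) (mulx C i m a z) = mulx D i (m + s) a (f m a z)"
    if "i \<in> M" "a \<in> P" "z \<in> sp C m a" for i a m z
    using f that unfolding gqis_def by blast
  note fin = cmapD(2)[OF qisD(1)[OF fq]]
  have fpow: "f m (shiftj j k a) (mulpow C j m a k z) = mulpow D j (m + s) a k (f m a z)"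
    if a: "a \<in> P" and z: "z \<in> sp C m a" for a m z k
  proof (induction k)
    case 0
    then show ?case by (simp add: shiftj_upd)
  next
    case (Suc k)
    have "shiftj j k a \<in> P" using P(2)[OF a] by (simp add: shiftj_upd)
    moreover have "mulpow C j m a k z \<in> sp C m (shiftj j k a)"
      using C.mulpow_in a z P j by blast
    ultimately have "f m (shiftj j 1 (shiftj j k a)) (mulx C j m (shiftj j k a) (mulpow C j m a k z)) =
      mulx D j (m + s) (shiftj j k a) (f m (shiftj j k a) (mulpow C j m a k z))"
      using fx j by blast
    moreover have "shiftj j (Suc k) a = shiftj j 1 (shiftj j k a)" by (simp add: shiftj_upd)
    ultimately show ?case using Suc by simp
  qed
  {
    fix a assume a: "a \<in> P"
    then have Dn: "a \<in> Dn n" using P by blast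
    show "qis (at_sp (Slab t j u v C) a) (at_dif (Slab t j u v C) a)
        (at_sp (Slab t j u v D) a) (at_dif (Slab t j u v D) a) s
        (cone_map s (\<lambda>m. f m (a(j := u))) (\<lambda>m. if v < t j then f m (a(j := Suc v)) else (\<lambda>_. 0)))"
      unfolding sp_Slab dif_Slab
    proof (rule cone_qis)
      show "qis (\<lambda>m. if v < t j then sp C m (a(j := Suc v)) else {0})
          (\<lambda>m. if v < t j then dif C m (a(j := Suc v)) else (\<lambda>_. 0))
          (\<lambda>m. if v < t j then sp D m (a(j := Suc v)) else {0})
          (\<lambda>m. if v < t j then dif D m (a(j := Suc v)) else (\<lambda>_. 0)) s
          (\<lambda>m. if v < t j then f m (a(j := Suc v)) else (\<lambda>_. 0))"
      proof (cases "v < t j")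
        case True
        then show ?thesis using fq P(2)[OF a] by simp
      next
        case False
        then show ?thesis
          using qis_surj[OF cplx_zero cplx_zero cmap_zero[OF cplx_zero cplx_zero]] by simp
      qed
      show "(if v < t j then f m (a(j := Suc v)) else (\<lambda>_. 0))
          ((if v < t j then mulpow C j m (a(j := u)) (Suc v - u) else (\<lambda>_. 0)) z) =
         (if v < t j then mulpow D j (m + s) (a(j := u)) (Suc v - u) else (\<lambda>_. 0)) (f m (a(j := u)) z)"
        if "z \<in> sp C m (a(j := u))" for m z
        using fpow[OF P(2)[OF a] that, of "Suc v - u"] uv by (simp add: shiftj_upd)
    qed (use Dn j uv fq P(2)[OF a] in \<open>auto intro!: C.cplx D.cplx C.slab_hi_cplx D.slab_hi_cplx
        C.slab_cmap D.slab_cmap\<close>)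
  }
  fix i a m z
  assume i: "i \<in> M" and a: "a \<in> P" and z: "z \<in> sp (Slab t j u v C) m a"
  have E: "(shiftj i 1 a)(j := x) = shiftj i 1 (a(j := x))" if "i \<noteq> j" for x
    using that by (auto simp: shiftj_def fun_eq_iff)
  have E': "(shiftj j 1 a)(j := x) = a(j := x)" for x by (simp add: shiftj_upd)
  show "cone_map s (\<lambda>m. f m ((shiftj i 1 a)(j := u)))
      (\<lambda>m. if v < t j then f m ((shiftj i 1 a)(j := Suc v)) else (\<lambda>_. 0)) m (mulx (Slab t j u v C) i m a z) =
     mulx (Slab t j u v D) i (m + s) a
      (cone_map s (\<lambda>m. f m (a(j := u))) (\<lambda>m. if v < t j then f m (a(j := Suc v)) else (\<lambda>_. 0)) m z)"
  proof (cases "i = j")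
    case True
    then show ?thesis by (simp add: mulx_Slab_apply E' del: One_nat_def cong: if_cong)
  next
    case False
    \<comment> \<open>For odd \<open>s\<close> the second component carries a sign, which has to be
      moved past the multiplication.\<close>
    have "mulx D i (m + s + 1) (a(j := Suc v)) (- y) = - mulx D i (m + s + 1) (a(j := Suc v)) y" for y
      using M i P(1) a j by (intro lin_minus[OF cmapD(1)[OF D.mulx_cmap]]) auto
    moreover have "f m (shiftj i 1 (a(j := u))) (mulx C i m (a(j := u)) (pr1 z)) =
        mulx D i (m + s) (a(j := u)) (f m (a(j := u)) (pr1 z))"
      using z by (intro fx i P a) (simp add: in_Slab_iff)
    moreover have "f (m + 1) (shiftj i 1 (a(j := Suc v))) (mulx C i (m + 1) (a(j := Suc v)) (pr2 z)) =
        mulx D i (m + s + 1) (a(j := Suc v)) (f (m + 1) (a(j := Suc v)) (pr2 z))" if "v < t j"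
      using fx[OF i P(2)[OF a], of "pr2 z" "m + 1" "Suc v"] z that
      by (simp add: in_Slab_iff add.commute add.left_commute)
    ultimately show ?thesis
      using False
      unfolding mulx_Slab_apply E[OF False] by (simp add: cone_map_def)
  qed
qed

section \<open>One step of the Nakayama functor on a slab\<close>

text \<open>\<open>u\<close>, \<open>v\<close> are the bounds of a slab and \<open>g\<close> is its
  cohomological shift. On triples with \<open>u \<le> v\<close> the \<open>v - 1\<close> of the
  first branch is a true predecessor. The second branch encodes the single term \<open>C_v\<close>
  as the slab from \<open>v\<close> to \<open>t\<close>.\<close>

fun bstep :: "nat \<Rightarrow> nat \<times> nat \<times> nat \<Rightarrow> nat \<times> nat \<times> nat" where
  "bstep t (u, v, g) = (if u > 0 then (u - 1, v - 1, g) else (v, t, Suc g))"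

context tdet
begin

context
  fixes j assumes j: "j < n"
begin

lemma nak_upd_ptrunc:
  assumes "x \<le> t j"
  shows "ptrunc t (a(j := x)) j = x"
    "decj j (ptrunc t (a(j := x))) = ptrunc t (a(j := x - 1))"
    "shiftj j (t j) (ptrunc t (a(j := x))) = (ptrunc t a)(j := x + t j)"
  using assms by (auto simp: ptrunc_def decj_def shiftj_def fun_eq_iff)

lemma nak_hi_sp: "a \<in> Dn n \<Longrightarrow> sp C m ((ptrunc t a)(j := x + t j)) = sp C m (a(j := t j))"
  using sp_upd_trunc[OF j, of "ptrunc t a" "x + t j" m] sp_trunc[of "a(j := t j)" m] j
  by (simp add: ptrunc_upd)

lemma nak_in:
  assumes "a \<in> Dn n" "x \<le> t j"
  shows "h \<in> sp (NakEps t j C) m (a(j := x)) \<longleftrightarrow>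
    (if x = 0 then pr1 h = 0 else pr1 h \<in> sp C m (a(j := x - 1))) \<and> pr2 h \<in> sp C (m + 1) (a(j := t j))"
  using assms j sp_trunc[of "a(j := x - 1)" m]
  by (simp add: fun_cong[OF sp_NakEps] cone_sp_def dsum_iff nak_upd_ptrunc nak_hi_sp)

text \<open>The arrow of \<open>NakEps\<close> has exponent \<open>t j + 1\<close>, but starting
  from coordinate \<open>x - 1\<close> the threshold is reached after \<open>t j + 1 - x\<close>
  multiplications, and the other \<open>x\<close> are identities.\<close>

lemma nak_dif:
  assumes a: "a \<in> Dn n" and x: "x \<le> t j" and h: "h \<in> sp (NakEps t j C) m (a(j := x))"
  shows "dif (NakEps t j C) m (a(j := x)) h = pairv (if x = 0 then 0 else dif C m (a(j := x - 1)) (pr1 h))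
    (dif C (m + 1) (a(j := t j)) (pr2 h)
      - (if x = 0 then 0 else sc (sg m) (mulpow C j m (a(j := x - 1)) (Suc (t j) - x) (pr1 h))))"
proof -
  have h': "if x = 0 then pr1 h = 0 else pr1 h \<in> sp C m (a(j := x - 1))"
    "pr2 h \<in> sp C (m + 1) (a(j := t j))"
    using h nak_in[OF a x] by auto
  have "dif C (m + 1) ((ptrunc t a)(j := x + t j)) (pr2 h) = dif C (m + 1) (a(j := t j)) (pr2 h)"
    using dif_upd_trunc[OF j, of "ptrunc t a" "x + t j" "pr2 h" "m + 1"]
      dif_trunc[of "a(j := t j)" "pr2 h" "m + 1"] nak_hi_sp[OF a, of "m + 1" 0] h' a j
    by (simp add: ptrunc_upd)
  moreover have "dif C m (ptrunc t (a(j := x - 1))) (pr1 h) = dif C m (a(j := x - 1)) (pr1 h)"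
    if "x \<noteq> 0"
    using that h' a j by (intro dif_trunc) auto
  moreover have "mulpow C j m (ptrunc t (a(j := x - 1))) (Suc (t j)) (pr1 h) =
      mulpow C j m (a(j := x - 1)) (Suc (t j) - x) (pr1 h)" if "x \<noteq> 0"
  proof -
    have "mulpow C j m (ptrunc t (a(j := x - 1))) (Suc (t j) - x + x) (pr1 h) =
        mulpow C j m (ptrunc t (a(j := x - 1))) (Suc (t j) - x) (pr1 h)"
      using that h' a j x by (intro mulpow_beyond) (auto simp: sp_trunc ptrunc_apply)
    also have "\<dots> = mulpow C j m (a(j := x - 1)) (Suc (t j) - x) (pr1 h)"
      using that h' a j x by (intro mulpow_trunc) auto
    finally show ?thesis using x by (simp del: mulpow.simps)
  qed
  ultimately show ?thesis
    unfolding fun_cong[OF dif_NakEps] cone_dif_def nak_upd_ptrunc[OF x]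
    by (simp del: mulpow.simps)
qed

text \<open>For \<open>i = j\<close> and \<open>x = t j\<close> multiplication on
  \<open>NakEps\<close> is the identity, whereas \<open>x_j\<close> on the first component starts
  from \<open>t j - 1\<close> and need not be; hence the last assumption.\<close>

lemma nak_mulx:
  assumes a: "a \<in> Dn n" and x: "x \<le> t j" and h: "h \<in> sp (NakEps t j C) m (a(j := x))"
    and i: "i < n" "i = j \<Longrightarrow> x < t j"
  shows "mulx (NakEps t j C) i m (a(j := x)) h =
    pairv (if x = 0 then 0 else mulx C i m (a(j := x - 1)) (pr1 h)) (mulx C i (m + 1) (a(j := t j)) (pr2 h))"
proof -
  have h': "if x = 0 then pr1 h = 0 else pr1 h \<in> sp C m (a(j := x - 1))"
    "pr2 h \<in> sp C (m + 1) (a(j := t j))"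
    using h nak_in[OF a x] by auto
  show ?thesis
  proof (cases "t i \<le> (a(j := x)) i")
    case True
    then have "i \<noteq> j" using i by auto
    then show ?thesis
      using True h' i(1) a j mulx_id[of i "a(j := x - 1)" "pr1 h" m]
        mulx_id[of i "a(j := t j)" "pr2 h" "m + 1"]
      by (auto simp: mulx_NakEps eq_pairv_iff)
  next
    case False
    have "mulx C i (m + 1) ((ptrunc t a)(j := x + t j)) (pr2 h) = mulx C i (m + 1) (a(j := t j)) (pr2 h)"
    proof (cases "i = j")
      case True
      then show ?thesis
        using h' a j mulx_id[OF i(1), of "a(j := t j)" "pr2 h" "m + 1"]
          mulx_id[OF i(1), of "(ptrunc t a)(j := x + t j)" "pr2 h" "m + 1"] nak_hi_sp[OF a]
        by simp
    next
      case ij: False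
      have "ptrunc t ((ptrunc t a)(j := x + t j)) = ptrunc t (a(j := t j))"
        by (simp add: ptrunc_upd)
      then show ?thesis
        using h' a j False ij mulx_trunc[OF i(1), of "a(j := t j)" "pr2 h" "m + 1"]
          mulx_trunc[OF i(1), of "(ptrunc t a)(j := x + t j)" "pr2 h" "m + 1"] nak_hi_sp[OF a]
        by (simp add: ptrunc_apply)
    qed
    moreover have "mulx C i m (ptrunc t (a(j := x - 1))) (pr1 h) = mulx C i m (a(j := x - 1)) (pr1 h)"
      if "x \<noteq> 0"
      using that h' a j False i by (intro mulx_trunc) auto
    ultimately show ?thesis
      using False unfolding mulx_NakEps nak_upd_ptrunc[OF x] cone_map_def by simp
  qed
qed

lemma nak_mulpow:
  assumes a: "a \<in> Dn n" and h: "h \<in> sp (NakEps t j C) m (a(j := x))" and s: "x + s \<le> t j"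
  shows "mulpow (NakEps t j C) j m (a(j := x)) s h =
    pairv (if x = 0 then 0 else mulpow C j m (a(j := x - 1)) s (pr1 h)) (pr2 h)"
  using s
proof (induction s)
  case 0
  then show ?case using nak_in[OF a, of x] h by (auto simp: eq_pairv_iff split: if_splits)
next
  case (Suc s)
  interpret N: tdet n t "NakEps t j C" using tdet_NakEps j by blast
  have E: "shiftj j s (a(j := x)) = a(j := x + s)" by (simp add: shiftj_upd)
  have E': "x \<noteq> 0 \<Longrightarrow> shiftj j s (a(j := x - 1)) = a(j := x + s - 1)" by (simp add: shiftj_upd)
  have w: "mulpow (NakEps t j C) j m (a(j := x)) s h \<in> sp (NakEps t j C) m (a(j := x + s))"
    using N.mulpow_in[OF j, of "a(j := x)" h m s] h a j unfolding E by simp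
  have h2: "pr2 h \<in> sp C (m + 1) (a(j := t j))"
    using h nak_in[OF a, of x] Suc.prems by auto
  have "mulx C j m (a(j := x + s - 1)) 0 = 0"
    using a j by (intro lin_zero[OF cmapD(1)[OF mulx_cmap]]) auto
  moreover have "mulx C j (m + 1) (a(j := t j)) (pr2 h) = pr2 h"
    using a j h2 by (intro mulx_id) auto
  moreover have "pr1 (mulpow (NakEps t j C) j m (a(j := x)) s h) =
      (if x = 0 then 0 else mulpow C j m (a(j := x - 1)) s (pr1 h))"
    "pr2 (mulpow (NakEps t j C) j m (a(j := x)) s h) = pr2 h"
    using Suc by (simp_all add: fun_upd_def)
  ultimately have "mulx (NakEps t j C) j m (a(j := x + s)) (mulpow (NakEps t j C) j m (a(j := x)) s h) =
    pairv (if x = 0 then 0 else mulpow C j m (a(j := x - 1)) (Suc s) (pr1 h)) (pr2 h)"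
    using nak_mulx[OF a _ w j] Suc.prems E' by (cases "x = 0") (simp_all add: pairv_eq_iff)
  then show ?case using E by (simp add: fun_upd_def zero_fun_def)
qed

text \<open>The components are \<open>pr1 (pr1 h)\<close> in \<open>C_{u-1}\<close> (zero for
  \<open>u = 0\<close>), \<open>pr2 (pr1 h)\<close> in \<open>C_t\<close>,
  \<open>pr1 (pr2 h)\<close> in \<open>C_v\<close> and \<open>pr2 (pr2 h)\<close> in
  \<open>C_t\<close>. For \<open>v < t j\<close> both copies of \<open>C_t\<close> are dropped. For
  \<open>v = t j\<close> the second half of \<open>h\<close> is 0, and the only copy of
  \<open>C_t\<close> is kept, as it is \<open>C_v\<close>.\<close>

definition nak_slab_map :: "nat \<Rightarrow> nat \<Rightarrow> 'k vec \<Rightarrow> 'k vec" where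
  "nak_slab_map u v h =
    (if u = 0 then pairv (if v = t j then pr2 (pr1 h) else pr1 (pr2 h)) 0
     else if v = t j then pr1 h else pairv (pr1 (pr1 h)) (pr1 (pr2 h)))"

lemma lin_nak_slab_map: "lin (nak_slab_map u v)"
  unfolding nak_slab_map_def
  by (cases "u = 0"; cases "v = t j")
    (auto intro!: lin_pairv lin_comp[of pr1] lin_comp[of pr2] lin_pr lin_const_zero)

text \<open>The projection is surjective, and its kernel is zero or the cone of the identity of
  \<open>C_t\<close> up to sign, hence acyclic, so \<open>qis_surj\<close> applies.\<close>

lemma slab_nak_gqis:
  assumes uv: "u \<le> v" "v \<le> t j"
    and s: "bstep (t j) (u, v, g) = (u', v', g')"
  shows "gqis (Dn n) {..<n} (Slab t j u v (NakEps t j C)) (Slab t j u' v' C) (int g' - int g)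
    (\<lambda>m a. nak_slab_map u v)"
proof -
  let ?N = "NakEps t j C"
  let ?S = "Slab t j u v ?N" and ?T = "Slab t j u' v' C"
  have uv': "u' \<le> v'" "v' \<le> t j" using uv s by (auto split: if_splits)
  have s1: "u = 0 \<Longrightarrow> u' = v \<and> v' = t j \<and> int g' - int g = 1"
    and s2: "u \<noteq> 0 \<Longrightarrow> u' = u - 1 \<and> v' = v - 1 \<and> g' = g"
    using s by auto
  interpret N: tdet n t ?N using tdet_NakEps j by blast
  have S: "tdet n t ?S" using N.tdet_Slab[OF j uv] .
  have T: "tdet n t ?T" using tdet_Slab[OF j uv'] .
  let ?s = "int g' - int g"
  have Sin: "h \<in> sp ?S m a \<longleftrightarrow>
      (if u = 0 then pr1 (pr1 h) = 0 else pr1 (pr1 h) \<in> sp C m (a(j := u - 1))) \<and>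
      pr2 (pr1 h) \<in> sp C (m + 1) (a(j := t j)) \<and>
      (if v < t j then pr1 (pr2 h) \<in> sp C (m + 1) (a(j := v)) \<and> pr2 (pr2 h) \<in> sp C (m + 1 + 1) (a(j := t j))
       else pr2 h = 0)" if "a \<in> Dn n" for h m a
    using that uv nak_in[of a u "pr1 h" m] nak_in[of a "Suc v" "pr2 h" "m + 1"]
    by (simp add: in_Slab_iff)
  have Sdif: "dif ?S m a h = pairv
      (pairv (if u = 0 then 0 else dif C m (a(j := u - 1)) (pr1 (pr1 h)))
        (dif C (m + 1) (a(j := t j)) (pr2 (pr1 h))
         - (if u = 0 then 0 else sc (sg m) (mulpow C j m (a(j := u - 1)) (Suc (t j) - u) (pr1 (pr1 h))))))
      (if v < t j then pairv
         (dif C (m + 1) (a(j := v)) (pr1 (pr2 h)) -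
            (if u = 0 then 0 else sc (sg m) (mulpow C j m (a(j := u - 1)) (Suc v - u) (pr1 (pr1 h)))))
         (dif C (m + 1 + 1) (a(j := t j)) (pr2 (pr2 h))
           - sc (sg (m + 1)) (mulpow C j (m + 1) (a(j := v)) (t j - v) (pr1 (pr2 h))) - sc (sg m) (pr2 (pr1 h)))
       else 0)" if a: "a \<in> Dn n" and h: "h \<in> sp ?S m a" for h m a
  proof -
    have "pr1 h \<in> sp ?N m (a(j := u))" "v < t j \<Longrightarrow> pr2 h \<in> sp ?N (m + 1) (a(j := Suc v))"
      using h by (auto simp: in_Slab_iff)
    then show ?thesis
      using a uv nak_dif[of a u "pr1 h" m] nak_dif[of a "Suc v" "pr2 h" "m + 1"]
        nak_mulpow[OF a, of "pr1 h" m u "Suc v - u"]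
      by (auto simp: dif_Slab_apply pairv_eq_iff pairv_diff scale_pairv simp del: mulpow.simps)
  qed
  have Smulx: "mulx ?S i m a h = pairv
      (pairv (if u = 0 then 0 else mulx C i m (a(j := u - 1)) (pr1 (pr1 h)))
        (mulx C i (m + 1) (a(j := t j)) (pr2 (pr1 h))))
      (if v < t j then pairv (mulx C i (m + 1) (a(j := v)) (pr1 (pr2 h)))
        (mulx C i (m + 1 + 1) (a(j := t j)) (pr2 (pr2 h))) else 0)"
    if a: "a \<in> Dn n" and h: "h \<in> sp ?S m a" and i: "i < n" "i \<noteq> j" for h m a i
  proof -
    have "pr1 h \<in> sp ?N m (a(j := u))" "v < t j \<Longrightarrow> pr2 h \<in> sp ?N (m + 1) (a(j := Suc v))"
      using h by (auto simp: in_Slab_iff)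
    then show ?thesis
      using a uv i nak_mulx[of a u "pr1 h" m i] nak_mulx[of a "Suc v" "pr2 h" "m + 1" i]
      by (simp add: mulx_Slab_apply)
  qed
  have Tin: "nak_slab_map u v h \<in> sp ?T (m + ?s) a" if "a \<in> Dn n" "h \<in> sp ?S m a" for h m a
    using that(2) uv s1 s2 unfolding Sin[OF that(1)]
    by (auto simp: in_Slab_iff nak_slab_map_def split: if_splits)
  have e: "u \<noteq> 0 \<Longrightarrow> Suc (v - 1) = v" "u \<noteq> 0 \<Longrightarrow> Suc (v - 1) - (u - 1) = Suc v - u"
    using uv by auto
  have Tdif: "dif ?T (m + ?s) a (nak_slab_map u v h) = nak_slab_map u v (dif ?S m a h)"
    if "a \<in> Dn n" "h \<in> sp ?S m a" for h m a
    using that(2) uv s1 s2 e unfolding Sdif[OF that] dif_Slab_apply[of t j u' v' C] Sin[OF that(1)]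
    by (cases "u = 0"; cases "v = t j") (auto simp: nak_slab_map_def pairv_eq_iff simp del: mulpow.simps)
  have Tmulx: "nak_slab_map u v (mulx ?S i m a h) = mulx ?T i (m + ?s) a (nak_slab_map u v h)"
    if "a \<in> Dn n" "h \<in> sp ?S m a" "i < n" for h m a i
  proof (cases "i = j")
    case True
    then show ?thesis by (simp add: mulx_Slab_apply)
  next
    case False
    show ?thesis
      using that(2) uv s1 s2 e False
      unfolding Smulx[OF that False] mulx_Slab_apply[of t j u'] Sin[OF that(1)]
      by (cases "u = 0"; cases "v = t j") (auto simp: nak_slab_map_def pairv_eq_iff)
  qed
  have surj: "\<exists>h\<in>sp ?S m a. nak_slab_map u v h = w"
    if a: "a \<in> Dn n" and w: "w \<in> sp ?T (m + ?s) a" for m a w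
  proof -
    have Z: "0 \<in> sp C l (a(j := x))" for l x
      using a j by (intro sc.subspace_0[OF cplxD(1)[OF cplx]]) auto
    \<comment> \<open>A preimage with zeros in the discarded components.\<close>
    define h where "h = (if u = 0 then if v = t j then pairv (pairv 0 (pr1 w)) 0 else pairv 0 (pairv (pr1 w) 0)
      else if v = t j then pairv w 0 else pairv (pairv (pr1 w) 0) (pairv (pr2 w) 0))"
    have "h \<in> sp ?S m a" "nak_slab_map u v h = w"
      using w uv s1 s2 e Z unfolding Sin[OF a] in_Slab_iff[of w t j u' v' C] h_def
      by (auto simp: nak_slab_map_def pairv_eq_zero eq_pairv_iff[of w, symmetric] split: if_splits
          intro!: pair_cong[of _ w])
    then show ?thesis by blast
  qed
  have ker: "\<exists>y\<in>sp ?S (m + 1) a. nak_slab_map u v y = 0 \<and> dif ?S (m + 1) a y = h"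
    if a: "a \<in> Dn n" and h: "h \<in> sp ?S m a" "nak_slab_map u v h = 0" "dif ?S m a h = 0" for m a h
  proof (cases "v = t j")
    case True
    \<comment> \<open>For \<open>v = t j\<close> nothing is discarded, so the kernel is
      zero.\<close>
    have "h = 0"
      using h(1,2) True uv unfolding Sin[OF a]
      by (auto simp: nak_slab_map_def pairv_eq_zero split: if_splits intro!: pair_cong[of h 0] pair_cong[of "pr1 h" 0])
    moreover have "0 \<in> sp ?S (m + 1) a" "dif ?S (m + 1) a 0 = 0"
      using sc.subspace_0[OF cplxD(1)[OF tdet.cplx[OF S a]]] lin_zero[OF cplxD(2)[OF tdet.cplx[OF S a]]]
      by auto
    ultimately show ?thesis using lin_zero[OF lin_nak_slab_map] by blast
  next
    case False
    have Ca: "cplx (at_sp C (a(j := x))) (at_dif C (a(j := x)))" for x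
      using cplx a j by simp
    note zero = sc.subspace_0[OF cplxD(1)[OF Ca]] lin_zero[OF cplxD(2)[OF Ca]]
      lin_zero[OF mulpow_lin[OF j, of "a(j := x)" for x]]
    have h0: "pr1 (pr1 h) = 0" "pr1 (pr2 h) = 0" "pr2 (pr2 h) \<in> sp C (m + 1 + 1) (a(j := t j))"
      using h(1,2) False uv unfolding Sin[OF a]
      by (auto simp: nak_slab_map_def pairv_eq_zero split: if_splits)
    have d: "dif C (m + 1 + 1) (a(j := t j)) (pr2 (pr2 h)) = sc (sg m) (pr2 (pr1 h))"
      using h(3) False uv a j unfolding Sdif[OF a h(1)] h0
      by (simp add: pairv_eq_zero zero split: if_splits)
    \<comment> \<open>By \<open>d\<close> the \<open>C_t\<close> component of \<open>pr1 h\<close>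
      is, up to sign, the boundary of the one in \<open>pr2 h\<close>. Moving the latter into the
      first slot gives an element with boundary \<open>h\<close>.\<close>
    define y where "y = pairv (pairv 0 (sc (sg m) (pr2 (pr2 h)))) 0"
    have y: "y \<in> sp ?S (m + 1) a"
      unfolding Sin[OF a] y_def using h0(3) zero(1) cplxD(1)[OF Ca] by (auto intro: sc.subspace_scale sc.subspace_neg)
    moreover have "nak_slab_map u v y = 0"
      using False by (simp add: nak_slab_map_def y_def)
    moreover have "dif ?S (m + 1) a y = h"
      using False uv a j h0 d unfolding Sdif[OF a y]
      by (auto simp: y_def zero lin_minus[OF cplxD(2)[OF Ca]] lin_scale[OF cplxD(2)[OF Ca]]
          intro!: pair_cong[of _ h] pair_cong[of _ "pr1 h"] pair_cong[of _ "pr2 h"])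
    ultimately show ?thesis by blast
  qed
  show ?thesis
    unfolding gqis_def
  proof (intro conjI ballI allI)
    fix a assume a: "a \<in> Dn n"
    show "qis (at_sp ?S a) (at_dif ?S a) (at_sp ?T a) (at_dif ?T a) ?s (\<lambda>m. nak_slab_map u v)"
      using Tin[OF a] Tdif[OF a] surj[OF a] ker[OF a] lin_nak_slab_map
      by (intro qis_surj tdet.cplx[OF S a] tdet.cplx[OF T a]) (auto simp: cmap_def)
  qed (use Tmulx in auto)
qed

lemma tdet_nak_funpow: "tdet n t ((NakEps t j ^^ k) C)"
  by (induction k) (auto intro: tdet.tdet_NakEps[OF _ j] tdet_axioms)

end

end

section \<open>Iterated steps in one variable\<close>

lemma bstep_invariant:
  assumes "(bstep t ^^ k) (u, v, g) = (u', v', g')" "u \<le> v" "v \<le> t"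
  shows "u' \<le> v' \<and> v' \<le> t"
  using assms
proof (induction k arbitrary: u v g)
  case (Suc k)
  obtain u1 v1 g1 where s: "bstep t (u, v, g) = (u1, v1, g1)" by (metis prod_cases3)
  have "u1 \<le> v1 \<and> v1 \<le> t" using s Suc.prems by (auto split: if_splits)
  then show ?case using Suc.IH[of u1 v1 g1] Suc.prems s by (simp add: funpow_swap1[symmetric] funpow_Suc_right del: funpow.simps bstep.simps)
qed auto

text \<open>The outermost \<open>NakEps\<close> meets the slab first, so the first
  \<open>bstep\<close> belongs to it, and the induction continues with the inner factors.\<close>

lemma slab_nak_power_gqis:
  assumes C: "tdet n t C" and j: "j < n"
    and uv: "u \<le> v" "v \<le> t j"
    and s: "(bstep (t j) ^^ k) (u, v, g) = (u', v', g')"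
  shows "\<exists>f. gqis (Dn n) {..<n} (Slab t j u v ((NakEps t j ^^ k) C)) (Slab t j u' v' C) (int g' - int g) f"
  using uv s
proof (induction k arbitrary: u v g)
  case 0
  then show ?case using gqis_id[OF tdet.tdet_Slab[OF C j, of u v], of "Dn n" "{..<n}"] by auto
next
  case (Suc k)
  interpret tdet n t "(NakEps t j ^^ k) C" using tdet.tdet_nak_funpow[OF C j] .
  obtain u1 v1 g1 where s: "bstep (t j) (u, v, g) = (u1, v1, g1)" by (metis prod_cases3)
  have uv1: "u1 \<le> v1" "v1 \<le> t j" using s Suc.prems by (auto split: if_splits)
  have s': "(bstep (t j) ^^ k) (u1, v1, g1) = (u', v', g')"
    using Suc.prems(3) s by (simp add: funpow_Suc_right del: funpow.simps bstep.simps)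
  obtain f where f: "gqis (Dn n) {..<n} (Slab t j u1 v1 ((NakEps t j ^^ k) C)) (Slab t j u' v' C) (int g' - int g1) f"
    using Suc.IH[OF uv1 s'] by blast
  have "u' \<le> v'" "v' \<le> t j" using bstep_invariant[OF s' uv1] by auto
  then show ?case
    using gqis_comp[OF tdet_Slab[OF j uv1] tdet.tdet_Slab[OF C j] subset_refl slab_nak_gqis[OF j Suc.prems(1,2) s] f]
    by auto
qed

text \<open>Restricting to the multidegrees with \<open>a\<^sub>j = x\<close> is the slab \<open>u = x\<close>, \<open>v = t\<^sub>j\<close>.\<close>

lemma restrict_gqis:
  assumes C: "tdet n t C" and j: "j < n" and x: "x \<le> t j"
    and P: "P \<subseteq> {a \<in> Dn n. a j = x}" and M: "M \<subseteq> {..<n} - {j}"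
  shows "gqis P M C (Slab t j x (t j) C) 0 (\<lambda>m a z. pairv z 0)"
  unfolding gqis_def
proof (intro conjI ballI allI)
  let ?S = "Slab t j x (t j) C"
  fix a assume "a \<in> P"
  then have a: "a \<in> Dn n" "a(j := x) = a" using P by auto
  note Ca = tdet.cplx[OF C a(1)]
  show "qis (at_sp C a) (at_dif C a) (at_sp ?S a) (at_dif ?S a) 0 (\<lambda>m z. pairv z 0)"
  proof (rule qis_surj[OF Ca tdet.cplx[OF tdet.tdet_Slab[OF C j x order_refl] a(1)]])
    show "cmap (at_sp C a) (at_dif C a) (at_sp ?S a) (at_dif ?S a) 0 (\<lambda>m z. pairv z 0)"
      by (auto simp: cmap_def in_Slab_iff dif_Slab_apply a intro: lin_pairv lin_id lin_const_zero)
    show "\<exists>z\<in>at_sp C a m. pairv z 0 = w" if "w \<in> at_sp ?S a (m + 0)" for m w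
      using that by (intro bexI[of _ "pr1 w"]) (auto simp: in_Slab_iff a eq_pairv_iff[of w, symmetric] intro!: pair_cong[of _ w])
    show "\<exists>y\<in>at_sp C a (m + 1). pairv y 0 = 0 \<and> at_dif C a (m + 1) y = z"
      if "z \<in> at_sp C a m" "pairv z 0 = 0" for m z
      using that sc.subspace_0[OF cplxD(1)[OF Ca]] lin_zero[OF cplxD(2)[OF Ca]]
      by (auto simp: pairv_eq_zero)
  qed
next
  fix i a m z assume "i \<in> M" "a \<in> P"
  then have "i \<noteq> j" "a(j := x) = a" using P M by auto
  then show "pairv (mulx C i m a z) 0 = mulx (Slab t j x (t j) C) i (m + 0) a (pairv z 0)"
    by (simp add: mulx_Slab_apply)
qed

section \<open>All variables together\<close>

definition slabs :: "deg \<Rightarrow> deg \<Rightarrow> deg \<Rightarrow> nat list \<Rightarrow> 'k::field gcx \<Rightarrow> 'k gcx" where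
  "slabs t u v js C = foldr (\<lambda>j. Slab t j (u j) (v j)) js C"

lemma slabs_simps [simp]:
  "slabs t u v [] C = C" "slabs t u v (j # js) C = Slab t j (u j) (v j) (slabs t u v js C)"
  by (simp_all add: slabs_def)

lemma tdet_slabs:
  assumes "tdet n t C" "set js \<subseteq> {..<n}" "u \<le> v" "v \<le> t"
  shows "tdet n t (slabs t u v js C)"
  using assms(2)
proof (induction js)
  case (Cons j js)
  then show ?case using assms(3,4) by (auto simp: le_fun_def intro!: tdet.tdet_Slab)
qed (use assms in simp)

lemma tdet_Ncomp:
  assumes "tdet n t C" "set js \<subseteq> {..<n}"
  shows "tdet n t (Ncomp t k js C)"
  using assms(2) by (induction js) (auto intro: tdet.tdet_nak_funpow assms(1))

text \<open>For each variable \<open>j\<close> three maps are composed: restriction to coordinate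
  \<open>r j\<close> seen as a slab, the \<open>k j\<close> steps in direction \<open>j\<close>, and
  the induction hypothesis inside the slab. The last one needs the coordinate \<open>j\<close> free
  and \<open>x_j\<close> respected, which holds because \<open>j\<close> does not occur in the tail
  of the list.\<close>

lemma Ncomp_slabs_gqis:
  assumes C: "tdet n t C" and r: "r \<le> t"
    and s: "\<And>j. (bstep (t j) ^^ k j) (r j, t j, 0) = (u j, v j, g j)"
    and js: "set js \<subseteq> {..<n}" "distinct js"
  shows "\<exists>f. gqis {a \<in> Dn n. \<forall>j\<in>set js. a j = r j} ({..<n} - set js)
    (Ncomp t k js C) (slabs t u v js C) (\<Sum>j\<leftarrow>js. int (g j)) f"
  using js
proof (induction js)
  case Nil
  then show ?case using gqis_id[OF C] by auto
next
  case (Cons j js)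
  let ?P = "\<lambda>js. {a \<in> Dn n. \<forall>j\<in>set js. a j = r j}" and ?M = "\<lambda>js. {..<n} - set js"
  let ?D = "Ncomp t k js C" and ?E = "slabs t u v js C"
  have uv: "u j \<le> v j \<and> v j \<le> t j" for j
    using bstep_invariant[OF s, of j] r by (simp add: le_fun_def)
  then have uv': "u \<le> v" "v \<le> t" by (auto simp: le_fun_def)
  have j: "j < n" using Cons.prems by simp
  have D: "tdet n t ?D" using tdet_Ncomp[OF C] Cons.prems by simp
  have E: "tdet n t ?E" using tdet_slabs[OF C _ uv'] Cons.prems by simp
  have ND: "tdet n t ((NakEps t j ^^ k j) ?D)" using tdet.tdet_nak_funpow[OF D j] .
  have rj: "r j \<le> t j" using r by (simp add: le_fun_def)
  obtain f where f: "gqis (?P js) (?M js) ?D ?E (\<Sum>j\<leftarrow>js. int (g j)) f"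
    using Cons by auto
  have 1: "gqis (?P (j # js)) (?M (j # js)) ((NakEps t j ^^ k j) ?D)
      (Slab t j (r j) (t j) ((NakEps t j ^^ k j) ?D)) 0 (\<lambda>m a z. pairv z 0)"
    by (rule restrict_gqis[OF ND j rj]) auto
  obtain f2 where 2: "gqis (?P (j # js)) (?M (j # js)) (Slab t j (r j) (t j) ((NakEps t j ^^ k j) ?D))
      (Slab t j (u j) (v j) ?D) (int (g j)) f2"
    using slab_nak_power_gqis[OF D j rj order_refl s[of j]] gqis_subset[where P' = "?P (j # js)" and M' = "?M (j # js)"]
    by fastforce
  obtain f3 where "gqis (?P js) (?M js) (Slab t j (u j) (v j) ?D) (Slab t j (u j) (v j) ?E) (\<Sum>j\<leftarrow>js. int (g j)) f3"
    using gqis_Slab[OF D E j _ _ _ _ _ _ f] Cons.prems uv[of j] j by fastforce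
  then have 3: "gqis (?P (j # js)) (?M (j # js)) (Slab t j (u j) (v j) ?D) (Slab t j (u j) (v j) ?E) (\<Sum>j\<leftarrow>js. int (g j)) f3"
    by (rule gqis_subset) auto
  have P: "?P (j # js) \<subseteq> Dn n" by auto
  have T: "tdet n t (Slab t j (r j) (t j) ((NakEps t j ^^ k j) ?D))" "tdet n t (Slab t j (u j) (v j) ?D)"
    "tdet n t (Slab t j (u j) (v j) ?E)"
    using uv[of j] rj by (auto intro: tdet.tdet_Slab[OF ND j] tdet.tdet_Slab[OF D j] tdet.tdet_Slab[OF E j])
  show ?case
    using gqis_comp[OF T(2,3) P gqis_comp[OF T(1,2) P 1 2] 3] by auto
qed

section \<open>Modules that are \<open>0\<close> or \<open>K\<close> in each multidegree\<close>

text \<open>The common shape of \<open>S/I\<close> and \<open>K_t{c,t}\<close>. By convexity a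
  product of multiplications between two degrees of \<open>A\<close> never passes through a zero
  piece, so the variables commute.\<close>

locale unit_module =
  fixes n :: nat and t :: deg and A :: "deg set" and C :: "'k::field gcx"
  assumes convex: "\<lbrakk>a \<in> A; c \<in> A; b \<in> Dn n; a \<le> b; b \<le> c\<rbrakk> \<Longrightarrow> b \<in> A"
    and A_trunc: "a \<in> Dn n \<Longrightarrow> ptrunc t a \<in> A \<longleftrightarrow> a \<in> A"
    and sp_eq: "a \<in> Dn n \<Longrightarrow> sp C m a = (if m = 0 \<and> a \<in> A then kline else {0})"
    and dif_eq: "dif C m a z = 0"
    and mulx_lin: "lin (mulx C i m a)"
    and mulx_eq: "i < n \<Longrightarrow> a \<in> A \<Longrightarrow> mulx C i m a z = (if shiftj i 1 a \<in> A then z else 0)"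
begin

lemma sp_cases:
  assumes "a \<in> Dn n" "z \<in> sp C m a"
  obtains "z = 0" | "m = 0" "a \<in> A" "z \<in> kline"
  using assms sp_eq[of a m] by (auto split: if_splits)

lemma mulx_zero: "mulx C i m a 0 = 0"
  by (rule lin_zero[OF mulx_lin])

lemma subspace_kline: "sc.subspace kline"
  by (auto simp: sc.subspace_def kline_def sc_def)

sublocale tdet n t C
proof
  fix a :: deg assume a: "a \<in> Dn n"
  have dif0: "dif C m b = (\<lambda>z. 0)" for m b using dif_eq by auto
  show "cplx (at_sp C a) (at_dif C a)"
    using a sc.subspace_0[OF subspace_kline]
    by (auto simp: cplx_def dif0 sp_eq subspace_kline intro: lin_const_zero)
  fix i assume i: "i < n"
  show "cmap (at_sp C a) (at_dif C a) (at_sp C (shiftj i 1 a)) (at_dif C (shiftj i 1 a)) 0 (\<lambda>m. mulx C i m a)"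
  proof -
    have "mulx C i m a z \<in> sp C m (shiftj i 1 a)" if "z \<in> sp C m a" for m z
      using a that
    proof (cases rule: sp_cases)
      case 1
      then show ?thesis using a i by (simp add: mulx_zero sp_eq kline_def del: One_nat_def)
    next
      case 2
      then show ?thesis using a i by (simp add: mulx_eq sp_eq kline_def del: One_nat_def)
    qed
    then show ?thesis by (simp add: cmap_def mulx_lin dif0 mulx_zero)
  qed
  fix m z assume z: "z \<in> sp C m a"
  show "mulx C i m (shiftj l 1 a) (mulx C l m a z) = mulx C l m (shiftj i 1 a) (mulx C i m a z)"
    if l: "l < n" for l
    using a z
  proof (cases rule: sp_cases)
    case 1
    then show ?thesis by (simp add: mulx_zero)
  next
    case 2
    have *: "mulx C i m (shiftj l 1 a) (mulx C l m a z) = (if shiftj i 1 (shiftj l 1 a) \<in> A then z else 0)"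
      if "i < n" "l < n" for i l
    proof -
      have "shiftj l 1 a \<in> A" if "shiftj i 1 (shiftj l 1 a) \<in> A"
        by (rule convex[OF 2(2) that Dn_shiftj[OF a \<open>l < n\<close>]]) (auto simp: le_fun_def shiftj_def)
      then show ?thesis using that 2 by (simp add: mulx_eq mulx_zero del: One_nat_def)
    qed
    have "shiftj i 1 (shiftj l 1 a) = shiftj l 1 (shiftj i 1 a)"
      by (auto simp: shiftj_def fun_eq_iff)
    then show ?thesis using *[OF i l] *[OF l i] by simp
  qed
  show "mulx C i m a z = z" if "t i \<le> a i"
    using a z
  proof (cases rule: sp_cases)
    case 1
    then show ?thesis by (simp add: mulx_zero)
  next
    case 2
    have "ptrunc t (shiftj i 1 a) = ptrunc t a"
      using that by (auto simp: shiftj_def ptrunc_def fun_eq_iff)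
    then have "shiftj i 1 a \<in> A" using A_trunc[of a] A_trunc[of "shiftj i 1 a"] a i 2 by simp
    then show ?thesis using mulx_eq[OF i 2(2)] by simp
  qed
  show "mulx C i m (ptrunc t a) z = mulx C i m a z" if "a i < t i"
    using a z
  proof (cases rule: sp_cases)
    case 1
    then show ?thesis by (simp add: mulx_zero)
  next
    case 2
    have "shiftj i 1 (ptrunc t a) = ptrunc t (shiftj i 1 a)"
      using that by (auto simp: shiftj_def ptrunc_def fun_eq_iff)
    then show ?thesis
      using mulx_eq[OF i 2(2)] mulx_eq[OF i, of "ptrunc t a"] 2 A_trunc[of "shiftj i 1 a"] A_trunc[OF a] a i
      by simp
  qed
next
  show "sp C m (ptrunc t a) = sp C m a" if "a \<in> Dn n" for m a
    using that by (simp add: sp_eq A_trunc)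
  show "dif C m (ptrunc t a) z = dif C m a z" for m a z
    by (simp add: dif_eq)
qed

end

section \<open>Nested slabs as simplicial cochains\<close>

text \<open>The coefficient of the face \<open>F\<close> in an element of nested slabs; the sign turns the
  differential of the nested cones into the simplicial coboundary.\<close>

primrec face_coeff :: "nat list \<Rightarrow> 'k::field vec \<Rightarrow> nat set \<Rightarrow> 'k" where
  "face_coeff [] h = (\<lambda>F. if F = {} then h 0 else 0)"
| "face_coeff (j # js) h = (\<lambda>F. if j \<in> F then (- 1) ^ card F * face_coeff js (pr2 h) (F - {j})
     else face_coeff js (pr1 h) F)"

lemma lin_face_coeff: "lin (face_coeff js :: 'k::field vec \<Rightarrow> _)"
proof (induction js)
  case (Cons j js)
  have IH: "lin (face_coeff js :: 'k vec \<Rightarrow> _)" by (rule Cons)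
  have "face_coeff js (x + y) F = face_coeff js x F + face_coeff js y F"
    "face_coeff js (sc c x) F = c * face_coeff js x F" for x y :: "'k vec" and c :: 'k and F
    using fun_cong[OF lin_add[OF IH, of x y], of F] fun_cong[OF lin_scale[OF IH, of c x], of F]
    by (simp_all add: sc_def)
  moreover have "sc c \<phi> F = c * \<phi> F" for c :: 'k and \<phi> and F :: "nat set"
    by (simp add: sc_def)
  ultimately have "lin (face_coeff (j # js) :: 'k vec \<Rightarrow> _)"
    by (intro linI ext) (auto simp: algebra_simps)
  then show ?case .
next
  case Nil
  have "lin (face_coeff [] :: 'k vec \<Rightarrow> _)"
    by (intro linI ext) (auto simp: sc_def)
  then show ?case .
qed

lemma face_coeff_simps:
  fixes x y :: "'k::field vec"
  shows
  "face_coeff js (0 :: 'k vec) F = 0"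
  "face_coeff js (x - y) F = face_coeff js x F - face_coeff js y F"
  "face_coeff js (sc c x) F = c * face_coeff js x F"
  "face_coeff js (- x) F = - face_coeff js x F"
  using fun_cong[OF lin_scale[OF lin_face_coeff, of js c x], of F]
  by (simp_all add: lin_zero[OF lin_face_coeff] lin_diff[OF lin_face_coeff]
      lin_minus[OF lin_face_coeff] sc_def)

text \<open>The analogue of \<open>xF\<close> at a stage where only the variables in
  \<open>js\<close> have been turned into slabs.\<close>

definition face_deg :: "deg \<Rightarrow> deg \<Rightarrow> nat list \<Rightarrow> deg \<Rightarrow> nat set \<Rightarrow> deg" where
  "face_deg u v js a F = (\<lambda>i. if i \<in> set js then if i \<in> F then Suc (v i) else u i else a i)"

locale slab_cochains = unit_module n t A C for n t A and C :: "'k::field gcx" +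
  fixes u v :: deg
  assumes uv: "u \<le> v" "v \<le> t"
begin

text \<open>The condition \<open>v i < t i\<close> records that a slab with \<open>v i = t i\<close>
  has no second term, so that \<open>i\<close> cannot be a vertex.\<close>

definition faces :: "nat list \<Rightarrow> deg \<Rightarrow> nat set set" where
  "faces js a = {F. F \<subseteq> set js \<and> (\<forall>i\<in>F. v i < t i) \<and> face_deg u v js a F \<in> A}"

lemma faces_Nil: "F \<in> faces [] a \<longleftrightarrow> F = {} \<and> a \<in> A"
  by (auto simp: faces_def face_deg_def)

lemma faces_Cons:
  assumes "j \<notin> set js"
  shows "F \<in> faces (j # js) a \<longleftrightarrow> (if j \<in> F then v j < t j \<and> F - {j} \<in> faces js (a(j := Suc (v j)))
    else F \<in> faces js (a(j := u j)))"
proof -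
  have "face_deg u v (j # js) a F =
      (if j \<in> F then face_deg u v js (a(j := Suc (v j))) (F - {j}) else face_deg u v js (a(j := u j)) F)"
    using assms by (auto simp: face_deg_def fun_eq_iff)
  then show ?thesis using assms by (auto simp: faces_def)
qed

abbreviation X :: "nat list \<Rightarrow> 'k gcx" where
  "X js \<equiv> slabs t u v js C"

lemma tdet_X: "set js \<subseteq> {..<n} \<Longrightarrow> tdet n t (X js)"
  using tdet_slabs tdet_axioms uv by blast

text \<open>Each vertex stands for the choice of a second component, one homological degree lower.
  Since \<open>C\<close> lives in degree 0, the cardinality of the face is the cohomological
  degree.\<close>

lemma face_coeff_support:
  assumes "distinct js" "set js \<subseteq> {..<n}" "a \<in> Dn n" "h \<in> sp (X js) m a" "face_coeff js h F \<noteq> 0"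
  shows "F \<in> faces js a \<and> int (card F) = - m"
  using assms
proof (induction js arbitrary: a h m F)
  case Nil
  then show ?case by (auto simp: faces_Nil sp_eq split: if_splits)
next
  case (Cons j js)
  have j: "j \<notin> set js" "j < n" using Cons.prems by auto
  have IH: "F \<in> faces js b \<and> int (card F) = - l"
    if "b \<in> Dn n" "h \<in> sp (X js) l b" "face_coeff js h F \<noteq> 0" for b h l F
    using Cons.IH[of b h l F] that Cons.prems by auto
  show ?case
  proof (cases "j \<in> F")
    case True
    then have "face_coeff js (pr2 h) (F - {j}) \<noteq> 0" using Cons.prems by auto
    moreover from this have vt: "v j < t j" "pr2 h \<in> sp (X js) (m + 1) (a(j := Suc (v j)))"
      using Cons.prems by (auto simp: in_Slab_iff face_coeff_simps split: if_splits)
    ultimately have F: "F - {j} \<in> faces js (a(j := Suc (v j)))" "int (card (F - {j})) = - (m + 1)"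
      using IH[of "a(j := Suc (v j))" "pr2 h" "m + 1" "F - {j}"] Cons.prems j by auto
    then have "F - {j} \<subseteq> set js" by (simp add: faces_def)
    then have "finite F" using finite_subset[of "F - {j}" "set js"] by simp
    then have "card F = Suc (card (F - {j}))" using True by (rule card.remove)
    then show ?thesis using F True vt j by (simp add: faces_Cons)
  next
    case False
    then show ?thesis
      using IH[of "a(j := u j)" "pr1 h" m F] Cons.prems j by (simp add: faces_Cons in_Slab_iff)
  qed
qed

lemma face_coeff_surj:
  assumes "distinct js" "set js \<subseteq> {..<n}" "a \<in> Dn n"
    and "\<And>F. \<phi> F \<noteq> 0 \<Longrightarrow> F \<in> faces js a \<and> int (card F) = - m"
  shows "\<exists>h\<in>sp (X js) m a. face_coeff js h = \<phi>"
  using assms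
proof (induction js arbitrary: a m \<phi>)
  case Nil
  define h where "h = (\<lambda>i::nat. if i = 0 then \<phi> {} else 0)"
  have "h = 0" if "\<phi> {} = 0" using that by (auto simp: h_def)
  then have "h \<in> sp C m a"
    using Nil.prems(3) Nil.prems(4)[of "{}"] sp_eq[of a m]
    by (cases "\<phi> {} = 0") (auto simp: faces_Nil kline_def h_def)
  moreover have "face_coeff [] h = \<phi>"
    using Nil.prems(4) by (auto simp: fun_eq_iff faces_Nil h_def)
  ultimately show ?case by auto
next
  case (Cons j js)
  have j: "j \<notin> set js" "j < n" using Cons.prems by auto
  have IH: "\<exists>h\<in>sp (X js) l b. face_coeff js h = \<psi>"
    if "b \<in> Dn n" "\<And>F. \<psi> F \<noteq> 0 \<Longrightarrow> F \<in> faces js b \<and> int (card F) = - l" for b l \<psi>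
    by (rule Cons.IH) (use that Cons.prems in auto)
  define \<phi>0 where "\<phi>0 F = (if j \<in> F then 0 else \<phi> F)" for F
  \<comment> \<open>Undoes the sign of \<open>face_coeff\<close> at the face
    \<open>insert j F\<close>, whose cardinality is \<open>Suc (card F)\<close>.\<close>
  define \<phi>1 where "\<phi>1 F = (if j \<in> F then 0 else (- 1) ^ Suc (card F) * \<phi> (insert j F))" for F
  have s1: "F \<in> faces js (a(j := Suc (v j))) \<and> int (card F) = - (m + 1) \<and> v j < t j" if "\<phi>1 F \<noteq> 0" for F
  proof -
    have F: "j \<notin> F" "\<phi> (insert j F) \<noteq> 0" using that by (auto simp: \<phi>1_def split: if_splits)
    then have *: "insert j F \<in> faces (j # js) a \<and> int (card (insert j F)) = - m" using Cons.prems(4) by blast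
    then have "finite F" by (auto simp: faces_def intro: finite_subset)
    then show ?thesis using * F j by (simp add: faces_Cons)
  qed
  obtain h0 where h0: "h0 \<in> sp (X js) m (a(j := u j))" "face_coeff js h0 = \<phi>0"
  proof -
    have "F \<in> faces js (a(j := u j)) \<and> int (card F) = - m" if "\<phi>0 F \<noteq> 0" for F
      using that Cons.prems(4)[of F] j by (auto simp: \<phi>0_def faces_Cons split: if_splits)
    then show ?thesis using IH[of "a(j := u j)" \<phi>0 m] Cons.prems(3) j that by auto
  qed
  obtain h1 where h1: "h1 \<in> sp (X js) (m + 1) (a(j := Suc (v j)))" "face_coeff js h1 = \<phi>1"
    using IH[of "a(j := Suc (v j))" \<phi>1 "m + 1"] Cons.prems(3) j s1 by auto
  define h where "h = pairv h0 (if v j < t j then h1 else 0)"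
  have "h \<in> sp (X (j # js)) m a" using h0 h1 by (simp add: h_def in_Slab_iff)
  moreover have "face_coeff (j # js) h = \<phi>"
  proof
    fix F
    have \<phi>1: "face_coeff js (if v j < t j then h1 else 0) = \<phi>1"
      using h1(2) s1 by (auto simp: fun_eq_iff face_coeff_simps)
    show "face_coeff (j # js) h F = \<phi> F"
    proof (cases "j \<in> F")
      case True
      show ?thesis
      proof (cases "finite F")
        case fin: True
        then have "card F = Suc (card (F - {j}))" "insert j (F - {j}) = F"
          using True by (auto intro: card.remove simp del: card_Diff_insert card_Diff_singleton)
        then have "face_coeff (j # js) h F = (- 1) ^ card F * ((- 1) ^ card F * \<phi> F)"
          using True \<phi>1 by (simp add: h_def \<phi>1_def)
        then show ?thesis by (simp add: power_mult_distrib[symmetric] flip: mult.assoc)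
      next
        case False
        \<comment> \<open>An infinite set has \<open>card\<close> 0, which would spoil the sign; but
          it is no face, so both sides vanish.\<close>
        then have "\<phi> F = 0" using Cons.prems(4)[of F] finite_subset by (auto simp: faces_def)
        moreover have "insert j (F - {j}) = F" using True by auto
        ultimately show ?thesis using True \<phi>1 by (simp add: h_def \<phi>1_def)
      qed
    next
      case False
      then show ?thesis using h0(2) by (simp add: h_def \<phi>0_def)
    qed
  qed
  ultimately show ?case by blast
qed

lemma face_coeff_inj:
  assumes "distinct js" "set js \<subseteq> {..<n}" "a \<in> Dn n" "h \<in> sp (X js) m a" "face_coeff js h = 0"
  shows "h = 0"
  using assms
proof (induction js arbitrary: a h m)
  case Nil
  then have "h 0 = 0" by (auto simp: fun_eq_iff split: if_splits)
  moreover have "h l = 0" if "l > 0" for l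
    using Nil that sp_eq[of a m] by (auto simp: kline_def split: if_splits)
  ultimately show ?case using gr0I by (metis ext zero_fun_apply)
next
  case (Cons j js)
  have j: "j \<notin> set js" "j < n" using Cons.prems by auto
  have IH: "h = 0" if "b \<in> Dn n" "h \<in> sp (X js) l b" "\<And>F. face_coeff js h F = 0" for b h l
    by (rule Cons.IH[of b _ l]) (use that Cons.prems in auto)
  have z: "face_coeff (j # js) h F = 0" for F using Cons.prems(5) by simp
  have "face_coeff js (pr1 h) F = 0" for F
  proof (cases "j \<in> F")
    case True
    then show ?thesis
      using face_coeff_support[of js "a(j := u j)" "pr1 h" m F] Cons.prems j
      by (auto simp: in_Slab_iff faces_def)
  qed (use z[of F] in auto)
  then have "pr1 h = 0"
    using IH[of "a(j := u j)" "pr1 h" m] Cons.prems j by (auto simp: in_Slab_iff)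
  moreover have "pr2 h = 0"
  proof (cases "v j < t j")
    case True
    then have h2: "pr2 h \<in> sp (X js) (m + 1) (a(j := Suc (v j)))"
      using Cons.prems by (simp add: in_Slab_iff)
    have "face_coeff js (pr2 h) F = 0" for F
    proof (cases "j \<in> F")
      case True
      then show ?thesis
        using face_coeff_support[OF _ _ _ h2, of F] Cons.prems j by (auto simp: faces_def)
    next
      case False
      then show ?thesis using z[of "insert j F"] by simp
    qed
    then show ?thesis
      using IH[OF _ h2] Cons.prems(3) j by auto
  next
    case False
    then show ?thesis using Cons.prems by (simp add: in_Slab_iff)
  qed
  ultimately have "h = 0" by (simp add: pair_cong)
  then show ?case by (simp add: zero_fun_def)
qed

lemma face_coeff_mulx:
  assumes "distinct js" "set js \<subseteq> {..<n}" "a \<in> Dn n" "h \<in> sp (X js) m a" "i < n" "i \<notin> set js"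
  shows "face_coeff js (mulx (X js) i m a h) F =
    (if F \<in> faces js (shiftj i 1 a) then face_coeff js h F else 0)"
  using assms
proof (induction js arbitrary: a h m F)
  case Nil
  have "h \<in> sp C m a" using Nil by simp
  with Nil(3) have "mulx C i m a h = (if shiftj i 1 a \<in> A then h else 0)"
    by (cases rule: sp_cases) (use Nil in \<open>auto simp: mulx_zero mulx_eq\<close>)
  then show ?case by (simp add: faces_Nil)
next
  case (Cons j js)
  have j: "j \<notin> set js" "j < n" "i \<noteq> j" using Cons.prems by auto
  have IH: "face_coeff js (mulx (X js) i l b h) F = (if F \<in> faces js (shiftj i 1 b) then face_coeff js h F else 0)"
    if "b \<in> Dn n" "h \<in> sp (X js) l b" for b h l F
    by (rule Cons.IH) (use that Cons.prems in auto)
  have E: "(shiftj i 1 a)(j := x) = shiftj i 1 (a(j := x))" for x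
    using j by (auto simp: shiftj_def fun_eq_iff)
  have h: "pr1 h \<in> sp (X js) m (a(j := u j))" "v j < t j \<Longrightarrow> pr2 h \<in> sp (X js) (m + 1) (a(j := Suc (v j)))"
    using Cons.prems by (auto simp: in_Slab_iff)
  show ?case
    using IH[OF _ h(1)] IH[OF _ h(2)] Cons.prems(3) j
    by (simp add: mulx_Slab_apply faces_Cons E face_coeff_simps del: One_nat_def)
qed

text \<open>By convexity a face that is present at both ends of the path is present at every step
  between, so its coefficient survives.\<close>

lemma face_coeff_mulpow:
  assumes js: "distinct js" "set js \<subseteq> {..<n}" and a: "a \<in> Dn n" and h: "h \<in> sp (X js) m a"
    and i: "i < n" "i \<notin> set js"
  shows "face_coeff js (mulpow (X js) i m a s h) F =
    (if F \<in> faces js (shiftj i s a) then face_coeff js h F else 0)"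
proof (induction s)
  case 0
  then show ?case using face_coeff_support[OF js a h] by (auto simp: shiftj_upd)
next
  case (Suc s)
  interpret X: tdet n t "X js" using tdet_X js by blast
  have E: "shiftj i 1 (shiftj i s a) = shiftj i (Suc s) a" by (simp add: shiftj_upd)
  have "F \<in> faces js (shiftj i s a)" if "face_coeff js h F \<noteq> 0" "F \<in> faces js (shiftj i (Suc s) a)"
  proof -
    have F: "F \<in> faces js a" using face_coeff_support[OF js a h] that by blast
    have "face_deg u v js (shiftj i s a) F \<in> A"
    proof (rule convex)
      show "face_deg u v js a F \<in> A" "face_deg u v js (shiftj i (Suc s) a) F \<in> A"
        using F that by (auto simp: faces_def)
      show "face_deg u v js (shiftj i s a) F \<in> Dn n"
        using a i js by (auto simp: face_deg_def Dn_def shiftj_def)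
    qed (auto simp: le_fun_def face_deg_def shiftj_def)
    then show ?thesis using F by (auto simp: faces_def)
  qed
  then show ?case
    using face_coeff_mulx[OF js _ X.mulpow_in[OF i(1) a h] i, of s F] Suc a i E by auto
qed

text \<open>As \<open>js\<close> is increasing, \<open>j\<close> is the least vertex: its deletion
  has sign +1, and its presence adds one to the count below every other vertex. Deleting a vertex
  changes the factor \<open>(-1) ^ card F\<close> of \<open>face_coeff\<close> by -1, which matches
  the extra count; together with the minus sign and \<open>sg m\<close> of the cone this factor
  gives the +1.\<close>

lemma face_coeff_dif:
  assumes "sorted_wrt (<) js" "set js \<subseteq> {..<n}" "a \<in> Dn n" "h \<in> sp (X js) m a"
  shows "face_coeff js (dif (X js) m a h) G = (if G \<in> faces js a
    then \<Sum>l\<in>G. (- 1) ^ card {g \<in> G. g < l} * face_coeff js h (G - {l}) else 0)"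
  using assms
proof (induction js arbitrary: a h m G)
  case Nil
  then show ?case by (auto simp: faces_Nil dif_eq)
next
  case (Cons j js)
  have js: "distinct js" "set js \<subseteq> {..<n}" using Cons.prems by (auto simp: strict_sorted_iff)
  have j: "j \<notin> set js" "j < n" "\<And>i. i \<in> set js \<Longrightarrow> j < i" using Cons.prems by auto
  have h: "pr1 h \<in> sp (X js) m (a(j := u j))" "v j < t j \<Longrightarrow> pr2 h \<in> sp (X js) (m + 1) (a(j := Suc (v j)))"
    using Cons.prems by (auto simp: in_Slab_iff)
  have IH: "face_coeff js (dif (X js) l b h) G = (if G \<in> faces js b
      then \<Sum>l\<in>G. (- 1) ^ card {g \<in> G. g < l} * face_coeff js h (G - {l}) else 0)"
    if "b \<in> Dn n" "h \<in> sp (X js) l b" for b h l G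
    by (rule Cons.IH) (use that Cons.prems in auto)
  have aj: "a(j := x) \<in> Dn n" for x using Cons.prems j by simp
  show ?case
  proof (cases "j \<in> G")
    case False
    then have "face_coeff (j # js) (dif (X (j # js)) m a h) G
        = face_coeff js (dif (X js) m (a(j := u j)) (pr1 h)) G"
      by (simp add: dif_Slab_apply)
    then show ?thesis
      using IH[OF aj h(1), of G] False j by (simp add: faces_Cons)
  next
    case True
    define G' where "G' = G - {j}"
    show ?thesis
    proof (cases "G \<in> faces (j # js) a")
      case G: True
      then have v: "v j < t j" and G': "G' \<in> faces js (a(j := Suc (v j)))"
        using True j by (auto simp: faces_Cons G'_def)
      have fin: "finite G" using G by (auto simp: faces_def intro: finite_subset)
      have jG: "j \<notin> G'" "finite G'" "G = insert j G'" "card G = Suc (card G')"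
        using fin True by (auto simp: G'_def intro: card.remove simp del: card_Diff_insert card_Diff_singleton)
      have lt: "j < l" if "l \<in> G'" for l using G' that j by (auto simp: faces_def)
      have shift: "shiftj j (Suc (v j) - u j) (a(j := u j)) = a(j := Suc (v j))"
        using uv by (simp add: shiftj_upd le_fun_def le_SucI)
      have "face_coeff (j # js) (dif (X (j # js)) m a h) G = (- 1) ^ card G *
          (face_coeff js (dif (X js) (m + 1) (a(j := Suc (v j))) (pr2 h)) G'
           - sg m * face_coeff js (mulpow (X js) j m (a(j := u j)) (Suc (v j) - u j) (pr1 h)) G')"
        using True v by (simp add: dif_Slab_apply face_coeff_simps G'_def[symmetric] del: mulpow.simps)
      also have "\<dots> = (- 1) ^ card G *
          ((\<Sum>l\<in>G'. (- 1) ^ card {g \<in> G'. g < l} * face_coeff js (pr2 h) (G' - {l}))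
           - sg m * face_coeff js (pr1 h) G')"
        using IH[OF aj h(2)[OF v], of G'] face_coeff_mulpow[OF js aj h(1) j(2,1)] G'
        by (simp add: shift del: mulpow.simps)
      also have "\<dots> = (\<Sum>l\<in>G'. (- 1) ^ card G * ((- 1) ^ card {g \<in> G'. g < l} * face_coeff js (pr2 h) (G' - {l})))
          - (- 1) ^ card G * (sg m * face_coeff js (pr1 h) G')"
        by (simp add: algebra_simps sum_distrib_left)
      \<comment> \<open>A nonzero coefficient at \<open>G'\<close> forces
        \<open>int (card G') = - m\<close>, so \<open>sg m\<close> equals
        \<open>(- 1) ^ card G'\<close>.\<close>
      also have "(- 1) ^ card G * (sg m * face_coeff js (pr1 h) G') = - face_coeff js (pr1 h) G'"
      proof (cases "face_coeff js (pr1 h) G' = 0")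
        case False
        then have "int (card G') = - m" using face_coeff_support[OF js aj h(1)] by blast
        then have "even m \<longleftrightarrow> even (card G')" by (metis even_minus even_of_nat)
        then show ?thesis using jG by simp
      qed simp
      also have "(\<Sum>l\<in>G'. (- 1) ^ card G * ((- 1) ^ card {g \<in> G'. g < l} * face_coeff js (pr2 h) (G' - {l})))
          = (\<Sum>l\<in>G'. (- 1) ^ card {g \<in> G. g < l} * face_coeff (j # js) h (G - {l}))"
      proof (rule sum.cong[OF refl])
        fix l assume l: "l \<in> G'"
        have "{g \<in> G. g < l} = insert j {g \<in> G'. g < l}" using lt[OF l] jG by auto
        then have 1: "card {g \<in> G. g < l} = Suc (card {g \<in> G'. g < l})" using jG by simp
        have 2: "card (G - {l}) = card G'" "G - {l} - {j} = G' - {l}" "j \<in> G - {l}"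
          using l lt[OF l] jG by auto
        show "(- 1) ^ card G * ((- 1) ^ card {g \<in> G'. g < l} * face_coeff js (pr2 h) (G' - {l}))
          = (- 1) ^ card {g \<in> G. g < l} * face_coeff (j # js) h (G - {l})"
          using 2 by (simp add: 1 jG(4))
      qed
      also have "\<dots> - (- face_coeff js (pr1 h) G') =
          (\<Sum>l\<in>G. (- 1) ^ card {g \<in> G. g < l} * face_coeff (j # js) h (G - {l}))"
      proof -
        have "{g \<in> G. g < j} = {}" using lt jG by force
        then have c: "card {g \<in> G. g < j} = 0" by (simp only: card.empty)
        have "G - {j} = G'" by (simp add: G'_def)
        moreover have "(\<Sum>l\<in>G. (- 1) ^ card {g \<in> G. g < l} * face_coeff (j # js) h (G - {l})) =
            (- 1) ^ card {g \<in> G. g < j} * face_coeff (j # js) h (G - {j}) +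
            (\<Sum>l\<in>G'. (- 1) ^ card {g \<in> G. g < l} * face_coeff (j # js) h (G - {l}))"
          unfolding G'_def by (rule sum.remove[OF fin True])
        ultimately show ?thesis using jG(1) by (simp add: c)
      qed
      finally show ?thesis using G by simp
    next
      case G: False
      then have "v j < t j \<Longrightarrow> G' \<notin> faces js (a(j := Suc (v j)))"
        using True j by (simp add: faces_Cons G'_def)
      moreover have shift: "shiftj j (Suc (v j) - u j) (a(j := u j)) = a(j := Suc (v j))"
        using uv by (simp add: shiftj_upd le_fun_def le_SucI)
      ultimately have "face_coeff (j # js) (dif (X (j # js)) m a h) G = 0"
        using True IH[OF aj h(2), of G'] face_coeff_mulpow[OF js aj h(1) j(2,1)]
        by (simp add: dif_Slab_apply face_coeff_simps G'_def[symmetric] del: mulpow.simps)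
      then show ?thesis using G by simp
    qed
  qed
qed

text \<open>Homological degree \<open>m\<close> corresponds to faces of dimension
  \<open>- m - 1\<close>. The cardinality test in \<open>cobd\<close> loses nothing, because by
  \<open>face_coeff_support\<close> the left side vanishes at all other cardinalities.\<close>

lemma face_coeff_cobd:
  assumes js: "sorted_wrt (<) js" "set js \<subseteq> {..<n}" and a: "a \<in> Dn n" and h: "h \<in> sp (X js) m a"
  shows "face_coeff js (dif (X js) m a h) = cobd (faces js a) (- m - 1) (face_coeff js h)"
proof
  fix G
  interpret X: tdet n t "X js" using tdet_X js by blast
  have d: "distinct js" using js(1) by (auto simp: strict_sorted_iff)
  have "dif (X js) m a h \<in> sp (X js) (m - 1) a" using cplxD(3)[OF X.cplx[OF a]] h by auto
  then have "face_coeff js (dif (X js) m a h) G = 0" if "int (card G) \<noteq> - m - 1 + 2"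
    using face_coeff_support[OF d js(2) a] that by fastforce
  then show "face_coeff js (dif (X js) m a h) G = cobd (faces js a) (- m - 1) (face_coeff js h) G"
    using face_coeff_dif[OF js a h, of G]
    by (cases "int (card G) = - m - 1 + 2") (simp_all add: cobd_def)
qed

lemma cochains_eq_face_coeff:
  assumes "distinct js" "set js \<subseteq> {..<n}" "a \<in> Dn n"
  shows "cochains (faces js a) (- m - 1) = face_coeff js ` sp (X js) m a"
  using face_coeff_support[OF assms] face_coeff_surj[OF assms, of _ m]
  by (auto simp: cochains_def image_iff) metis+

end

text \<open>Stated for any \<open>unit_module\<close> because it serves twice: for
  \<open>S/I\<close> it gives the conclusion, for the interval module it decodes the hypothesis.
  \<open>Nk\<close> is compared with slabs by a quasi-isomorphism of degree \<open>\<gamma>\<close>,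
  and slabs are identified with cochains by \<open>face_coeff\<close>.\<close>

theorem Nk_quot_iso:
  fixes C :: "'k::field gcx"
  assumes C: "unit_module n t A C" and r: "r \<in> Dn n" "r \<le> t"
    and s: "\<And>j. (bstep (t j) ^^ k j) (r j, t j, 0) = (u j, v j, g j)" and u: "u \<in> Dn n"
  defines "D \<equiv> {F. F \<subseteq> {..<n} \<and> (\<forall>i\<in>F. v i < t i) \<and> xF u v F \<in> A}"
    and "\<gamma> \<equiv> \<Sum>j<n. int (g j)"
  shows "quot_iso (cycles (Nk t k n C) (- i) r) (bnds (Nk t k n C) (- i) r)
    (rcycles D (i - \<gamma> - 1)) (rbnds D (i - \<gamma> - 1))"
proof -
  define js where "js = [0..<n]"
  have js: "sorted_wrt (<) js" "distinct js" "set js = {..<n}" "set js \<subseteq> {..<n}"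
    by (auto simp: js_def atLeast0LessThan)
  have uv: "u j \<le> v j \<and> v j \<le> t j" for j
    using bstep_invariant[OF s, of j] r by (simp add: le_fun_def)
  interpret C: unit_module n t A C by fact
  interpret slab_cochains n t A C u v
    by unfold_locales (use uv in \<open>auto simp: le_fun_def\<close>)
  let ?N = "Nk t k n C" and ?X = "X js"
  interpret X: tdet n t ?X using tdet_X js by blast
  have D: "D = faces js r"
    unfolding D_def faces_def js(3)
  proof (intro Collect_cong conj_cong refl)
    fix F assume "F \<subseteq> {..<n}"
    then have "face_deg u v js r F = xF u v F"
      using r u by (auto simp: face_deg_def xF_def js(3) fun_eq_iff Dn_def)
    then show "(xF u v F \<in> A) = (face_deg u v js r F \<in> A)" by simp
  qed
  have \<gamma>: "(\<Sum>j\<leftarrow>js. int (g j)) = \<gamma>"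
    by (simp add: \<gamma>_def js_def interv_sum_list_conv_sum_set_nat atLeast0LessThan)
  obtain f where "gqis {a \<in> Dn n. \<forall>j\<in>set js. a j = r j} ({..<n} - set js)
      (Ncomp t k js C) ?X (\<Sum>j\<leftarrow>js. int (g j)) f"
    using Ncomp_slabs_gqis[OF C.tdet_axioms r(2) s js(4,2)] by blast
  then have q: "qis (at_sp ?N r) (at_dif ?N r) (at_sp ?X r) (at_dif ?X r) \<gamma> (\<lambda>m. f m r)"
    using r unfolding gqis_def \<gamma> by (auto simp: Nk_def js_def)
  note fm = cmapD[OF qisD(1)[OF q]]
  note coch = cochains_eq_face_coeff[OF js(2,4) r(1)] and dF = face_coeff_cobd[OF js(1,4) r(1)]
    and inj = face_coeff_inj[OF js(2,4) r(1)]
  have Xs: "sc.subspace (sp ?X m r)" "z \<in> sp ?X m r \<Longrightarrow> dif ?X m r z \<in> sp ?X (m - 1) r" for m z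
    using cplxD[OF X.cplx[OF r(1)]] by auto
  define m where "m = - i"
  \<comment> \<open>Homological degree \<open>- i\<close> becomes \<open>- i + \<gamma>\<close> in
    the slabs, where the faces have \<open>i - \<gamma>\<close> elements.\<close>
  have q1: "i - \<gamma> - 1 = - (m + \<gamma>) - 1" "i - \<gamma> - 1 - 1 = - (m + 1 + \<gamma>) - 1" by (auto simp: m_def)
  have dF1: "z \<in> sp ?X (m + 1 + \<gamma>) r \<Longrightarrow> dif ?X (m + 1 + \<gamma>) r z \<in> sp ?X (m + \<gamma>) r" for z
    using Xs(2)[of z "m + 1 + \<gamma>"] by (simp add: algebra_simps)
  let ?\<Phi> = "\<lambda>x. face_coeff js (f m r x)"
  have 1: "?\<Phi> x \<in> rcycles D (i - \<gamma> - 1)" if "x \<in> cycles ?N (- i) r" for x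
  proof -
    have x: "x \<in> sp ?N m r" "dif ?N m r x = 0"
      using that by (auto simp: cycles_def vec_simps m_def)
    have "dif ?X (m + \<gamma>) r (f m r x) = 0" using fm(3)[OF x(1)] x(2) by (simp add: lin_zero[OF fm(1)])
    then have "cobd D (- (m + \<gamma>) - 1) (?\<Phi> x) = 0"
      using dF[OF fm(2)[OF x(1)]] by (simp add: D lin_zero[OF lin_face_coeff])
    then show ?thesis
      using fm(2)[OF x(1)] unfolding rcycles_def q1 D coch by (simp add: vec_simps)
  qed
  have 2: "?\<Phi> x \<in> rbnds D (i - \<gamma> - 1) \<longleftrightarrow> x \<in> bnds ?N (- i) r" if "x \<in> cycles ?N (- i) r" for x
  proof
    have x: "x \<in> sp ?N m r" "dif ?N m r x = 0"
      using that by (auto simp: cycles_def vec_simps m_def)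
    assume "?\<Phi> x \<in> rbnds D (i - \<gamma> - 1)"
    then obtain b where b: "b \<in> sp ?X (m + 1 + \<gamma>) r" "?\<Phi> x = cobd D (- (m + 1 + \<gamma>) - 1) (face_coeff js b)"
      unfolding rbnds_def q1(2) D coch by auto
    then have "face_coeff js (f m r x - dif ?X (m + 1 + \<gamma>) r b) = 0"
      using dF[OF b(1)] b(2) by (simp add: D lin_diff[OF lin_face_coeff])
    then have "f m r x = dif ?X (m + 1 + \<gamma>) r b"
      using inj[of "f m r x - dif ?X (m + 1 + \<gamma>) r b" "m + \<gamma>"] fm(2)[OF x(1)] dF1[OF b(1)] Xs(1)
      by (auto dest: sc.subspace_diff)
    then show "x \<in> bnds ?N (- i) r"
      using qisD(2)[OF q x b(1)] by (auto simp: bnds_def m_def)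
  next
    assume "x \<in> bnds ?N (- i) r"
    then obtain c where c: "c \<in> sp ?N (m + 1) r" "x = dif ?N (m + 1) r c" by (auto simp: bnds_def m_def)
    have fc: "f (m + 1) r c \<in> sp ?X (m + 1 + \<gamma>) r" using fm(2)[OF c(1)] .
    have "?\<Phi> x = cobd D (- (m + 1 + \<gamma>) - 1) (face_coeff js (f (m + 1) r c))"
      using fm(4)[OF c(1)] dF[OF fc] c(2) by (simp add: D)
    then show "?\<Phi> x \<in> rbnds D (i - \<gamma> - 1)"
      unfolding rbnds_def q1(2) D coch using fc by blast
  qed
  have 3: "\<exists>x\<in>cycles ?N (- i) r. vsub y (?\<Phi> x) \<in> rbnds D (i - \<gamma> - 1)"
    if y: "y \<in> rcycles D (i - \<gamma> - 1)" for y
  proof -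
    obtain w where w: "w \<in> sp ?X (m + \<gamma>) r" "y = face_coeff js w" "cobd D (- (m + \<gamma>) - 1) y = 0"
      using y unfolding rcycles_def q1(1) D coch by (auto simp: vec_simps)
    have "dif ?X (m + \<gamma>) r w = 0"
      using inj[OF Xs(2)[OF w(1)]] dF[OF w(1)] w by (simp add: D)
    then obtain z b where z: "z \<in> sp ?N m r" "dif ?N m r z = 0" "b \<in> sp ?X (m + 1 + \<gamma>) r"
      "w = f m r z + dif ?X (m + 1 + \<gamma>) r b"
      using qisD(3)[OF q w(1)] by blast
    have "y - ?\<Phi> z = cobd D (- (m + 1 + \<gamma>) - 1) (face_coeff js b)"
      using dF[OF z(3)] w(2) z(4) by (simp add: D lin_add[OF lin_face_coeff])
    then have "y - ?\<Phi> z \<in> rbnds D (i - \<gamma> - 1)"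
      unfolding rbnds_def q1(2) D coch using z(3) by blast
    then show ?thesis using z by (auto simp: cycles_def vec_simps m_def)
  qed
  show ?thesis
    unfolding quot_iso_def
  proof (intro exI[of _ ?\<Phi>] conjI ballI)
    show "lin_on (cycles ?N (- i) r) ?\<Phi>"
      by (rule lin_imp_lin_on[OF lin_comp[OF lin_face_coeff fm(1)]])
  qed (use 1 2 3 in auto)
qed

section \<open>Cohomology of intervals of faces\<close>

lemma cobd_add: "cobd D q (\<phi> + \<psi>) = cobd D q \<phi> + cobd D q \<psi>"
  by (auto simp: cobd_def fun_eq_iff algebra_simps sum.distrib)

lemma rbnds_add:
  assumes "\<phi> \<in> rbnds D q" "\<psi> \<in> rbnds D q"
  shows "\<phi> + \<psi> \<in> rbnds D q"
proof -
  obtain a b where ab: "a \<in> cochains D (q - 1)" "b \<in> cochains D (q - 1)"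
    "\<phi> = cobd D (q - 1) a" "\<psi> = cobd D (q - 1) b"
    using assms unfolding rbnds_def by blast
  have "F \<in> D \<and> int (card F) = q - 1 + 1" if "(a + b) F \<noteq> 0" for F
  proof -
    have "a F \<noteq> 0 \<or> b F \<noteq> 0" using that by auto
    then show ?thesis using ab(1,2) by (auto simp: cochains_def)
  qed
  then have "a + b \<in> cochains D (q - 1)" unfolding cochains_def by blast
  then show ?thesis unfolding rbnds_def ab(3,4) by (metis cobd_add imageI)
qed

text \<open>The interval module enters only through the places where its cohomology vanishes, and
  vanishing passes through \<open>quot_iso\<close> because boundaries are closed under
  addition.\<close>

lemma quot_iso_trivial_iff:
  assumes "quot_iso Z B (rcycles D q :: (nat set \<Rightarrow> 'k::field) set) (rbnds D q)"
  shows "Z \<subseteq> B \<longleftrightarrow> (rcycles D q :: (nat set \<Rightarrow> 'k) set) \<subseteq> rbnds D q"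
proof -
  obtain f :: "_ \<Rightarrow> nat set \<Rightarrow> 'k" where f: "\<And>x. x \<in> Z \<Longrightarrow> f x \<in> rcycles D q" "\<And>x. x \<in> Z \<Longrightarrow> f x \<in> rbnds D q \<longleftrightarrow> x \<in> B"
    "\<And>y. y \<in> rcycles D q \<Longrightarrow> \<exists>x\<in>Z. y - f x \<in> rbnds D q"
    using assms unfolding quot_iso_def vsub_eq_minus by blast
  show ?thesis
  proof
    assume Z: "Z \<subseteq> B"
    show "(rcycles D q :: (nat set \<Rightarrow> 'k) set) \<subseteq> rbnds D q"
    proof
      fix y :: "nat set \<Rightarrow> 'k" assume "y \<in> rcycles D q"
      then obtain x where "x \<in> Z" "y - f x \<in> rbnds D q" using f(3) by blast
      then show "y \<in> rbnds D q" using rbnds_add[of "y - f x" D q "f x"] f(2) Z by auto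
    qed
  qed (use f in blast)
qed

text \<open>An interval in the Boolean lattice: \<open>Q i\<close> permits the vertex
  \<open>i\<close>, and \<open>P i\<close> permits its absence.\<close>

definition face_interval :: "nat \<Rightarrow> (nat \<Rightarrow> bool) \<Rightarrow> (nat \<Rightarrow> bool) \<Rightarrow> nat set set" where
  "face_interval n P Q = {F. F \<subseteq> {..<n} \<and> (\<forall>i\<in>F. Q i) \<and> (\<forall>i<n. i \<notin> F \<longrightarrow> P i)}"

text \<open>The vertex \<open>l\<close> may be added to or removed from any face, so contraction
  with \<open>l\<close> is a homotopy between the identity and zero; \<open>\<psi>\<close> is the
  contraction of \<open>\<phi>\<close>.\<close>

lemma face_interval_cone_acyclic:
  assumes l: "l < n" "P l" "Q l" and D: "D = face_interval n P Q"
  shows "(rcycles D q :: (nat set \<Rightarrow> 'k::field) set) \<subseteq> rbnds D q"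
proof
  fix \<phi> :: "nat set \<Rightarrow> 'k" assume "\<phi> \<in> rcycles D q"
  then have \<phi>: "\<And>F. \<phi> F \<noteq> 0 \<Longrightarrow> F \<in> D \<and> int (card F) = q + 1" "\<And>G. cobd D q \<phi> G = 0"
    by (auto simp: rcycles_def cochains_def vec_simps)
  define s :: "nat set \<Rightarrow> nat \<Rightarrow> 'k" where "s G x = (- 1) ^ card {g \<in> G. g < x}" for G x
  have s2: "s G x * s G x = 1" for G x by (simp add: s_def flip: power_mult_distrib)
  have fin: "F \<in> D \<Longrightarrow> finite F" for F by (auto simp: D face_interval_def intro: finite_subset)
  define \<psi> where "\<psi> F = (if l \<in> F then 0 else s F l * \<phi> (insert l F))" for F
  have "\<psi> \<in> cochains D (q - 1)"
    unfolding cochains_def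
  proof (intro CollectI allI impI)
    fix F assume "\<psi> F \<noteq> 0"
    then have F: "l \<notin> F" "insert l F \<in> D" "int (card (insert l F)) = q + 1"
      using \<phi>(1) by (auto simp: \<psi>_def split: if_splits)
    then show "F \<in> D \<and> int (card F) = q - 1 + 1"
      using fin[OF F(2)] l by (auto simp: D face_interval_def)
  qed
  moreover have "cobd D (q - 1) \<psi> G = \<phi> G" for G
  proof (cases "G \<in> D \<and> int (card G) = q + 1")
    case False
    then show ?thesis using \<phi>(1)[of G] by (auto simp: cobd_def)
  next
    case True
    then have G: "G \<in> D" "int (card G) = q + 1" "finite G" using fin by auto
    have cob: "cobd D (q - 1) \<psi> G = (\<Sum>x\<in>G. s G x * \<psi> (G - {x}))"
      using G by (simp add: cobd_def s_def)
    show ?thesis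
    proof (cases "l \<in> G")
      case lG: True
      have "(\<Sum>x\<in>G. s G x * \<psi> (G - {x})) = s G l * \<psi> (G - {l}) + (\<Sum>x\<in>G - {l}. s G x * \<psi> (G - {x}))"
        by (rule sum.remove[OF G(3) lG])
      also have "(\<Sum>x\<in>G - {l}. s G x * \<psi> (G - {x})) = 0"
        by (rule sum.neutral) (use lG in \<open>auto simp: \<psi>_def\<close>)
      also have "\<psi> (G - {l}) = s G l * \<phi> G"
      proof -
        have "{g \<in> G - {l}. g < l} = {g \<in> G. g < l}" by auto
        then have "s (G - {l}) l = s G l" by (simp only: s_def)
        then show ?thesis using lG by (simp add: \<psi>_def insert_absorb)
      qed
      finally show ?thesis using cob s2[of G l] by (simp flip: mult.assoc)
    next
      case lG: False
      \<comment> \<open>For a face without \<open>l\<close>, the cocycle condition at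
        \<open>insert l G\<close> expresses \<open>\<phi> G\<close> by the values at faces
        containing \<open>l\<close>.\<close>
      define H where "H = insert l G"
      have H: "H \<in> D" "int (card H) = q + 2" "finite H" "l \<in> H" "H - {l} = G"
        using G l lG by (auto simp: H_def D face_interval_def)
      have "0 = (\<Sum>x\<in>H. s H x * \<phi> (H - {x}))"
        using \<phi>(2)[of H] H by (simp add: cobd_def s_def)
      also have "\<dots> = s H l * \<phi> G + (\<Sum>x\<in>G. s H x * \<phi> (H - {x}))"
        using sum.remove[OF H(3,4), of "\<lambda>x. s H x * \<phi> (H - {x})"] H(5) by simp
      also have "s H l = s G l"
      proof -
        have "{g \<in> H. g < l} = {g \<in> G. g < l}" by (auto simp: H_def)
        then show ?thesis by (simp only: s_def)
      qed
      finally have z: "(\<Sum>x\<in>G. s H x * \<phi> (H - {x})) = - (s G l * \<phi> G)"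
        by (simp add: eq_neg_iff_add_eq_0 add.commute)
      have "s G x * \<psi> (G - {x}) = - s G l * (s H x * \<phi> (H - {x}))" if x: "x \<in> G" for x
      proof -
        have xl: "x \<noteq> l" using x lG by auto
        then have e: "insert l (G - {x}) = H - {x}" by (auto simp: H_def)
        \<comment> \<open>Deleting \<open>x\<close> and adding \<open>l\<close> anticommute: exactly
          one of the two signs changes, according to which vertex is smaller.\<close>
        have "s G x * s (G - {x}) l = - s G l * s H x"
        proof (cases "x < l")
          case True
          have "{g \<in> G. g < l} = insert x {g \<in> G - {x}. g < l}" using True x by auto
          moreover have "finite {g \<in> G - {x}. g < l}" "x \<notin> {g \<in> G - {x}. g < l}" using G(3) by auto
          ultimately have "card {g \<in> G. g < l} = Suc (card {g \<in> G - {x}. g < l})"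
            by (metis card_insert_disjoint)
          moreover have "{g \<in> H. g < x} = {g \<in> G. g < x}" using True by (auto simp: H_def)
          ultimately show ?thesis by (simp add: s_def)
        next
          case False
          have "{g \<in> H. g < x} = insert l {g \<in> G. g < x}" using False xl by (auto simp: H_def)
          then have "card {g \<in> H. g < x} = Suc (card {g \<in> G. g < x})"
            using G(3) lG by simp
          moreover have "{g \<in> G - {x}. g < l} = {g \<in> G. g < l}" using False by auto
          ultimately show ?thesis by (simp only: s_def) simp
        qed
        then show ?thesis using lG e by (simp add: \<psi>_def flip: mult.assoc)
      qed
      then have "(\<Sum>x\<in>G. s G x * \<psi> (G - {x})) = - s G l * (\<Sum>x\<in>G. s H x * \<phi> (H - {x}))"
        by (simp add: sum_distrib_left)
      also have "\<dots> = \<phi> G" unfolding z using s2[of G l] by (simp flip: mult.assoc)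
      finally show ?thesis using cob by simp
    qed
  qed
  ultimately show "\<phi> \<in> rbnds D q" unfolding rbnds_def by (auto simp: image_iff fun_eq_iff intro!: bexI[of _ \<psi>])
qed

text \<open>If \<open>P l = Q l\<close> for some vertex, the complex is contractible along it or has
  no faces. Otherwise every vertex is decided, and the single remaining face carries a line in its
  own degree.\<close>

lemma face_interval_acyclic_iff:
  "(rcycles (face_interval n P Q) q :: (nat set \<Rightarrow> 'k::field) set) \<subseteq> rbnds (face_interval n P Q) q \<longleftrightarrow>
    \<not> ((\<forall>l<n. P l \<noteq> Q l) \<and> q + 1 = (\<Sum>l<n. if Q l then 1 else 0))" (is "?Z \<subseteq> ?B \<longleftrightarrow> _")
proof (cases "\<forall>l<n. P l \<noteq> Q l")
  case False
  then obtain l where l: "l < n" "P l = Q l" by auto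
  have "?Z \<subseteq> ?B"
  proof (cases "P l")
    case True
    then show ?thesis using face_interval_cone_acyclic[of l n P Q _ q] l by auto
  next
    case False
    then have E: "face_interval n P Q = {}" using l by (auto simp: face_interval_def)
    have "\<phi> \<in> ?B" if "\<phi> \<in> ?Z" for \<phi>
    proof -
      have "\<phi> = 0" using that unfolding E rcycles_def cochains_def by auto
      then have "\<phi> = cobd {} (q - 1) 0" by (auto simp: cobd_def fun_eq_iff)
      moreover have "0 \<in> cochains {} (q - 1)" by (auto simp: cochains_def)
      ultimately show ?thesis unfolding rbnds_def E by blast
    qed
    then show ?thesis by blast
  qed
  then show ?thesis using False by blast
next
  case True
  define F where "F = {l. l < n \<and> Q l}"
  have D: "face_interval n P Q = {F}"
    using True by (auto simp: face_interval_def F_def)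
  have "(\<Sum>l<n. if Q l then 1 else 0) = int (card F)"
    by (simp add: sum.If_cases F_def Int_def lessThan_def)
  moreover have "?Z \<subseteq> ?B \<longleftrightarrow> q + 1 \<noteq> int (card F)"
  proof
    assume sub: "?Z \<subseteq> ?B"
    show "q + 1 \<noteq> int (card F)"
    proof
      assume q: "q + 1 = int (card F)"
      define \<phi> :: "nat set \<Rightarrow> 'k" where "\<phi> G = (if G = F then 1 else 0)" for G
      have "\<phi> \<in> ?Z"
        using q unfolding D by (auto simp: rcycles_def cochains_def \<phi>_def cobd_def vec_simps fun_eq_iff)
      then obtain \<psi> where \<psi>: "\<psi> \<in> cochains {F} (q - 1)" "\<phi> = cobd {F} (q - 1) \<psi>"
        using sub unfolding D rbnds_def by blast
      have "\<psi> G = 0" for G using \<psi>(1) q by (auto simp: cochains_def)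
      then have "\<phi> F = 0" unfolding \<psi>(2) cobd_def by simp
      then show False by (simp add: \<phi>_def)
    qed
  next
    assume q: "q + 1 \<noteq> int (card F)"
    show "?Z \<subseteq> ?B"
    proof
      fix \<phi> assume "\<phi> \<in> ?Z"
      then have "\<phi> G = 0" for G using q unfolding D rcycles_def cochains_def by fastforce
      then have "\<phi> = cobd {F} (q - 1) 0" by (auto simp: cobd_def fun_eq_iff)
      moreover have "0 \<in> cochains {F} (q - 1)" by (auto simp: cochains_def)
      ultimately show "\<phi> \<in> ?B" unfolding D rbnds_def by blast
    qed
  qed
  ultimately show ?thesis using True by simp
qed

section \<open>Evaluating slabs on interval modules in one variable\<close>

text \<open>The slab \<open>(u, v)\<close> in cohomological degree \<open>g\<close> evaluated on the interval module \<open>[c, d]\<close> in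
  degree \<open>h\<close> is acyclic or a line; \<open>slab_degree\<close> is its degree in the latter case.\<close>

fun slab_degree :: "nat \<Rightarrow> nat \<times> nat \<times> nat \<Rightarrow> nat \<times> nat \<times> nat \<Rightarrow> nat option" where
  "slab_degree t (u, v, g) (c, d, h) =
    (if (c \<le> u \<and> u \<le> d) = (v < t \<and> c \<le> Suc v \<and> Suc v \<le> d) then None
     else Some (g + h + (if v < t \<and> c \<le> Suc v \<and> Suc v \<le> d then 1 else 0)))"

text \<open>The effect of the Nakayama functor on the interval module \<open>[c, d]\<close> in one
  variable. For \<open>d < t\<close> its second term \<open>C_t\<close> is 0, which leaves the shift
  by one. For \<open>d = t\<close> that term is \<open>K\<close> in every degree and cancels the
  shifted first term above \<open>c\<close>, leaving \<open>[0, c]\<close> one cohomological degree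
  higher.\<close>

fun nak_interval :: "nat \<Rightarrow> nat \<times> nat \<times> nat \<Rightarrow> nat \<times> nat \<times> nat" where
  "nak_interval t (c, d, h) = (if d < t then (Suc c, Suc d, h) else (0, c, Suc h))"

lemma slab_degree_adjoint:
  assumes "u \<le> v" "v \<le> t" "c \<le> d" "d \<le> t"
  shows "slab_degree t (bstep t (u, v, g)) (c, d, h) = slab_degree t (u, v, g) (nak_interval t (c, d, h))"
  using assms by auto

lemma slab_degree_adjoint_funpow:
  assumes "u \<le> v" "v \<le> t" "c \<le> d" "d \<le> t"
  shows "slab_degree t ((bstep t ^^ k) (u, v, g)) (c, d, h) = slab_degree t (u, v, g) ((nak_interval t ^^ k) (c, d, h))"
  using assms
proof (induction k arbitrary: c d h)
  case (Suc k)
  obtain u' v' g' where s: "(bstep t ^^ k) (u, v, g) = (u', v', g')" by (metis prod_cases3)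
  obtain c' d' h' where i: "nak_interval t (c, d, h) = (c', d', h')" by (metis prod_cases3)
  have "c' \<le> d' \<and> d' \<le> t" using i Suc.prems by (auto split: if_splits)
  then have "slab_degree t ((bstep t ^^ k) (u, v, g)) (c', d', h')
      = slab_degree t (u, v, g) ((nak_interval t ^^ k) (c', d', h'))"
    using Suc by blast
  moreover have "slab_degree t (bstep t (u', v', g')) (c, d, h) = slab_degree t (u', v', g') (c', d', h')"
    using slab_degree_adjoint[of u' v' t c d] bstep_invariant[OF s] Suc.prems i by simp
  ultimately show ?case
    using s i by (simp add: funpow_swap1 del: slab_degree.simps bstep.simps nak_interval.simps)
qed simp

text \<open>Under the reflection of \<open>[u, v]\<close> to \<open>[t - v, t - u]\<close> the two
  rules coincide: \<open>u > 0\<close> becomes \<open>d < t\<close>, a step down becomes a step up,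
  and both gain a degree in the other case.\<close>

lemma nak_interval_bstep:
  assumes "u \<le> v" "v \<le> t" "(bstep t ^^ k) (u, v, g) = (u', v', g')"
  shows "(nak_interval t ^^ k) (t - v, t - u, e + g) = (t - v', t - u', e + g')"
  using assms(3)
proof (induction k arbitrary: u' v' g')
  case (Suc k)
  obtain u1 v1 g1 where s: "(bstep t ^^ k) (u, v, g) = (u1, v1, g1)" by (metis prod_cases3)
  have "u1 \<le> v1" "v1 \<le> t" using bstep_invariant[OF s] assms by auto
  then show ?case using Suc.IH[OF s] Suc.prems s by (auto split: if_splits)
qed auto

text \<open>The first of the \<open>Suc k\<close> steps takes \<open>[t - r, t]\<close> to
  \<open>[0, t - r]\<close> in degree 1, the reflection of the starting slab \<open>(r, t)\<close>.
  The other \<open>k\<close> reach \<open>[t - v, t - u]\<close> in degree \<open>Suc g\<close>. By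
  adjointness the slab \<open>(a, t)\<close>, which is evaluation at \<open>a\<close>, then tests
  membership of \<open>a\<close> in this interval.\<close>

lemma slab_degree_box:
  assumes r: "r \<le> t" and a: "a \<le> t" and s: "(bstep t ^^ k) (r, t, 0) = (u, v, g)"
  shows "slab_degree t ((bstep t ^^ Suc k) (a, t, 0)) (t - r, t, 0) =
    (if t - v \<le> a \<and> a \<le> t - u then Some (Suc g) else None)"
proof -
  have "(nak_interval t ^^ Suc k) (t - r, t, 0) = (nak_interval t ^^ k) (t - t, t - r, 1 + 0)"
    by (simp add: funpow_Suc_right del: funpow.simps)
  also have "\<dots> = (t - v, t - u, 1 + g)"
    by (rule nak_interval_bstep[OF r order_refl s])
  finally have "slab_degree t ((bstep t ^^ Suc k) (a, t, 0)) (t - r, t, 0) =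
      slab_degree t (a, t, 0) (t - v, t - u, 1 + g)"
    using slab_degree_adjoint_funpow[of a t t "t - r" t "Suc k" 0 0] a
    by (simp del: funpow.simps slab_degree.simps)
  then show ?thesis by (simp del: funpow.simps)
qed

section \<open>The modules \<open>S/I\<close> and \<open>K\<^sub>t{c, t}\<close>\<close>

text \<open>Descent on the total degree; the sum over \<open>i < n\<close> detects every strict
  inequality because all vectors lie in \<open>Dn n\<close>.\<close>

lemma exists_mingen_below:
  assumes I: "monideal n I" and a: "a \<in> I"
  shows "\<exists>b\<in>mingens I. b \<le> a"
proof -
  let ?w = "\<lambda>b. \<Sum>i<n. b i"
  obtain b where b: "b \<in> I" "b \<le> a" "\<And>c. c \<in> I \<Longrightarrow> c \<le> a \<Longrightarrow> ?w b \<le> ?w c"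
    using ex_has_least_nat[of "\<lambda>b. b \<in> I \<and> b \<le> a" a ?w] a by auto
  have "c = b" if c: "c \<in> I" "c \<le> b" for c
  proof (rule ccontr)
    assume "c \<noteq> b"
    then obtain i where i: "c i \<noteq> b i" by auto
    have "b \<in> Dn n" "c \<in> Dn n" using I b(1) c(1) by (auto simp: monideal_def)
    then have "i < n" using i by (metis (mono_tags, lifting) Dn_def mem_Collect_eq not_le_imp_less)
    moreover have "c i < b i" using c(2) i by (simp add: le_fun_def nat_less_le)
    ultimately have "?w c < ?w b"
      using c(2) by (intro sum_strict_mono_ex1) (auto dest: le_funD)
    then show False using b(3)[OF c(1)] c(2) b(2) by force
  qed
  then show ?thesis using b by (auto simp: mingens_def)
qed

lemma unit_module_quotI:
  assumes I: "monideal n I" and t: "pos_tdet_ideal t I"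
  shows "unit_module n t (Dn n - I) (quotI n I :: 'k::field gcx)"
proof (rule unit_module.intro)
  fix a b c :: deg and i m z
  show "b \<in> Dn n - I" if "a \<in> Dn n - I" "c \<in> Dn n - I" "b \<in> Dn n" "a \<le> b" "b \<le> c"
    using that I by (auto simp: monideal_def)
  show "ptrunc t a \<in> Dn n - I \<longleftrightarrow> a \<in> Dn n - I" if a: "a \<in> Dn n"
  proof -
    \<comment> \<open>A minimal generator below \<open>a\<close> is also at most \<open>t\<close>,
      hence below the truncation of \<open>a\<close>.\<close>
    have "ptrunc t a \<in> I" if "a \<in> I"
    proof -
      obtain b where b: "b \<in> mingens I" "b \<le> a" using exists_mingen_below[OF I \<open>a \<in> I\<close>] by blast
      then have "b \<le> ptrunc t a" using t by (auto simp: pos_tdet_ideal_def ptrunc_def le_fun_def)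
      then show ?thesis using I a b by (auto simp: monideal_def mingens_def)
    qed
    moreover have "a \<in> I" if "ptrunc t a \<in> I"
    proof -
      have "ptrunc t a \<le> a" by (auto simp: ptrunc_def le_fun_def)
      then show ?thesis using I a that by (auto simp: monideal_def)
    qed
    ultimately show ?thesis using a by auto
  qed
  show "lin (mulx (quotI n I :: 'k gcx) i m a)"
    by (cases "shiftj i 1 a \<in> I") (simp_all add: quotI_def vzero_eq_zero lin_id lin_const_zero)
qed (auto simp: quotI_def vec_simps)

text \<open>After truncation the upper bound \<open>t\<close> holds automatically, so the support is
  closed upwards and its convexity is immediate.\<close>

lemma unit_module_Kint:
  assumes c: "c \<le> t"
  shows "unit_module n t {x \<in> Dn n. c \<le> ptrunc t x} (Kint t c t :: 'k::field gcx)"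
proof (rule unit_module.intro)
  let ?A = "{x \<in> Dn n. c \<le> ptrunc t x}"
  fix a b e :: deg and i m and z :: "'k vec"
  have pt: "ptrunc t x \<le> t" for x by (auto simp: ptrunc_def le_fun_def)
  show "b \<in> ?A" if "a \<in> ?A" "e \<in> ?A" "b \<in> Dn n" "a \<le> b" "b \<le> e"
  proof -
    have "ptrunc t a \<le> ptrunc t b"
      using that(4) by (auto simp: ptrunc_def le_fun_def intro: min.coboundedI1)
    then show ?thesis using that by auto
  qed
  show "sp (Kint t c t :: 'k gcx) m a = (if m = 0 \<and> a \<in> ?A then kline else {0})" if "a \<in> Dn n"
    using that c pt by (auto simp: Kint_def vec_simps)
  show "lin (mulx (Kint t c t :: 'k gcx) i m a)"
    by (cases "t i \<le> a i"; cases "c \<le> shiftj i 1 (ptrunc t a) \<and> shiftj i 1 (ptrunc t a) \<le> t")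
      (auto simp: Kint_def vzero_eq_zero lin_id lin_const_zero simp del: One_nat_def cong: if_cong)
  show "mulx (Kint t c t :: 'k gcx) i m a z = (if shiftj i 1 a \<in> ?A then z else 0)"
    if i: "i < n" and a: "a \<in> ?A"
  proof -
    have le: "c \<le> ptrunc t (shiftj i 1 a)"
      using a by (auto simp: ptrunc_def shiftj_def le_fun_def) (metis le_SucI)+
    have "shiftj i 1 (ptrunc t a) = ptrunc t (shiftj i 1 a)" if "\<not> t i \<le> a i"
      using that by (auto simp: shiftj_def ptrunc_def fun_eq_iff)
    then show ?thesis using le pt a i by (simp add: Kint_def del: One_nat_def)
  qed
qed (auto simp: Kint_def vec_simps)

section \<open>Cohomology of the Nakayama functor on interval modules\<close>

text \<open>Beyond the last variable \<open>k j\<close> is 0, so no step is taken and the zero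
  entries of \<open>a\<close> and \<open>t\<close> remain.\<close>

lemma bstep_funpow_Dn:
  assumes "t \<in> Dn n" "a \<in> Dn n" "k \<in> Dn n"
    and s: "\<And>j. (bstep (t j) ^^ k j) (a j, t j, 0) = (u j, v j, g j)"
  shows "u \<in> Dn n" "v \<in> Dn n"
  using assms(1-3) s by (auto simp: Dn_def) (metis funpow_0 prod.inject)+

text \<open>Membership in the support of the interval module is a condition on each coordinate, so
  the faces form a \<open>face_interval\<close>. Its cohomology is nonzero iff every variable
  contributes a line, and \<open>slab_degree_box\<close> says when this happens and that the
  variable \<open>j\<close> contributes \<open>Suc (G j)\<close> to the degree; summing these gives
  the additional \<open>n\<close>.\<close>

lemma Kint_cohomology:
  fixes t k r a U V G :: deg
  assumes t: "t \<in> Dn n" and k: "k \<in> Dn n" and r: "r \<in> Dn n" "r \<le> t" and a: "a \<in> Dn n" "a \<le> t"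
    and s: "\<And>j. (bstep (t j) ^^ k j) (r j, t j, 0) = (U j, V j, G j)"
  defines "N \<equiv> Nk t (\<lambda>j. k j + onesv n j) n (Kint t (\<lambda>j. t j - r j) t :: 'k::field gcx)"
  shows "cycles N (- i) a \<subseteq> bnds N (- i) a \<longleftrightarrow>
    \<not> ((\<forall>j<n. t j - V j \<le> a j \<and> a j \<le> t j - U j) \<and> i = (\<Sum>j<n. int (G j)) + int n)"
proof -
  define c where "c j = t j - r j" for j
  define K where "K j = k j + onesv n j" for j
  define u v g where "u j = fst ((bstep (t j) ^^ K j) (a j, t j, 0))"
    and "v j = fst (snd ((bstep (t j) ^^ K j) (a j, t j, 0)))"
    and "g j = snd (snd ((bstep (t j) ^^ K j) (a j, t j, 0)))" for j
  have s': "(bstep (t j) ^^ K j) (a j, t j, 0) = (u j, v j, g j)" for j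
    by (simp add: u_def v_def g_def)
  have "K \<in> Dn n" using k by (auto simp: Dn_def K_def onesv_def)
  then have u: "u \<in> Dn n" using bstep_funpow_Dn(1)[OF t a(1) _ s'] by blast
  have uv: "u j \<le> v j \<and> v j \<le> t j" for j
    using bstep_invariant[OF s', of j] a(2) by (simp add: le_fun_def)
  have c: "c \<le> t" by (auto simp: c_def le_fun_def)
  \<comment> \<open>\<open>P j\<close> and \<open>Q j\<close> say that the first, respectively
    second, term of the slab in direction \<open>j\<close> is nonzero on the interval
    module.\<close>
  define P Q where "P j \<longleftrightarrow> c j \<le> u j" and "Q j \<longleftrightarrow> v j < t j \<and> c j \<le> Suc (v j)" for j
  have D: "{F. F \<subseteq> {..<n} \<and> (\<forall>i\<in>F. v i < t i) \<and> xF u v F \<in> {x \<in> Dn n. c \<le> ptrunc t x}}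
      = face_interval n P Q"
  proof -
    have "xF u v F \<in> {x \<in> Dn n. c \<le> ptrunc t x} \<longleftrightarrow> (\<forall>i\<in>F. Q i) \<and> (\<forall>i<n. i \<notin> F \<longrightarrow> P i)"
      if F: "F \<subseteq> {..<n}" "\<forall>i\<in>F. v i < t i" for F
    proof -
      have "xF u v F \<in> Dn n" using F u by (force simp: Dn_def xF_def)
      moreover have "c i \<le> ptrunc t (xF u v F) i \<longleftrightarrow> (if i \<in> F then Q i else i < n \<longrightarrow> P i)" for i
      proof (cases "i \<in> F")
        case True
        then show ?thesis using F c by (auto simp: ptrunc_def xF_def Q_def)
      next
        case False
        have "u i \<le> t i" "c i \<le> t i" using uv[of i] c by (auto simp: le_fun_def)
        moreover have "i < n \<or> c i = 0" using t by (cases "i < n") (auto simp: c_def Dn_def)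
        ultimately show ?thesis using False by (auto simp: ptrunc_def xF_def P_def)
      qed
      ultimately show ?thesis by (auto simp: le_fun_def)
    qed
    then show ?thesis unfolding face_interval_def by (auto simp: Q_def)
  qed
  have box: "(P j \<noteq> Q j) = (t j - V j \<le> a j \<and> a j \<le> t j - U j)"
    "P j \<noteq> Q j \<Longrightarrow> g j + (if Q j then 1 else 0) = Suc (G j)" if "j < n" for j
  proof -
    have "K j = Suc (k j)" using that by (simp add: K_def onesv_def)
    moreover have "r j \<le> t j" "a j \<le> t j" using r a by (auto simp: le_fun_def)
    ultimately have "slab_degree (t j) (u j, v j, g j) (c j, t j, 0) =
      (if t j - V j \<le> a j \<and> a j \<le> t j - U j then Some (Suc (G j)) else None)"
      using slab_degree_box[OF _ _ s[of j], of "a j"] s'[of j] by (simp add: c_def)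
    moreover have "slab_degree (t j) (u j, v j, g j) (c j, t j, 0) =
      (if P j = Q j then None else Some (g j + (if Q j then 1 else 0)))"
      using uv[of j] by (auto simp: P_def Q_def)
    ultimately show "(P j \<noteq> Q j) = (t j - V j \<le> a j \<and> a j \<le> t j - U j)"
      "P j \<noteq> Q j \<Longrightarrow> g j + (if Q j then 1 else 0) = Suc (G j)"
      by (auto split: if_splits)
  qed
  define \<gamma> where "\<gamma> = (\<Sum>j<n. int (g j))"
  have H: "quot_iso (cycles N (- i) a) (bnds N (- i) a)
      (rcycles (face_interval n P Q) (i - \<gamma> - 1) :: (nat set \<Rightarrow> 'k) set) (rbnds (face_interval n P Q) (i - \<gamma> - 1))"
    using Nk_quot_iso[OF unit_module_Kint[OF c] a s' u, where i = i, unfolded D]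
    unfolding \<gamma>_def N_def K_def[abs_def] c_def[abs_def] .
  have "cycles N (- i) a \<subseteq> bnds N (- i) a \<longleftrightarrow>
      \<not> ((\<forall>l<n. P l \<noteq> Q l) \<and> i - \<gamma> - 1 + 1 = (\<Sum>l<n. if Q l then 1 else 0))"
    unfolding quot_iso_trivial_iff[OF H] by (rule face_interval_acyclic_iff)
  moreover have "\<gamma> + (\<Sum>l<n. if Q l then 1 else 0) = (\<Sum>j<n. int (G j)) + int n" if "\<forall>l<n. P l \<noteq> Q l"
  proof -
    have "\<gamma> + (\<Sum>l<n. if Q l then 1 else 0) = (\<Sum>l<n. int (g l + (if Q l then 1 else 0)))"
      unfolding \<gamma>_def sum.distrib[symmetric] by (intro sum.cong) auto
    also have "\<dots> = (\<Sum>l<n. int (Suc (G l)))"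
      using box(2) that by (intro sum.cong) auto
    finally show ?thesis by (simp add: sum.distrib)
  qed
  ultimately show ?thesis using box(1) by (auto simp: algebra_simps)
qed

section \<open>Recovering the bounds and the degree from the hypothesis\<close>

lemma Delta_eq:
  assumes "t \<in> Dn n" "u \<in> Dn n" "u \<le> t"
  shows "Delta n t I u v = {F. F \<subseteq> {..<n} \<and> (\<forall>i\<in>F. v i < t i) \<and> xF u v F \<in> Dn n - I}"
proof -
  have "xF u v F \<le> t \<longleftrightarrow> (\<forall>i\<in>F. v i < t i)" for F
    using assms(3) by (auto simp: xF_def le_fun_def Suc_le_eq split: if_splits)
  then show ?thesis by (auto simp: Delta_def quot_nonzero_def)
qed

theorem mainTheorem1:
  fixes n :: nat and t k r u v :: deg and \<gamma> :: int
  assumes "t \<in> Dn n" and "k \<in> Dn n" and "r \<in> Dn n" and "r \<le> t"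
    and "u \<in> Dn n" and "v \<in> Dn n" and "u \<le> v" and "v \<le> t"
    and "\<forall>i. i \<noteq> \<gamma> + int n \<longrightarrow>
           coh_vanish n (Nk t (\<lambda>j. k j + onesv n j) n
                           (Kint t (\<lambda>j. t j - r j) t :: 'k::field gcx)) i"
    and "coh_iso_graded n (Nk t (\<lambda>j. k j + onesv n j) n
                           (Kint t (\<lambda>j. t j - r j) t :: 'k::field gcx)) (\<gamma> + int n)
           (Kint t (\<lambda>j. t j - v j) (\<lambda>j. t j - u j))"
  shows "\<forall>(I :: deg set) (i :: int). monideal n I \<and> pos_tdet_ideal t I \<longrightarrow>
           quot_iso (cycles (Nk t k n (quotI n I :: 'k gcx)) (-i) r)
                    (bnds (Nk t k n (quotI n I :: 'k gcx)) (-i) r)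
                    (rcycles (Delta n t I u v) (i - \<gamma> - 1) :: (nat set \<Rightarrow> 'k) set)
                    (rbnds (Delta n t I u v) (i - \<gamma> - 1))"
proof -
  note t = assms(1) and k = assms(2) and r = assms(3,4)
  define U V G where "U j = fst ((bstep (t j) ^^ k j) (r j, t j, 0))"
    and "V j = fst (snd ((bstep (t j) ^^ k j) (r j, t j, 0)))"
    and "G j = snd (snd ((bstep (t j) ^^ k j) (r j, t j, 0)))" for j
  have s: "(bstep (t j) ^^ k j) (r j, t j, 0) = (U j, V j, G j)" for j
    by (simp add: U_def V_def G_def)
  have UV: "U j \<le> V j \<and> V j \<le> t j" for j
    using bstep_invariant[OF s, of j] r(2) by (simp add: le_fun_def)
  have uv: "u j \<le> v j \<and> v j \<le> t j" for j using assms(7,8) by (simp add: le_fun_def)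
  have UVn: "U \<in> Dn n" "V \<in> Dn n" using bstep_funpow_Dn[OF t r(1) k s] by auto
  define N where "N = Nk t (\<lambda>j. k j + onesv n j) n (Kint t (\<lambda>j. t j - r j) t :: 'k gcx)"
  note coh = Kint_cohomology[OF t k r _ _ s, where 'k = 'k, folded N_def]
  have sub: "(\<lambda>j. t j - w j) \<in> Dn n" "(\<lambda>j. t j - w j) \<le> t" for w
    using t by (auto simp: Dn_def le_fun_def)
  let ?M = "Kint t (\<lambda>j. t j - v j) (\<lambda>j. t j - u j) :: 'k gcx"
  \<comment> \<open>At the lower corner of the computed box the cohomology is nonzero in degree
    \<open>(\<Sum>j<n. int (G j)) + int n\<close>, while the hypothesis admits only
    \<open>\<gamma> + int n\<close>.\<close>
  have "t j - V j \<le> t j - U j" for j using UV by (simp add: diff_le_mono2)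
  then have "\<not> cycles N (- ((\<Sum>j<n. int (G j)) + int n)) (\<lambda>j. t j - V j)
      \<subseteq> bnds N (- ((\<Sum>j<n. int (G j)) + int n)) (\<lambda>j. t j - V j)"
    using coh[OF sub(1)[of V] sub(2)[of V]] by blast
  then have \<gamma>: "\<gamma> = (\<Sum>j<n. int (G j))"
    using assms(9) sub(1)[of V] unfolding N_def[symmetric] coh_vanish_def
    by (metis add_right_cancel)
  obtain f where f: "\<And>a. a \<in> Dn n \<Longrightarrow> (\<forall>z\<in>cycles N (- (\<gamma> + int n)) a. f a z \<in> sp ?M 0 a) \<and>
      (\<forall>z\<in>cycles N (- (\<gamma> + int n)) a. f a z = vzero \<longleftrightarrow> z \<in> bnds N (- (\<gamma> + int n)) a) \<and>
      (\<forall>w\<in>sp ?M 0 a. \<exists>z\<in>cycles N (- (\<gamma> + int n)) a. f a z = w)"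
    using assms(10) unfolding N_def[symmetric] coh_iso_graded_def by blast
  have box: "(\<forall>j<n. t j - V j \<le> a j \<and> a j \<le> t j - U j) \<longleftrightarrow> (\<forall>j<n. t j - v j \<le> a j \<and> a j \<le> t j - u j)"
    if a: "a \<in> Dn n" "a \<le> t" for a
  proof -
    have "(\<forall>j<n. t j - V j \<le> a j \<and> a j \<le> t j - U j) \<longleftrightarrow>
        \<not> cycles N (- (\<gamma> + int n)) a \<subseteq> bnds N (- (\<gamma> + int n)) a"
      using coh[OF a, of "\<gamma> + int n"] \<gamma> by blast
    also have "\<dots> \<longleftrightarrow> \<not> sp ?M 0 a \<subseteq> {vzero}"
      using f[OF a(1)] by fastforce
    \<comment> \<open>Through \<open>f\<close> the cohomology at \<open>a\<close> is nonzero exactly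
      if the piece of the interval module at \<open>a\<close> is.\<close>
    also have "\<dots> \<longleftrightarrow> (\<lambda>j. t j - v j) \<le> a \<and> a \<le> (\<lambda>j. t j - u j)"
    proof -
      have "(\<lambda>l::nat. if l = 0 then 1 else 0 :: 'k) \<in> kline" by (simp add: kline_def)
      moreover have "(\<lambda>l::nat. if l = 0 then 1 else 0 :: 'k) \<noteq> vzero"
        by (auto simp: vzero_def fun_eq_iff)
      ultimately have "\<not> (kline :: 'k vec set) \<subseteq> {vzero}" by blast
      moreover have "(\<lambda>j. t j - v j) \<le> (\<lambda>j. t j - u j)"
        using uv by (auto simp: le_fun_def intro: diff_le_mono2)
      ultimately show ?thesis using ptrunc_le[OF a(2)] by (simp add: Kint_def)
    qed
    also have "\<dots> \<longleftrightarrow> (\<forall>j<n. t j - v j \<le> a j \<and> a j \<le> t j - u j)"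
    proof -
      have "t j - v j \<le> a j \<and> a j \<le> t j - u j" if "\<not> j < n" for j
        using that t a(1) by (auto simp: Dn_def)
      then show ?thesis by (auto simp: le_fun_def)
    qed
    finally show ?thesis .
  qed
  \<comment> \<open>Both boxes are nonempty and contain their own corners. As they have the same
    points in \<open>[0, t]\<close>, each contains the corners of the other, which forces equal
    bounds.\<close>
  have in_box: "\<forall>j<n. t j - V j \<le> t j - w j \<and> t j - w j \<le> t j - U j" if "w = U \<or> w = V" for w
    using that UV by (auto intro: diff_le_mono2)
  have in_box': "\<forall>j<n. t j - v j \<le> t j - w j \<and> t j - w j \<le> t j - u j" if "w = u \<or> w = v" for w
    using that uv by (auto intro: diff_le_mono2)
  have "U j = u j \<and> V j = v j" for j
  proof (cases "j < n")
    case True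
    have "t j - v j \<le> t j - V j" "t j - U j \<le> t j - u j"
      using box[OF sub, of V] box[OF sub, of U] in_box True by auto
    moreover have "t j - V j \<le> t j - v j" "t j - u j \<le> t j - U j"
      using box[OF sub, of v] box[OF sub, of u] in_box' True by auto
    ultimately show ?thesis using UV[of j] uv[of j] by linarith
  next
    case False
    then show ?thesis using UVn assms(5,6) by (simp add: Dn_def)
  qed
  then have eq: "U = u" "V = v" by auto
  have u_t: "u \<le> t" using assms(7,8) by (rule order_trans)
  show ?thesis
  proof (intro allI impI)
    fix I :: "deg set" and i :: int
    assume I: "monideal n I \<and> pos_tdet_ideal t I"
    then have "unit_module n t (Dn n - I) (quotI n I :: 'k gcx)"
      by (intro unit_module_quotI) auto
    from Nk_quot_iso[OF this r s UVn(1), where i = i]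
    show "quot_iso (cycles (Nk t k n (quotI n I :: 'k gcx)) (-i) r)
                    (bnds (Nk t k n (quotI n I :: 'k gcx)) (-i) r)
                    (rcycles (Delta n t I u v) (i - \<gamma> - 1) :: (nat set \<Rightarrow> 'k) set)
                    (rbnds (Delta n t I u v) (i - \<gamma> - 1))"
      unfolding eq \<gamma> Delta_eq[OF t assms(5) u_t] .
  qed
qed

end
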